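(* Let $y\in\mathbb T^N\setminus\mathcal A$. Then the interior of $F_\beta(y)$ (in $\mathbb R^m$) is nonempty, and $\mathbf b\in\mathbb R^m$ is an internal point of $F_\beta(y)$ if and only if there is a critical subsolution $\mathbf u$, locally strict at $y$, with $\mathbf u(y)=\mathbf b$.
   Context: $\mathbb T^N=\mathbb R^N/\mathbb Z^N$ is the flat torus, $m\ge 2$. For $\alpha\in\mathbb R$ consider the weakly coupled system $$H_i(x,Du_i)+\sum_{j=1}^m a_{ij}u_j(x)=\alpha\quad\text{in }\mathbb T^N,\ i=1,\dots,m,\qquad (\mathrm{HJ}\alpha)$$ with unknown $\mathbf u=(u_1,\dots,u_m):\mathbb T^N\to\mathbb R^m$. Each $H_i:\mathbb T^N\times\mathbb R^N\to\mathbb R$ is continuous, and $p\mapsto H_i(x,p)$ is convex and superlinear for every $x$. The $m\times m$ real matrix $A=(a_{ij})$ satisfies: $a_{ij}\le 0$ for $i\ne j$; $\sum_j a_{ij}=0$ for all $i$; $A$ is irreducible, i.e. for every nonempty $W\subsetneq\{1,\dots,m\}$ there are $i\in W$, $j\notin W$ with $a_{ij}<0$. (Sub/super)solutions are understood in the viscosity sense: a continuous $\mathbf u$ is a subsolution (resp. supersolution) if for every $i$, every $x$ and every $C^1$ function $\varphi$ such that $u_i-\varphi$ has a local maximum (resp. minimum) at $x$, $H_i(x,D\varphi(x))+\sum_j a_{ij}u_j(x)\le\alpha$ (resp. $\ge\alpha$); a solution is both. Subsolutions are Lipschitz and coincide with Lipschitz a.e. subsolutions. The critical value is $\beta=\inf\{\alpha: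 (\mathrm{HJ}\alpha)\text{ admits subsolutions}\}$, a real number; critical (sub)solutions are (sub)solutions of $(\mathrm{HJ}\beta)$. For $y\in\mathbb T^N$, $F_\beta(y)=\{\mathbf b\in\mathbb R^m:\exists\,\mathbf u\text{ critical subsolution with }\mathbf u(y)=\mathbf b\}$. The Aubry set $\mathcal A\subset\mathbb T^N$ is the set of points $y$ such that, for every $\mathbf b\in F_\beta(y)$, the maximal critical subsolution taking the value $\mathbf b$ at $y$ is a solution of $(\mathrm{HJ}\beta)$. A critical subsolution $\mathbf u$ is locally strict at $y$ if there are a neighborhood $U$ of $y$ and a constant $\delta>0$ with $H_i(x,Du_i(x))+\sum_j a_{ij}u_j(x)\le\beta-\delta$ for every $i\in\{1,\dots,m\}$ and a.e. $x\in U$. *)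

theory Defs
  imports "HOL-Analysis.Analysis"
begin

(* Functions on the flat torus R^N/Z^N are identified with the Z^N-periodic functions on R^N;
   points and subsets of the torus are represented by their lifts to R^N. *)
definition zperiodic :: "((real^'n::finite) \<Rightarrow> 'b) \<Rightarrow> bool" where
  "zperiodic f \<longleftrightarrow> (\<forall>x k. (\<forall>j. k $ j \<in> \<int>) \<longrightarrow> f (x + k) = f x)"

definition irreducible_coupling :: "real^'m^'m::finite \<Rightarrow> bool" where
  "irreducible_coupling A \<longleftrightarrow>
     (\<forall>W. W \<noteq> {} \<and> W \<subset> UNIV \<longrightarrow> (\<exists>i\<in>W. \<exists>j. j \<notin> W \<and> A $ i $ j < 0))"

definition C1_torus :: "((real^'n::finite) \<Rightarrow> real) \<Rightarrow> (real^'n \<Rightarrow> real^'n) \<Rightarrow> bool" where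
  "C1_torus \<phi> D\<phi> \<longleftrightarrow>
     zperiodic \<phi> \<and> (\<forall>x. GDERIV \<phi> x :> D\<phi> x) \<and> continuous_on UNIV D\<phi>"

definition local_max_at :: "('a::topological_space \<Rightarrow> real) \<Rightarrow> 'a \<Rightarrow> bool" where
  "local_max_at g x \<longleftrightarrow> (\<forall>\<^sub>F z in nhds x. g z \<le> g x)"

definition local_min_at :: "('a::topological_space \<Rightarrow> real) \<Rightarrow> 'a \<Rightarrow> bool" where
  "local_min_at g x \<longleftrightarrow> (\<forall>\<^sub>F z in nhds x. g x \<le> g z)"

definition subsolution ::
  "('m::finite \<Rightarrow> real^'n::finite \<Rightarrow> real^'n \<Rightarrow> real) \<Rightarrow> real^'m^'m \<Rightarrow> real
     \<Rightarrow> (real^'n \<Rightarrow> real^'m) \<Rightarrow> bool" where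
  "subsolution H A \<alpha> u \<longleftrightarrow> zperiodic u \<and> continuous_on UNIV u \<and>
     (\<forall>i x \<phi> D\<phi>. C1_torus \<phi> D\<phi> \<and> local_max_at (\<lambda>z. u z $ i - \<phi> z) x \<longrightarrow>
        H i x (D\<phi> x) + (\<Sum>j\<in>UNIV. A $ i $ j * u x $ j) \<le> \<alpha>)"

definition supersolution ::
  "('m::finite \<Rightarrow> real^'n::finite \<Rightarrow> real^'n \<Rightarrow> real) \<Rightarrow> real^'m^'m \<Rightarrow> real
     \<Rightarrow> (real^'n \<Rightarrow> real^'m) \<Rightarrow> bool" where
  "supersolution H A \<alpha> u \<longleftrightarrow> zperiodic u \<and> continuous_on UNIV u \<and>
     (\<forall>i x \<phi> D\<phi>. C1_torus \<phi> D\<phi> \<and> local_min_at (\<lambda>z. u z $ i - \<phi> z) x \<longrightarrow>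
        H i x (D\<phi> x) + (\<Sum>j\<in>UNIV. A $ i $ j * u x $ j) \<ge> \<alpha>)"

definition solution ::
  "('m::finite \<Rightarrow> real^'n::finite \<Rightarrow> real^'n \<Rightarrow> real) \<Rightarrow> real^'m^'m \<Rightarrow> real
     \<Rightarrow> (real^'n \<Rightarrow> real^'m) \<Rightarrow> bool" where
  "solution H A \<alpha> u \<longleftrightarrow> subsolution H A \<alpha> u \<and> supersolution H A \<alpha> u"

definition critical_value ::
  "('m::finite \<Rightarrow> real^'n::finite \<Rightarrow> real^'n \<Rightarrow> real) \<Rightarrow> real^'m^'m \<Rightarrow> real" where
  "critical_value H A = Inf {\<alpha>. \<exists>u. subsolution H A \<alpha> u}"

abbreviation critical_subsolution ::
  "('m::finite \<Rightarrow> real^'n::finite \<Rightarrow> real^'n \<Rightarrow> real) \<Rightarrow> real^'m^'m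
     \<Rightarrow> (real^'n \<Rightarrow> real^'m) \<Rightarrow> bool" where
  "critical_subsolution H A \<equiv> subsolution H A (critical_value H A)"

abbreviation critical_solution ::
  "('m::finite \<Rightarrow> real^'n::finite \<Rightarrow> real^'n \<Rightarrow> real) \<Rightarrow> real^'m^'m
     \<Rightarrow> (real^'n \<Rightarrow> real^'m) \<Rightarrow> bool" where
  "critical_solution H A \<equiv> solution H A (critical_value H A)"

definition critical_subsolution_values ::
  "('m::finite \<Rightarrow> real^'n::finite \<Rightarrow> real^'n \<Rightarrow> real) \<Rightarrow> real^'m^'m
     \<Rightarrow> real^'n \<Rightarrow> (real^'m) set" where
  "critical_subsolution_values H A y = {b. \<exists>u. critical_subsolution H A u \<and> u y = b}"

(* Maximal means greatest in the componentwise, pointwise order; such a u is unique. *)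
definition maximal_critical_subsolution ::
  "('m::finite \<Rightarrow> real^'n::finite \<Rightarrow> real^'n \<Rightarrow> real) \<Rightarrow> real^'m^'m
     \<Rightarrow> real^'n \<Rightarrow> real^'m \<Rightarrow> (real^'n \<Rightarrow> real^'m) \<Rightarrow> bool" where
  "maximal_critical_subsolution H A y b u \<longleftrightarrow>
     critical_subsolution H A u \<and> u y = b \<and>
     (\<forall>v. critical_subsolution H A v \<and> v y = b \<longrightarrow> (\<forall>x i. v x $ i \<le> u x $ i))"

definition aubry_set ::
  "('m::finite \<Rightarrow> real^'n::finite \<Rightarrow> real^'n \<Rightarrow> real) \<Rightarrow> real^'m^'m \<Rightarrow> (real^'n) set" where
  "aubry_set H A = {y. \<forall>b\<in>critical_subsolution_values H A y.
     \<exists>u. maximal_critical_subsolution H A y b u \<and> critical_solution H A u}"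

(* The a.e. inequality includes the a.e. existence of the gradient Du_i, which is automatic
   for subsolutions because they are Lipschitz. *)
definition locally_strict_at ::
  "('m::finite \<Rightarrow> real^'n::finite \<Rightarrow> real^'n \<Rightarrow> real) \<Rightarrow> real^'m^'m
     \<Rightarrow> (real^'n \<Rightarrow> real^'m) \<Rightarrow> real^'n \<Rightarrow> bool" where
  "locally_strict_at H A u y \<longleftrightarrow>
     (\<exists>U \<delta>. open U \<and> y \<in> U \<and> \<delta> > 0 \<and>
        (\<forall>i. AE x in lebesgue. x \<in> U \<longrightarrow>
           (\<exists>p. GDERIV (\<lambda>z. u z $ i) x :> p \<and>
                H i x p + (\<Sum>j\<in>UNIV. A $ i $ j * u x $ j) \<le> critical_value H A - \<delta>)))"

end

theory Submission
  imports Defs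
begin

text \<open>
  Functions on the torus are treated through their superdifferentials, the sets of gradients of
  test functions touching from above. For a convex coercive Hamiltonian the viscosity inequality
  amounts, up to arbitrarily small errors, to a local bound on increments in every direction by
  the support function of a sublevel set of \<open>H\<close>. The two halves of this principle
  (\<open>superdiff_bound_imp_increment\<close> and \<open>increment_bound_imp_superdiff\<close>) give the equi-Lipschitz
  bound for subsolutions, the stability under convex combinations, and, together with
  \<open>ae_gradient_bound_imp_increment\<close>, the passage from an inequality almost everywhere to the
  viscosity inequality. In particular Rademacher's theorem is avoided: a subsolution that has to be
  differentiable almost everywhere near \<open>y\<close> is constructed to be \<open>C\<^sup>1\<close> there.

  Call a component strict at \<open>y\<close> if its superdifferentials near \<open>y\<close> satisfy the inequality with
  a uniform gap. If \<open>y\<close> is not in the Aubry set, some maximal critical subsolution with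
  prescribed value at \<open>y\<close> fails to be a supersolution. By maximality it can fail only at \<open>y\<close>, and
  raising the failing component there by its own test function makes this component strict
  (\<open>bump_where_supersolution_fails\<close>). A strict component can be raised a little
  further, which lowers the coupling term of every other equation linked to it and makes that
  equation strict as well; by irreducibility all components become strict
  (\<open>strict_everywhere_from_one\<close>).

  A subsolution \<open>u\<close> that is strict at \<open>y\<close> in all components can be perturbed by a small bump in any
  direction of \<open>\<real>\<^sup>m\<close>, so \<open>u y\<close> is interior to the set of values (\<open>strict_value_interior\<close>). This
  gives the nonempty interior and, since local strictness almost everywhere implies strictness
  of all components (\<open>strict_at_if_ae_strict\<close>), one direction of the equivalence.
  Conversely, an interior point \<open>b\<close> is a convex combination of the value of a strict
  subsolution and of another value, with positive weight on the former. The same combination of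
  the subsolutions is strict (\<open>strict_convex_combination\<close>). It is finally made \<open>C\<^sup>1\<close> near \<open>y\<close>
  without changing its value there (\<open>smooth_strict_with_same_value\<close>): each component is replaced by
  a smoothed concave cone with vertex above \<open>y\<close>, steep enough to fall below the component within a
  small neighbourhood, and a constant vector is subtracted.
\<close>

section \<open>Periodic test functions\<close>

lemma C1_torus_const: "C1_torus (\<lambda>z. c) (\<lambda>z. 0)"
  unfolding C1_torus_def zperiodic_def by (auto intro: GDERIV_const)

lemma C1_torus_add:
  assumes "C1_torus f Df" "C1_torus g Dg"
  shows "C1_torus (\<lambda>z. f z + g z) (\<lambda>z. Df z + Dg z)"
  using assms unfolding C1_torus_def zperiodic_def
  by (auto intro!: GDERIV_add continuous_intros)

lemma C1_torus_chain:
  fixes F F' :: "real \<Rightarrow> real"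
  assumes f: "C1_torus f Df"
    and F: "\<And>z. (F has_real_derivative F' (f z)) (at (f z))"
    and F': "continuous_on UNIV (\<lambda>z. F' (f z))"
  shows "C1_torus (\<lambda>z. F (f z)) (\<lambda>z. F' (f z) *\<^sub>R Df z)"
  using f F' unfolding C1_torus_def zperiodic_def
  by (auto intro!: GDERIV_DERIV_compose[where f = f and g = F] F continuous_intros)

lemma C1_torus_cmult:
  assumes "C1_torus f Df"
  shows "C1_torus (\<lambda>z. c * f z) (\<lambda>z. c *\<^sub>R Df z)"
  by (rule C1_torus_chain[OF assms, where F = "\<lambda>s. c * s" and F' = "\<lambda>s. c"])
    (auto intro!: derivative_eq_intros)

lemma C1_torus_diff:
  assumes "C1_torus f Df" "C1_torus g Dg"
  shows "C1_torus (\<lambda>z. f z - g z) (\<lambda>z. Df z - Dg z)"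
  using C1_torus_add[OF assms(1) C1_torus_cmult[OF assms(2), of "-1"]] by simp

lemma C1_torus_sum:
  assumes "finite I" "\<And>i. i \<in> I \<Longrightarrow> C1_torus (f i) (Df i)"
  shows "C1_torus (\<lambda>z. \<Sum>i\<in>I. f i z) (\<lambda>z. \<Sum>i\<in>I. Df i z)"
  using assms
  by (induction I rule: finite_induct) (auto intro: C1_torus_add C1_torus_const)

lemma C1_torus_continuous:
  assumes "C1_torus f Df"
  shows "continuous_on UNIV f" "continuous_on UNIV Df"
proof -
  have "(f has_derivative (\<lambda>h. h \<bullet> Df x)) (at x)" for x
    using assms by (auto simp: C1_torus_def gderiv_def)
  then show "continuous_on UNIV f"
    by (meson continuous_at_imp_continuous_on has_derivative_continuous)
  show "continuous_on UNIV Df" using assms by (auto simp: C1_torus_def)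
qed

lemma C1_torus_gradient_shift:
  assumes "C1_torus \<phi> D\<phi>" and k: "\<forall>j. k $ j \<in> \<int>"
  shows "D\<phi> (x + k) = D\<phi> x"
proof -
  have *: "(\<phi> has_derivative (\<lambda>h. h \<bullet> D\<phi> z)) (at z)" for z
    using assms by (auto simp: C1_torus_def gderiv_def)
  have "((\<lambda>z. z + k) has_derivative (\<lambda>h. h)) (at x)" by (auto intro!: derivative_eq_intros)
  from has_derivative_compose[OF this *] have "((\<lambda>z. \<phi> (z + k)) has_derivative (\<lambda>h. h \<bullet> D\<phi> (x + k))) (at x)" .
  moreover have "(\<lambda>z. \<phi> (z + k)) = \<phi>" using assms by (auto simp: C1_torus_def zperiodic_def)
  ultimately have "(\<lambda>h. h \<bullet> D\<phi> (x + k)) = (\<lambda>h. h \<bullet> D\<phi> x)"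
    using has_derivative_unique[OF _ *] by simp
  then have "(D\<phi> (x + k) - D\<phi> x) \<bullet> (D\<phi> (x + k) - D\<phi> x) = 0"
    by (metis inner_diff_right eq_iff_diff_eq_0)
  then show ?thesis by simp
qed

lemma sin_int_shift_squared:
  assumes "k \<in> \<int>"
  shows "(sin (pi * (t + k)))\<^sup>2 = (sin (pi * t))\<^sup>2"
proof -
  obtain n where n: "k = of_int n" using assms Ints_cases by blast
  have s: "sin (pi * of_int n) = 0" by (rule sin_npi_int)
  have "sin (pi * (t + k)) = sin (pi * t) * cos (pi * of_int n)"
    using s by (simp add: n distrib_left sin_add)
  moreover have "(cos (pi * of_int n))\<^sup>2 = 1"
    by (simp only: cos_squared_eq s) simp
  ultimately show ?thesis by (simp add: power_mult_distrib)
qed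

lemma sin_2pi_int_shift:
  assumes "k \<in> \<int>"
  shows "sin (2 * pi * (t + k)) = sin (2 * pi * t)"
proof -
  obtain n where n: "k = of_int n" using assms Ints_cases by blast
  have s: "sin (2 * pi * of_int n) = 0" and c: "cos (2 * pi * of_int n) = 1"
    using sin_int_2pin[of n] cos_int_2pin[of n] by (auto simp: mult_ac)
  have "sin (2 * pi * (t + k)) = sin (2 * pi * t) * 1 + cos (2 * pi * t) * 0"
    unfolding n distrib_left sin_add s c by (rule refl)
  then show ?thesis by simp
qed

text \<open>A periodic \<open>C\<^sup>1\<close> substitute for the squared distance to \<open>y\<close>: it vanishes
  exactly on the lattice \<open>y + \<int>\<^sup>N\<close> and dominates the squared distance to that lattice.\<close>

definition sqd :: "real^'n::finite \<Rightarrow> real^'n \<Rightarrow> real" where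
  "sqd y z = (\<Sum>j\<in>UNIV. (sin (pi * (z $ j - y $ j)))\<^sup>2)"

definition Dsqd :: "real^'n::finite \<Rightarrow> real^'n \<Rightarrow> real^'n" where
  "Dsqd y z = (\<chi> j. pi * sin (2 * pi * (z $ j - y $ j)))"

text \<open>A periodic function that agrees with \<open>z \<mapsto> q \<bullet> (z - y)\<close> to second order at \<open>y\<close>.\<close>

definition slin :: "real^'n::finite \<Rightarrow> real^'n \<Rightarrow> real^'n \<Rightarrow> real" where
  "slin y q z = (\<Sum>j\<in>UNIV. q $ j * sin (2 * pi * (z $ j - y $ j)) / (2 * pi))"

definition Dslin :: "real^'n::finite \<Rightarrow> real^'n \<Rightarrow> real^'n \<Rightarrow> real^'n" where
  "Dslin y q z = (\<chi> j. q $ j * cos (2 * pi * (z $ j - y $ j)))"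

lemma C1_torus_coordinate:
  fixes F F' :: "real \<Rightarrow> real"
  assumes F: "\<And>t. (F has_real_derivative F' t) (at t)" and F': "continuous_on UNIV F'"
    and per: "\<And>t k. k \<in> \<int> \<Longrightarrow> F (t + k) = F t"
  shows "C1_torus (\<lambda>z::real^'n::finite. F (z $ j - y $ j))
           (\<lambda>z. F' (z $ j - y $ j) *\<^sub>R axis j 1)"
proof -
  have g: "GDERIV (\<lambda>z::real^'n. z $ j - y $ j) x :> axis j 1" for x
  proof -
    have "((\<lambda>z::real^'n. z $ j) has_derivative (\<lambda>z. z $ j)) (at x)"
      by (rule bounded_linear.has_derivative[OF bounded_linear_vec_nth has_derivative_ident])
    then show ?thesis
      unfolding gderiv_def by (auto intro!: derivative_eq_intros simp: inner_axis)
  qed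
  have p: "F (x $ j + k $ j - y $ j) = F (x $ j - y $ j)" if "\<forall>j. k $ j \<in> \<int>"
    for x k :: "real^'n"
    using per[of "k $ j" "x $ j - y $ j"] that by (simp add: algebra_simps)
  show ?thesis
    unfolding C1_torus_def zperiodic_def
    using p by (auto intro!: GDERIV_DERIV_compose[OF g F] continuous_intros
        continuous_on_compose2[OF F'])
qed

lemma C1_torus_sqd: "C1_torus (sqd y) (Dsqd y)"
proof -
  have "C1_torus (\<lambda>z. \<Sum>j\<in>UNIV. (sin (pi * (z $ j - y $ j)))\<^sup>2)
      (\<lambda>z. \<Sum>j\<in>UNIV. (pi * sin (2 * pi * (z $ j - y $ j))) *\<^sub>R axis j 1)"
  proof (rule C1_torus_sum, simp, rule C1_torus_coordinate)
    fix t :: real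
    have "sin (2 * (pi * t)) = 2 * sin (pi * t) * cos (pi * t)" by (rule sin_double)
    then show "((\<lambda>t. (sin (pi * t))\<^sup>2) has_real_derivative pi * sin (2 * pi * t)) (at t)"
      by (auto intro!: derivative_eq_intros simp: mult_ac)
  qed (auto intro!: continuous_intros simp: sin_int_shift_squared)
  moreover have "(\<Sum>j\<in>UNIV. (pi * sin (2 * pi * (z $ j - y $ j))) *\<^sub>R axis j 1) = Dsqd y z" for z
    by (simp add: Dsqd_def vec_eq_iff axis_def if_distrib[of "\<lambda>x. _ * x"] cong: if_cong)
  ultimately show ?thesis by (simp add: sqd_def[abs_def])
qed

lemma C1_torus_slin: "C1_torus (slin y q) (Dslin y q)"
proof -
  have "C1_torus (\<lambda>z. \<Sum>j\<in>UNIV. q $ j * sin (2 * pi * (z $ j - y $ j)) / (2 * pi))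
      (\<lambda>z. \<Sum>j\<in>UNIV. (q $ j * cos (2 * pi * (z $ j - y $ j))) *\<^sub>R axis j 1)"
    by (rule C1_torus_sum, simp, rule C1_torus_coordinate)
      (auto intro!: continuous_intros derivative_eq_intros simp: sin_2pi_int_shift)
  moreover have "(\<Sum>j\<in>UNIV. (q $ j * cos (2 * pi * (z $ j - y $ j))) *\<^sub>R axis j 1) = Dslin y q z" for z
    by (simp add: Dslin_def vec_eq_iff axis_def if_distrib[of "\<lambda>x. _ * x"] cong: if_cong)
  ultimately show ?thesis by (simp add: slin_def[abs_def])
qed

lemma sqd_self [simp]: "sqd y y = 0" and Dsqd_self [simp]: "Dsqd y y = 0"
  by (auto simp: sqd_def Dsqd_def vec_eq_iff)

lemma sqd_nonneg: "0 \<le> sqd y z"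
  by (simp add: sqd_def sum_nonneg)

lemma slin_self [simp]: "slin y q y = 0" and Dslin_self [simp]: "Dslin y q y = q"
  by (auto simp: slin_def Dslin_def)

lemma square_le_sin_pi_square:
  fixes t :: real
  assumes "\<bar>t\<bar> \<le> 1/2"
  shows "t\<^sup>2 \<le> (sin (pi * t))\<^sup>2"
proof -
  have *: "s \<le> sin (pi * s)" if s: "0 \<le> s" "s \<le> 1/2" for s :: real
  proof -
    define x where "x = pi * s"
    have x: "0 \<le> x" "x \<le> 2" "x \<ge> 3 * s"
      using s pi_gt3 pi_less_4 mult_mono[of pi 4 s "1/2"] mult_right_mono[of 3 pi s]
      by (auto simp: x_def)
    have "\<bar>sin x - (\<Sum>m<3. sin_coeff m * x ^ m)\<bar> \<le> inverse (fact 3) * \<bar>x\<bar> ^ 3"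
      by (rule Maclaurin_sin_bound)
    moreover have "(\<Sum>m<3. sin_coeff m * x ^ m) = x"
      by (simp add: numeral_3_eq_3 sin_coeff_def)
    ultimately have "\<bar>sin x - x\<bar> \<le> x ^ 3 / 6"
      using x by (simp add: fact_numeral)
    then have "sin x \<ge> x - x ^ 3 / 6" by linarith
    moreover have "x ^ 3 \<le> 4 * x"
      using x mult_mono[of x 2 x 2] mult_right_mono[of "x * x" 4 x]
      by (simp add: power3_eq_cube)
    ultimately show ?thesis using x by (simp add: x_def[symmetric])
  qed
  have "\<bar>t\<bar> \<le> \<bar>sin (pi * t)\<bar>"
    using *[of t] *[of "- t"] assms by (cases "t \<ge> 0") auto
  then show ?thesis by (simp add: abs_le_square_iff)
qed

lemma norm_square_sum: "(norm (x::real^'n::finite))\<^sup>2 = (\<Sum>j\<in>UNIV. (x $ j)\<^sup>2)"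
  by (simp add: norm_vec_def L2_set_def sum_nonneg)

lemma norm_square_le_sqd:
  fixes y z :: "real^'n::finite"
  assumes "norm (z - y) \<le> 1/2"
  shows "(norm (z - y))\<^sup>2 \<le> sqd y z"
  unfolding norm_square_sum sqd_def
proof (rule sum_mono)
  fix j :: 'n
  have "\<bar>z $ j - y $ j\<bar> \<le> 1/2"
    using component_le_norm_cart[of "z - y" j] assms by simp
  then show "((z - y) $ j)\<^sup>2 \<le> (sin (pi * (z $ j - y $ j)))\<^sup>2"
    using square_le_sin_pi_square[of "z $ j - y $ j"] by simp
qed

lemma lattice_distance_le_sqd:
  fixes y z :: "real^'n::finite"
  obtains k where "\<forall>j. k $ j \<in> \<int>" "(norm (z + k - y))\<^sup>2 \<le> sqd y z"
proof
  define k :: "real^'n" where "k = (\<chi> j. - of_int (round (z $ j - y $ j)))"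
  show k: "\<forall>j. k $ j \<in> \<int>" by (simp add: k_def)
  show "(norm (z + k - y))\<^sup>2 \<le> sqd y z"
    unfolding norm_square_sum sqd_def
  proof (rule sum_mono)
    fix j :: 'n
    let ?t = "z $ j - y $ j"
    have "\<bar>?t - of_int (round ?t)\<bar> \<le> 1/2"
      using of_int_round_abs_le[of ?t] by (simp add: abs_minus_commute)
    from square_le_sin_pi_square[OF this] sin_int_shift_squared[of "k $ j" ?t] k
    show "((z + k - y) $ j)\<^sup>2 \<le> (sin (pi * ?t))\<^sup>2"
      by (simp add: k_def algebra_simps)
  qed
qed

lemma slin_approx:
  "\<bar>slin y q z - q \<bullet> (z - y)\<bar> \<le> pi * norm q * (norm (z - y))\<^sup>2"
proof -
  have e: "\<bar>sin (2 * pi * t) / (2 * pi) - t\<bar> \<le> pi * t\<^sup>2" for t :: real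
  proof -
    have "\<bar>sin (2 * pi * t) - (\<Sum>m<2. sin_coeff m * (2 * pi * t) ^ m)\<bar>
        \<le> inverse (fact 2) * \<bar>2 * pi * t\<bar> ^ 2"
      by (rule Maclaurin_sin_bound)
    moreover have "(\<Sum>m<2. sin_coeff m * (2 * pi * t) ^ m) = 2 * pi * t"
      by (simp add: numeral_2_eq_2 sin_coeff_def)
    ultimately have "\<bar>sin (2 * pi * t) - 2 * pi * t\<bar> \<le> (2 * pi * t)\<^sup>2 / 2"
      by (simp add: fact_numeral)
    moreover have "\<bar>sin (2 * pi * t) / (2 * pi) - t\<bar> = \<bar>sin (2 * pi * t) - 2 * pi * t\<bar> / (2 * pi)"
      by (simp add: field_simps abs_divide flip: abs_divide[of _ "2 * pi", simplified])
    ultimately show ?thesis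
      by (simp add: field_simps power2_eq_square)
  qed
  have "slin y q z - q \<bullet> (z - y)
      = (\<Sum>j\<in>UNIV. q $ j * (sin (2 * pi * (z $ j - y $ j)) / (2 * pi) - (z $ j - y $ j)))"
    by (simp add: slin_def inner_vec_def algebra_simps sum.distrib sum_subtractf)
  also have "\<bar>\<dots>\<bar> \<le> (\<Sum>j\<in>UNIV. norm q * (pi * ((z - y) $ j)\<^sup>2))"
  proof (rule order_trans[OF sum_abs], rule sum_mono)
    fix j
    show "\<bar>q $ j * (sin (2 * pi * (z $ j - y $ j)) / (2 * pi) - (z $ j - y $ j))\<bar>
        \<le> norm q * (pi * ((z - y) $ j)\<^sup>2)"
      unfolding abs_mult
      using e[of "z $ j - y $ j"] component_le_norm_cart[of q j]
      by (intro mult_mono) auto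
  qed
  also have "\<dots> = pi * norm q * (norm (z - y))\<^sup>2"
    unfolding norm_square_sum by (simp add: sum_distrib_left mult_ac)
  finally show ?thesis .
qed

lemma zperiodic_sqd: "zperiodic (sqd y)"
  using C1_torus_sqd by (auto simp: C1_torus_def)

lemma has_derivative_max0_square:
  fixes t :: real
  shows "((\<lambda>s. (max 0 s)\<^sup>2) has_real_derivative 2 * max 0 t) (at t)"
proof -
  consider "t > 0" | "t < 0" | "t = 0" by linarith
  then show ?thesis
  proof cases
    case 1
    have "((\<lambda>s. s\<^sup>2) has_real_derivative 2 * max 0 t) (at t)"
      using 1 by (auto intro!: derivative_eq_intros)
    then show ?thesis
      by (rule has_field_derivative_transform_within_open[where S = "{0<..}"]) (use 1 in auto)
  next
    case 2
    have "((\<lambda>s. 0) has_real_derivative 2 * max 0 t) (at t)"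
      using 2 by (auto intro!: derivative_eq_intros)
    then show ?thesis
      by (rule has_field_derivative_transform_within_open[where S = "{..<0}"]) (use 2 in auto)
  next
    case 3
    have "((\<lambda>h::real. (max 0 h)\<^sup>2 / h) \<longlongrightarrow> 0) (at 0)"
    proof (rule Lim_null_comparison)
      show "\<forall>\<^sub>F h::real in at 0. norm ((max 0 h)\<^sup>2 / h) \<le> \<bar>h\<bar>"
        by (rule eventuallyI) (auto simp: max_def power2_eq_square)
      show "((\<lambda>h. \<bar>h\<bar>) \<longlongrightarrow> 0) (at (0::real))"
        by (auto intro!: tendsto_eq_intros)
    qed
    then show ?thesis using 3 by (simp add: DERIV_def)
  qed
qed

text \<open>Pushing a test function below a given function away from the lattice \<open>y + \<int>\<^sup>N\<close>
  without changing it near that lattice; this is how local modifications are made periodic.\<close>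

lemma C1_torus_push_below:
  fixes f g :: "real^'n::finite \<Rightarrow> real"
  assumes g: "C1_torus g Dg" and bound: "\<And>z. g z - f z \<le> B"
    and "\<rho>1 < \<rho>" and below: "\<And>z. \<rho>1 \<le> sqd y z \<Longrightarrow> sqd y z < \<rho> \<Longrightarrow> g z < f z"
  obtains h Dh where "C1_torus h Dh"
    "\<And>z. sqd y z \<le> \<rho>1 \<Longrightarrow> h z = g z \<and> Dh z = Dg z"
    "\<And>z. \<rho>1 \<le> sqd y z \<Longrightarrow> h z < f z"
proof
  define M where "M = (\<bar>B\<bar> + 1) / (\<rho> - \<rho>1)\<^sup>2"
  have M: "M > 0" "M * (\<rho> - \<rho>1)\<^sup>2 = \<bar>B\<bar> + 1"
    using \<open>\<rho>1 < \<rho>\<close> by (auto simp: M_def)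
  let ?F = "\<lambda>s. (max 0 (s - \<rho>1))\<^sup>2"
  have "C1_torus (\<lambda>z. ?F (sqd y z)) (\<lambda>z. (2 * max 0 (sqd y z - \<rho>1)) *\<^sub>R Dsqd y z)"
  proof (rule C1_torus_chain[OF C1_torus_sqd, where F = ?F and F' = "\<lambda>s. 2 * max 0 (s - \<rho>1)"])
    fix z
    show "(?F has_real_derivative 2 * max 0 (sqd y z - \<rho>1)) (at (sqd y z))"
    proof -
      have "((\<lambda>s. s - \<rho>1) has_real_derivative 1) (at (sqd y z))"
        by (auto intro!: derivative_eq_intros)
      from DERIV_chain2[OF has_derivative_max0_square this] show ?thesis by simp
    qed
  qed (intro continuous_intros C1_torus_continuous(1)[OF C1_torus_sqd])
  from C1_torus_diff[OF g C1_torus_cmult[OF this, of M]]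
  show "C1_torus (\<lambda>z. g z - M * ?F (sqd y z))
     (\<lambda>z. Dg z - M *\<^sub>R (2 * max 0 (sqd y z - \<rho>1)) *\<^sub>R Dsqd y z)" by simp
  show "g z - M * ?F (sqd y z) = g z \<and>
      Dg z - M *\<^sub>R (2 * max 0 (sqd y z - \<rho>1)) *\<^sub>R Dsqd y z = Dg z" if "sqd y z \<le> \<rho>1" for z
    using that by simp
  show "g z - M * ?F (sqd y z) < f z" if "\<rho>1 \<le> sqd y z" for z
  proof (cases "sqd y z < \<rho>")
    case True
    have "0 \<le> M * ?F (sqd y z)" using M by simp
    with below[OF that True] show ?thesis by linarith
  next
    case False
    have "(\<rho> - \<rho>1)\<^sup>2 \<le> ?F (sqd y z)"
      using False \<open>\<rho>1 < \<rho>\<close> by (intro power_mono) auto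
    then have "\<bar>B\<bar> + 1 \<le> M * ?F (sqd y z)"
      using M mult_left_mono[of "(\<rho> - \<rho>1)\<^sup>2" "?F (sqd y z)" M] by simp
    with bound[of z] show ?thesis by linarith
  qed
qed

section \<open>Superdifferentials\<close>

text \<open>Collecting the gradients of all touching test functions turns the viscosity inequality into
  a condition on pairs of a point and a covector.\<close>

definition superdiff :: "(real^'n::finite \<Rightarrow> real) \<Rightarrow> real^'n \<Rightarrow> (real^'n) set" where
  "superdiff f x = {D\<phi> x | \<phi> D\<phi>. C1_torus \<phi> D\<phi> \<and> local_max_at (\<lambda>z. f z - \<phi> z) x}"

lemma superdiffI:
  assumes "C1_torus \<phi> D\<phi>" "\<forall>\<^sub>F z in nhds x. f z - \<phi> z \<le> f x - \<phi> x"
  shows "D\<phi> x \<in> superdiff f x"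
  using assms unfolding superdiff_def local_max_at_def by blast

lemma superdiffE:
  assumes "p \<in> superdiff f x"
  obtains \<phi> D\<phi> where "C1_torus \<phi> D\<phi>" "\<forall>\<^sub>F z in nhds x. f z - \<phi> z \<le> f x - \<phi> x" "p = D\<phi> x"
  using assms unfolding superdiff_def local_max_at_def by blast

lemma subsolution_iff_superdiff:
  "subsolution H A \<alpha> u \<longleftrightarrow> zperiodic u \<and> continuous_on UNIV u \<and>
     (\<forall>i x. \<forall>p\<in>superdiff (\<lambda>z. u z $ i) x. H i x p + (A *v u x) $ i \<le> \<alpha>)"
proof -
  have "(\<forall>i x \<phi> D\<phi>. C1_torus \<phi> D\<phi> \<and> local_max_at (\<lambda>z. u z $ i - \<phi> z) x \<longrightarrow>
        H i x (D\<phi> x) + (A *v u x) $ i \<le> \<alpha>)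
      \<longleftrightarrow> (\<forall>i x. \<forall>p\<in>superdiff (\<lambda>z. u z $ i) x. H i x p + (A *v u x) $ i \<le> \<alpha>)"
    unfolding superdiff_def by blast
  then show ?thesis
    unfolding subsolution_def matrix_vector_mult_def by simp
qed

lemma eventually_nhds_norm:
  "(\<forall>\<^sub>F z in nhds x. P z) \<longleftrightarrow> (\<exists>d>0. \<forall>z. norm (z - x) < d \<longrightarrow> P z)"
  by (simp add: eventually_nhds_metric dist_norm)

text \<open>A quadratic touching function on a small ball can be replaced by a periodic
  one, the quadratic error being absorbed by a multiple of \<^const>\<open>sqd\<close>.\<close>

lemma superdiff_proximal:
  assumes r: "r > 0"
    and le: "\<And>w. norm (w - x) < r \<Longrightarrow> f w \<le> f x + p \<bullet> (w - x) + C * (norm (w - x))\<^sup>2"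
  shows "p \<in> superdiff f x"
proof -
  define M where "M = \<bar>C\<bar> + pi * norm p"
  let ?\<phi> = "\<lambda>z. slin x p z + M * sqd x z" and ?D = "\<lambda>z. Dslin x p z + M *\<^sub>R Dsqd x z"
  have C1: "C1_torus ?\<phi> ?D"
    by (intro C1_torus_add C1_torus_slin C1_torus_cmult C1_torus_sqd)
  have "f w - ?\<phi> w \<le> f x - ?\<phi> x" if w: "norm (w - x) < min r (1/2)" for w
  proof -
    have "slin x p w \<ge> p \<bullet> (w - x) - pi * norm p * (norm (w - x))\<^sup>2"
      using slin_approx[of x p w] by linarith
    moreover have "M * (norm (w - x))\<^sup>2 \<le> M * sqd x w"
      using w by (intro mult_left_mono norm_square_le_sqd) (auto simp: M_def)
    moreover have "C * (norm (w - x))\<^sup>2 \<le> \<bar>C\<bar> * (norm (w - x))\<^sup>2"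
      by (intro mult_right_mono) auto
    moreover have "M * (norm (w - x))\<^sup>2 = \<bar>C\<bar> * (norm (w - x))\<^sup>2 + pi * norm p * (norm (w - x))\<^sup>2"
      by (simp add: M_def algebra_simps)
    moreover have "f w \<le> f x + p \<bullet> (w - x) + C * (norm (w - x))\<^sup>2" using le w by simp
    ultimately show ?thesis by simp
  qed
  then have "\<forall>\<^sub>F w in nhds x. f w - ?\<phi> w \<le> f x - ?\<phi> x"
    unfolding eventually_nhds_norm using r by (intro exI[of _ "min r (1/2)"]) auto
  from superdiffI[OF C1 this] show ?thesis by simp
qed

lemma superdiff_mono:
  assumes "p \<in> superdiff f x" "\<forall>\<^sub>F z in nhds x. g z \<le> f z" "g x = f x"
  shows "p \<in> superdiff g x"
proof -
  from assms(1) obtain \<phi> D\<phi> where *: "C1_torus \<phi> D\<phi>"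
    "\<forall>\<^sub>F z in nhds x. f z - \<phi> z \<le> f x - \<phi> x" "p = D\<phi> x" by (rule superdiffE)
  have "\<forall>\<^sub>F z in nhds x. g z - \<phi> z \<le> g x - \<phi> x"
    using *(2) assms(2) by eventually_elim (use assms(3) in auto)
  from superdiffI[OF *(1) this] *(3) show ?thesis by simp
qed

lemma superdiff_GDERIV:
  assumes "p \<in> superdiff f x" "GDERIV f x :> D"
  shows "p = D"
proof -
  from assms(1) obtain \<phi> D\<phi> where *: "C1_torus \<phi> D\<phi>"
    "\<forall>\<^sub>F z in nhds x. f z - \<phi> z \<le> f x - \<phi> x" "p = D\<phi> x" by (rule superdiffE)
  have "GDERIV \<phi> x :> p" using * by (auto simp: C1_torus_def)
  then have "((\<lambda>z. f z - \<phi> z) has_derivative (\<lambda>h. h \<bullet> D - h \<bullet> p)) (at x)"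
    using assms(2) unfolding gderiv_def by (intro has_derivative_diff)
  moreover have "\<forall>\<^sub>F z in at x. f z - \<phi> z \<le> f x - \<phi> x"
    using *(2) by (simp add: eventually_at_filter eventually_mono)
  ultimately have "(\<lambda>h. h \<bullet> D - h \<bullet> p) = (\<lambda>h. 0)" by (rule has_derivative_local_max)
  then have "(D - p) \<bullet> (D - p) = 0"
    by (metis inner_diff_right)
  then show ?thesis by simp
qed

lemma superdiff_add_C1:
  assumes "p \<in> superdiff (\<lambda>z. f z + g z) x" "C1_torus g Dg"
  shows "p - Dg x \<in> superdiff f x"
proof -
  from assms(1) obtain \<phi> D\<phi> where *: "C1_torus \<phi> D\<phi>"
    "\<forall>\<^sub>F z in nhds x. f z + g z - \<phi> z \<le> f x + g x - \<phi> x" "p = D\<phi> x" by (rule superdiffE)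
  have "\<forall>\<^sub>F z in nhds x. f z - (\<phi> z - g z) \<le> f x - (\<phi> x - g x)"
    using *(2) by eventually_elim simp
  from superdiffI[OF C1_torus_diff[OF *(1) assms(2)] this] *(3) show ?thesis by simp
qed

lemma superdiff_shift:
  assumes p: "p \<in> superdiff f x" and f: "zperiodic f" and k: "\<forall>j. k $ j \<in> \<int>"
  shows "p \<in> superdiff f (x + k)"
proof -
  from p obtain \<phi> D\<phi> where *: "C1_torus \<phi> D\<phi>"
    "\<forall>\<^sub>F z in nhds x. f z - \<phi> z \<le> f x - \<phi> x" "p = D\<phi> x" by (rule superdiffE)
  from *(2) obtain d where d: "d > 0" "\<And>z. norm (z - x) < d \<Longrightarrow> f z - \<phi> z \<le> f x - \<phi> x"
    unfolding eventually_nhds_norm by auto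
  have "zperiodic \<phi>" using *(1) by (simp add: C1_torus_def)
  have k': "\<forall>j. (- k) $ j \<in> \<int>" using k by simp
  have "f z - \<phi> z \<le> f (x + k) - \<phi> (x + k)" if "norm (z - (x + k)) < d" for z
  proof -
    have "f (z + - k) - \<phi> (z + - k) \<le> f x - \<phi> x" using that by (intro d(2)) (simp add: algebra_simps)
    moreover have "f (z + - k) = f z" "\<phi> (z + - k) = \<phi> z" "f (x + k) = f x" "\<phi> (x + k) = \<phi> x"
      using f \<open>zperiodic \<phi>\<close> k k' unfolding zperiodic_def by blast+
    ultimately show ?thesis by simp
  qed
  then have "\<forall>\<^sub>F z in nhds (x + k). f z - \<phi> z \<le> f (x + k) - \<phi> (x + k)"
    unfolding eventually_nhds_norm using d(1) by auto
  from superdiffI[OF *(1) this] *(3) C1_torus_gradient_shift[OF *(1) k] show ?thesis by simp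
qed

lemma norm_square_shift:
  fixes a w z :: "'a::real_inner"
  shows "(norm (w - a))\<^sup>2 = (norm (z - a))\<^sup>2 + 2 * ((z - a) \<bullet> (w - z)) + (norm (w - z))\<^sup>2"
  by (simp add: power2_norm_eq_inner inner_diff_left inner_diff_right inner_commute algebra_simps)

lemma superdiff_quadratic_max:
  assumes "r > 0"
    and le: "\<And>w. norm (w - x) < r \<Longrightarrow> f w - k * (norm (w - a))\<^sup>2 \<le> f x - k * (norm (x - a))\<^sup>2"
  shows "(2 * k) *\<^sub>R (x - a) \<in> superdiff f x"
proof (rule superdiff_proximal[OF \<open>r > 0\<close>, where C = k])
  fix w assume "norm (w - x) < r"
  from le[OF this] show "f w \<le> f x + (2 * k) *\<^sub>R (x - a) \<bullet> (w - x) + k * (norm (w - x))\<^sup>2"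
    by (simp add: norm_square_shift[of w a x] algebra_simps)
qed

text \<open>Superdifferentials are nonempty on a dense set: penalise the distance to \<open>x\<close> strongly.\<close>

lemma superdiff_nonempty_nearby:
  assumes f: "continuous_on (cball x r) f" and r: "r > 0"
  obtains z p where "norm (z - x) < r" "p \<in> superdiff f z"
proof -
  obtain m where m: "m \<in> cball x r" "\<And>w. w \<in> cball x r \<Longrightarrow> f w \<le> f m"
    using continuous_attains_sup[OF compact_cball _ f] r by auto
  define k where "k = (f m - f x + 1) / r\<^sup>2"
  have k: "k > 0" "k * r\<^sup>2 = f m - f x + 1"
    using r m(2)[of x] by (auto simp: k_def)
  have "continuous_on (cball x r) (\<lambda>w. f w - k * (norm (w - x))\<^sup>2)"
    by (intro continuous_intros f)
  from continuous_attains_sup[OF compact_cball _ this]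
  obtain z where z: "z \<in> cball x r"
      "\<And>w. w \<in> cball x r \<Longrightarrow> f w - k * (norm (w - x))\<^sup>2 \<le> f z - k * (norm (z - x))\<^sup>2"
    using r by auto
  have "f x \<le> f z - k * (norm (z - x))\<^sup>2" using z(2)[of x] r by simp
  then have "k * (norm (z - x))\<^sup>2 < k * r\<^sup>2" using m(2)[OF z(1)] k by linarith
  then have "(norm (z - x))\<^sup>2 < r\<^sup>2" using k(1) mult_less_cancel_left_pos by blast
  then have "norm (z - x) < r"
    using r by (simp add: power2_less_imp_less)
  moreover have "(2 * k) *\<^sub>R (z - x) \<in> superdiff f z"
  proof (rule superdiff_quadratic_max[where r = "r - norm (z - x)"])
    fix w assume "norm (w - z) < r - norm (z - x)"
    then have "norm (w - x) < r" using norm_triangle_ineq[of "w - z" "z - x"] by simp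
    then show "f w - k * (norm (w - x))\<^sup>2 \<le> f z - k * (norm (z - x))\<^sup>2"
      by (intro z(2)) (simp add: dist_norm norm_minus_commute)
  qed (use \<open>norm (z - x) < r\<close> in simp)
  ultimately show ?thesis using that by blast
qed

text \<open>A one-sided mean value inequality without differentiability. If \<open>f\<close> grew faster than
  rate \<open>c\<close> along a segment, maximising
  \<open>f x - c' s - k \<parallel>x - (z + s e)\<parallel>\<^sup>2\<close> jointly over the parameter \<open>s\<close> of the segment and a free
  point \<open>x\<close> would, for large \<open>k\<close>, give a superdifferential element whose component along \<open>e\<close>
  is at least \<open>c' > c\<close>.\<close>

lemma superdiff_bound_imp_increment:
  fixes f :: "real^'n::finite \<Rightarrow> real"
  assumes f: "continuous_on (cball a R) f"
    and bound: "\<And>x p. x \<in> ball a R \<Longrightarrow> p \<in> superdiff f x \<Longrightarrow> e \<bullet> p \<le> c"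
    and z: "z \<in> ball a R" "z + T *\<^sub>R e \<in> ball a R" and "0 \<le> T"
  shows "f (z + T *\<^sub>R e) \<le> f z + c * T"
proof (rule ccontr)
  assume neg: "\<not> ?thesis"
  then have T: "T > 0" using \<open>0 \<le> T\<close> by (cases "T = 0") auto
  define \<eta> where "\<eta> = (f (z + T *\<^sub>R e) - f z - c * T) / 2"
  define c' where "c' = c + \<eta> / T"
  have \<eta>: "\<eta> > 0" using neg by (simp add: \<eta>_def)
  have c': "c' > c" "f (z + T *\<^sub>R e) - c' * T = f z + \<eta>"
    using \<eta> T by (auto simp: c'_def \<eta>_def field_simps)
  define P where "P s = z + s *\<^sub>R e" for s
  define m where "m = max (norm (z - a)) (norm (z + T *\<^sub>R e - a))"
  have m: "m < R" using z by (auto simp: m_def dist_norm norm_minus_commute)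
  have Pm: "norm (P s - a) \<le> m" if "0 \<le> s" "s \<le> T" for s
  proof -
    have "P s - a = (1 - s / T) *\<^sub>R (z - a) + (s / T) *\<^sub>R (z + T *\<^sub>R e - a)"
      using T by (simp add: P_def algebra_simps)
    then have "norm (P s - a) \<le> norm ((1 - s / T) *\<^sub>R (z - a)) + norm ((s / T) *\<^sub>R (z + T *\<^sub>R e - a))"
      using norm_triangle_ineq by metis
    also have "\<dots> = (1 - s / T) * norm (z - a) + (s / T) * norm (z + T *\<^sub>R e - a)"
      using that T by simp
    also have "\<dots> \<le> (1 - s / T) * m + (s / T) * m"
      using that T by (intro add_mono mult_left_mono) (auto simp: m_def)
    also have "\<dots> = m" by (simp add: algebra_simps)
    finally show ?thesis .
  qed
  have "z \<in> cball a R" using z by auto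
  then obtain \<rho>' where \<rho>': "\<rho>' > 0" "\<And>x. x \<in> cball a R \<Longrightarrow> norm (x - z) < \<rho>' \<Longrightarrow> f x < f z + \<eta>"
    using f \<eta> unfolding continuous_on_iff
    by (metis abs_diff_less_iff dist_norm dist_real_def add.commute)
  define \<rho> where "\<rho> = min \<rho>' (R - m)"
  have \<rho>: "\<rho> > 0" using \<rho>' m by (simp add: \<rho>_def)
  have "R > 0" using z(1) by (metis ball_eq_empty empty_iff not_le)
  obtain M where M: "\<And>w. w \<in> cball a R \<Longrightarrow> f w \<le> M"
    using continuous_attains_sup[OF compact_cball _ f] \<open>R > 0\<close> by fastforce
  define k where "k = (\<bar>M - f z\<bar> + \<bar>c'\<bar> * T + 1) / \<rho>\<^sup>2"
  have k: "k > 0" "k * \<rho>\<^sup>2 = \<bar>M - f z\<bar> + \<bar>c'\<bar> * T + 1"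
    using \<rho> T by (auto simp: k_def add_nonneg_pos)
  let ?\<Phi> = "\<lambda>(s, x). f x - c' * s - k * (norm (x - P s))\<^sup>2"
  have "continuous_on ({0..T} \<times> cball a R) ?\<Phi>"
    unfolding P_def case_prod_beta
    by (intro continuous_intros continuous_on_compose2[OF f]) auto
  moreover have "compact ({0..T} \<times> cball a R)" by (intro compact_Times compact_cball compact_Icc)
  ultimately obtain s x where sx: "s \<in> {0..T}" "x \<in> cball a R"
      and max: "\<And>s' w. s' \<in> {0..T} \<Longrightarrow> w \<in> cball a R \<Longrightarrow>
        f w - c' * s' - k * (norm (w - P s'))\<^sup>2 \<le> f x - c' * s - k * (norm (x - P s))\<^sup>2"
    using continuous_attains_sup[of "{0..T} \<times> cball a R" ?\<Phi>] T \<open>z \<in> cball a R\<close> by fastforce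
  have top: "f z + \<eta> \<le> f x - c' * s - k * (norm (x - P s))\<^sup>2"
    using max[of T "z + T *\<^sub>R e"] T z c'(2) by (auto simp: P_def)
  have "\<bar>c' * s\<bar> \<le> \<bar>c'\<bar> * T" unfolding abs_mult using sx by (intro mult_left_mono) auto
  then have "k * (norm (x - P s))\<^sup>2 < k * \<rho>\<^sup>2"
    using top M[OF sx(2)] \<eta> k(2) by linarith
  then have "(norm (x - P s))\<^sup>2 < \<rho>\<^sup>2" using k(1) mult_less_cancel_left_pos by blast
  then have near: "norm (x - P s) < \<rho>"
    using \<rho> by (simp add: power2_less_imp_less)
  have "norm (x - a) < R"
    using near Pm[of s] sx norm_triangle_ineq[of "x - P s" "P s - a"] by (simp add: \<rho>_def)
  then have xin: "x \<in> ball a R" by (simp add: dist_norm norm_minus_commute)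
  have "s \<noteq> 0"
  proof
    assume "s = 0"
    then have "norm (x - z) < \<rho>'" using near by (simp add: P_def \<rho>_def)
    from \<rho>'(2)[OF sx(2) this] top \<open>s = 0\<close> k(1) show False
      by (smt (verit) mult_zero_right zero_le_mult_iff zero_le_power2)
  qed
  then have s: "0 < s" "s \<le> T" using sx by auto
  define p where "p = (2 * k) *\<^sub>R (x - P s)"
  have "p \<in> superdiff f x"
    unfolding p_def
  proof (rule superdiff_quadratic_max[where r = "R - norm (x - a)"])
    fix w assume "norm (w - x) < R - norm (x - a)"
    then have "norm (w - a) < R" using norm_triangle_ineq[of "w - x" "x - a"] by simp
    then show "f w - k * (norm (w - P s))\<^sup>2 \<le> f x - k * (norm (x - P s))\<^sup>2"
      using max[OF sx(1), of w] by (simp add: dist_norm norm_minus_commute)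
  qed (use \<open>norm (x - a) < R\<close> in simp)
  then have ep: "e \<bullet> p \<le> c" using bound xin by blast
  have slope: "c' \<le> e \<bullet> p + k * h * (norm e)\<^sup>2" if h: "0 < h" "h \<le> s" for h
  proof -
    have "x - P (s - h) = (x - P s) + h *\<^sub>R e" by (simp add: P_def algebra_simps)
    moreover have "(norm (v + h *\<^sub>R e))\<^sup>2
        = (norm v)\<^sup>2 + 2 * h * (e \<bullet> v) + h\<^sup>2 * (norm e)\<^sup>2" for v
      unfolding power2_norm_eq_inner
      by (simp add: inner_add_left inner_add_right inner_commute algebra_simps power2_eq_square)
    ultimately have "(norm (x - P (s - h)))\<^sup>2
        = (norm (x - P s))\<^sup>2 + 2 * h * (e \<bullet> (x - P s)) + h\<^sup>2 * (norm e)\<^sup>2"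
      by (simp only:)
    moreover have "f x - c' * (s - h) - k * (norm (x - P (s - h)))\<^sup>2
        \<le> f x - c' * s - k * (norm (x - P s))\<^sup>2"
      using max[of "s - h" x] h s sx by auto
    ultimately have "f x - c' * (s - h) - k * ((norm (x - P s))\<^sup>2 +
          (2 * h * (e \<bullet> (x - P s)) + h\<^sup>2 * (norm e)\<^sup>2))
        \<le> f x - c' * s - k * (norm (x - P s))\<^sup>2"
      by (simp only: add.assoc)
    then have "c' * h \<le> k * (2 * h * (e \<bullet> (x - P s)) + h\<^sup>2 * (norm e)\<^sup>2)"
      unfolding distrib_left[of k "(norm (x - P s))\<^sup>2"] right_diff_distrib[of c'] by linarith
    also have "\<dots> = (e \<bullet> p + k * h * (norm e)\<^sup>2) * h"
      by (simp add: p_def algebra_simps power2_eq_square)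
    finally show ?thesis using h by simp
  qed
  define h where "h = min s ((c' - c) / (2 * k * ((norm e)\<^sup>2 + 1)))"
  have den: "2 * k * ((norm e)\<^sup>2 + 1) > 0" using k by (simp add: add_nonneg_pos)
  have "h > 0" using s c' den by (simp add: h_def)
  have "h * (2 * k * ((norm e)\<^sup>2 + 1)) \<le> c' - c"
    using den by (simp add: h_def min_def pos_le_divide_eq[symmetric])
  moreover have "2 * (k * h * (norm e)\<^sup>2) \<le> h * (2 * k * ((norm e)\<^sup>2 + 1))"
    using \<open>h > 0\<close> k by (simp add: algebra_simps)
  ultimately have "2 * (k * h * (norm e)\<^sup>2) \<le> c' - c" by linarith
  with slope[of h] \<open>h > 0\<close> ep c'(1) show False by (simp add: h_def)
qed

text \<open>Just before \<open>z\<close>, in direction \<open>e\<close>, a function touching \<open>f\<close> from above at \<open>z\<close> rises no faster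
  than \<open>f\<close>, so its derivative inherits the bound.\<close>

lemma increment_bound_imp_superdiff:
  assumes p: "p \<in> superdiff f z" and "\<delta> > 0"
    and inc: "\<And>t. 0 < t \<Longrightarrow> t < \<delta> \<Longrightarrow> f z - f (z - t *\<^sub>R e) \<le> c * t"
  shows "e \<bullet> p \<le> c"
proof (rule ccontr)
  assume "\<not> ?thesis"
  from p obtain \<phi> D\<phi> where *: "C1_torus \<phi> D\<phi>"
    "\<forall>\<^sub>F w in nhds z. f w - \<phi> w \<le> f z - \<phi> z" "p = D\<phi> z" by (rule superdiffE)
  have "(\<phi> has_derivative (\<lambda>h. h \<bullet> p)) (at (z - 0 *\<^sub>R e))"
    using * by (auto simp: C1_torus_def gderiv_def)
  from has_derivative_compose[where f = "\<lambda>t. z - t *\<^sub>R e" and f' = "\<lambda>t. - t *\<^sub>R e"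
      and x = 0 and s = UNIV, OF _ this]
  moreover have "((\<lambda>t. z - t *\<^sub>R e) has_derivative (\<lambda>t. - t *\<^sub>R e)) (at 0)"
    by (auto intro!: derivative_eq_intros)
  ultimately have "((\<lambda>t. \<phi> (z - t *\<^sub>R e)) has_derivative (\<lambda>t. (- t *\<^sub>R e) \<bullet> p)) (at 0)"
    by blast
  moreover have "(\<lambda>t. (- t *\<^sub>R e) \<bullet> p) = (*) (- (e \<bullet> p))" by (simp add: fun_eq_iff)
  ultimately have "((\<lambda>t. \<phi> (z - t *\<^sub>R e)) has_real_derivative - (e \<bullet> p)) (at 0)"
    by (simp only: has_field_derivative_def)
  then have "((\<lambda>t. \<phi> (z - t *\<^sub>R e) + c * t) has_real_derivative (c - e \<bullet> p)) (at 0)"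
    by (auto intro!: derivative_eq_intros)
  from DERIV_neg_dec_right[OF this] \<open>\<not> ?thesis\<close> obtain d where d: "d > 0"
    "\<And>h. 0 < h \<Longrightarrow> h < d \<Longrightarrow> \<phi> (z - h *\<^sub>R e) + c * h < \<phi> z" by auto
  from *(2) obtain d' where d': "d' > 0" "\<And>w. norm (w - z) < d' \<Longrightarrow> f w - \<phi> w \<le> f z - \<phi> z"
    unfolding eventually_nhds_norm by auto
  have n: "norm e + 1 > 0" by (simp add: add_nonneg_pos)
  define q where "q = d' / (norm e + 1)"
  have "q > 0" using n d' by (simp add: q_def)
  define t where "t = min (min \<delta> d) q / 2"
  have t: "0 < t" "t < \<delta>" "t < d" "t < q"
    using \<open>\<delta> > 0\<close> d(1) \<open>q > 0\<close> by (auto simp: t_def min_def)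
  then have "t * (norm e + 1) < d'" using n by (simp add: q_def pos_less_divide_eq)
  then have "norm ((z - t *\<^sub>R e) - z) < d'" using t by (simp add: algebra_simps)
  from d'(2)[OF this] inc[OF t(1,2)] d(2)[OF t(1,3)] show False by linarith
qed

section \<open>Almost everywhere gradients\<close>

text \<open>Only one admissible step \<open>h\<close> is needed at each \<open>t\<close>, since a largest point up to which the
  bound holds cannot lie before \<open>T\<close>.\<close>

lemma dini_bound:
  fixes g :: "real \<Rightarrow> real"
  assumes g: "continuous_on {0..T} g" and "0 \<le> T"
    and dini: "\<And>t \<eta>. 0 \<le> t \<Longrightarrow> t < T \<Longrightarrow> \<eta> > 0 \<Longrightarrow>
      \<exists>h. 0 < h \<and> t + h \<le> T \<and> g (t + h) - g t \<le> (c + \<eta>) * h"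
  shows "g T - g 0 \<le> c * T"
proof -
  have *: "g T - g 0 \<le> (c + \<eta>) * T" if "\<eta> > 0" for \<eta>
  proof -
    define S where "S = {t \<in> {0..T}. g t - (c + \<eta>) * t \<le> g 0}"
    have "closed S"
      unfolding S_def by (intro continuous_closed_preimage_constant continuous_on_closed_Collect_le
          continuous_intros g closed_atLeastAtMost)
    moreover have "S \<subseteq> {0..T}" by (auto simp: S_def)
    ultimately have "compact S" by (metis closed_Int_compact compact_Icc inf.absorb1)
    moreover have "0 \<in> S" using \<open>0 \<le> T\<close> by (simp add: S_def)
    ultimately obtain s where s: "s \<in> S" "\<And>t. t \<in> S \<Longrightarrow> t \<le> s"
      using compact_attains_sup[of S] by blast
    have "s = T"
    proof (rule ccontr)
      assume "s \<noteq> T"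
      then have "0 \<le> s" "s < T" using s(1) by (auto simp: S_def)
      from dini[OF this that] obtain h where h: "0 < h" "s + h \<le> T" "g (s + h) - g s \<le> (c + \<eta>) * h"
        by blast
      then have "s + h \<in> S" using s(1) by (auto simp: S_def algebra_simps)
      with s(2) h(1) show False by fastforce
    qed
    then show ?thesis using s(1) by (simp add: S_def)
  qed
  show ?thesis
  proof (rule field_le_epsilon)
    fix e :: real assume "e > 0"
    have "g T - g 0 \<le> (c + e / (T + 1)) * T" using \<open>e > 0\<close> \<open>0 \<le> T\<close> by (intro *) simp
    also have "\<dots> \<le> c * T + e"
    proof -
      have "e / (T + 1) * T \<le> e" using \<open>e > 0\<close> \<open>0 \<le> T\<close> by (simp add: field_simps)
      then show ?thesis by (simp add: algebra_simps)
    qed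
    finally show "g T - g 0 \<le> c * T + e" .
  qed
qed

text \<open>Instead of restricting to almost every line, the function is averaged
  over a small cube; by dominated convergence the right Dini derivative of the average along
  \<open>e\<close> is at most \<open>c\<close> times the volume. Replacing difference quotients by their maximum with
  \<open>c\<close> makes the limit function constant.\<close>

lemma ae_gradient_bound_imp_increment:
  fixes f :: "real^'n::finite \<Rightarrow> real"
  assumes lip: "\<And>x y. \<bar>f x - f y\<bar> \<le> L * norm (x - y)"
    and ae: "AE x in lebesgue. x \<in> ball a R \<longrightarrow> (\<exists>p. GDERIV f x :> p \<and> e \<bullet> p \<le> c)"
    and z: "z \<in> ball a R" "z + T *\<^sub>R e \<in> ball a R" and "0 \<le> T"
  shows "f (z + T *\<^sub>R e) \<le> f z + c * T"
proof (rule ccontr)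
  assume neg: "\<not> ?thesis"
  have "L \<ge> 0" using lip[of "axis undefined 1" 0] by (auto simp: norm_axis_1)
  have f: "continuous_on S f" for S
  proof (rule lipschitz_on_continuous_on)
    show "L-lipschitz_on S f" using lip \<open>L \<ge> 0\<close> by (auto simp: lipschitz_on_def dist_norm)
  qed
  define \<eta> where "\<eta> = (f (z + T *\<^sub>R e) - f z - c * T) / 2"
  have \<eta>: "\<eta> > 0" using neg by (simp add: \<eta>_def)
  obtain N where N: "negligible N"
    "\<And>x. x \<in> ball a R - N \<Longrightarrow> \<exists>p. GDERIV f x :> p \<and> e \<bullet> p \<le> c"
  proof -
    from ae obtain N where N: "N \<in> null_sets lebesgue"
      "{x \<in> space lebesgue. \<not> (x \<in> ball a R \<longrightarrow> (\<exists>p. GDERIV f x :> p \<and> e \<bullet> p \<le> c))} \<subseteq> N"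
      unfolding eventually_ae_filter by blast
    have "\<exists>p. GDERIV f x :> p \<and> e \<bullet> p \<le> c" if "x \<in> ball a R - N" for x
      using that N(2) by auto
    with N(1) show ?thesis using that[of N] by (simp add: negligible_iff_null_sets)
  qed
  define m where "m = max (norm (z - a)) (norm (z + T *\<^sub>R e - a))"
  have m: "m < R" using z by (auto simp: m_def dist_norm norm_minus_commute)
  have seg: "z + w + t *\<^sub>R e \<in> ball a R" if "0 \<le> t" "t \<le> T" "norm w < R - m" for t w
  proof (cases "T = 0")
    case True
    then show ?thesis
      using that norm_triangle_ineq[of w "z - a"]
      by (auto simp: m_def dist_norm norm_minus_commute[of a] algebra_simps)
  next
    case False
    then have T: "T > 0" using \<open>0 \<le> T\<close> by simp
    have "z + w + t *\<^sub>R e - a = w + ((1 - t / T) *\<^sub>R (z - a) + (t / T) *\<^sub>R (z + T *\<^sub>R e - a))"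
      using T by (simp add: algebra_simps)
    also have "norm \<dots> \<le> norm w + (norm ((1 - t / T) *\<^sub>R (z - a)) + norm ((t / T) *\<^sub>R (z + T *\<^sub>R e - a)))"
      by (intro order_trans[OF norm_triangle_ineq] add_left_mono norm_triangle_ineq)
    also have "\<dots> = norm w + ((1 - t / T) * norm (z - a) + (t / T) * norm (z + T *\<^sub>R e - a))"
      using that T by simp
    also have "\<dots> \<le> norm w + ((1 - t / T) * m + (t / T) * m)"
      using that T by (intro add_left_mono add_mono mult_left_mono) (auto simp: m_def)
    also have "\<dots> = norm w + m" by (simp add: algebra_simps)
    also have "\<dots> < R" using that by simp
    finally show ?thesis by (simp add: dist_norm norm_minus_commute)
  qed
  define V where "V = {w. c * T + \<eta> < f (z + w + T *\<^sub>R e) - f (z + w)} \<inter> ball 0 (R - m)"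
  have "open V"
    unfolding V_def
    by (intro open_Int open_ball open_Collect_less continuous_intros
        continuous_on_compose2[OF f[of UNIV]]) auto
  moreover have "0 \<in> V"
  proof -
    have "f (z + T *\<^sub>R e) - f z - c * T = 2 * \<eta>" by (simp add: \<eta>_def)
    then have "c * T + \<eta> < f (z + T *\<^sub>R e) - f z" using \<eta> by linarith
    then show ?thesis using m by (simp add: V_def)
  qed
  ultimately obtain l u where Q: "cbox l u \<subseteq> V" "0 \<in> box l u" "\<forall>i\<in>Basis. l \<bullet> i < u \<bullet> i"
    by (rule open_contains_cbox)
  define Q where "Q = cbox l u"
  define v where "v = measure lborel Q"
  have v: "v > 0" using Q(3) unfolding v_def Q_def by (rule content_pos_lt)
  have int: "(\<lambda>w. f (z + w + t *\<^sub>R e)) integrable_on Q" for t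
    unfolding Q_def by (intro integrable_continuous continuous_on_compose2[OF f[of UNIV]]
        continuous_intros) auto
  define g where "g t = integral Q (\<lambda>w. f (z + w + t *\<^sub>R e))" for t
  have glip: "\<bar>g s - g t\<bar> \<le> L * norm e * v * \<bar>s - t\<bar>" for s t
  proof -
    have "g s - g t = integral Q (\<lambda>w. f (z + w + s *\<^sub>R e) - f (z + w + t *\<^sub>R e))"
      unfolding g_def by (intro Henstock_Kurzweil_Integration.integral_diff[symmetric] int)
    also have "norm \<dots> \<le> (L * norm e * \<bar>s - t\<bar>) * measure lborel Q"
      unfolding Q_def
    proof (rule integrable_bound)
      fix w
      have "\<bar>f (z + w + s *\<^sub>R e) - f (z + w + t *\<^sub>R e)\<bar> \<le> L * norm ((s - t) *\<^sub>R e)"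
        using lip[of "z + w + s *\<^sub>R e" "z + w + t *\<^sub>R e"] by (simp add: algebra_simps)
      then show "norm (f (z + w + s *\<^sub>R e) - f (z + w + t *\<^sub>R e)) \<le> L * norm e * \<bar>s - t\<bar>"
        by (simp add: mult_ac)
    qed (use \<open>L \<ge> 0\<close> int Q_def in \<open>auto intro!: integrable_diff\<close>)
    finally show ?thesis by (simp add: v_def mult_ac)
  qed
  have "continuous_on {0..T} g"
  proof (rule lipschitz_on_continuous_on)
    show "(L * norm e * v)-lipschitz_on {0..T} g"
      using glip \<open>L \<ge> 0\<close> v by (auto simp: lipschitz_on_def dist_real_def)
  qed
  then have "g T - g 0 \<le> (c * v) * T"
  proof (rule dini_bound[OF _ \<open>0 \<le> T\<close>])
    fix t \<theta> :: real assume t: "0 \<le> t" "t < T" and "\<theta> > 0"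
    define h where "h n = (T - t) / real (Suc n)" for n
    have h: "h n > 0" "t + h n \<le> T" for n
    proof -
      show "h n > 0" using t by (simp add: h_def)
      have "(T - t) / real (Suc n) \<le> (T - t) / 1"
        using t by (intro divide_left_mono) auto
      then show "t + h n \<le> T" by (simp add: h_def)
    qed
    have h0: "h \<longlonglongrightarrow> 0"
      unfolding h_def using LIMSEQ_Suc[OF lim_const_over_n, of "T - t"] by simp
    define q where "q n w = (f (z + w + (t + h n) *\<^sub>R e) - f (z + w + t *\<^sub>R e)) / h n" for n w
    define N' where "N' = (+) (- z - t *\<^sub>R e) ` N"
    have N': "negligible N'" unfolding N'_def by (rule negligible_translation[OF N(1)])
    have N'_iff: "z + w + t *\<^sub>R e \<notin> N" if "w \<notin> N'" for w
    proof
      assume "z + w + t *\<^sub>R e \<in> N"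
      then have "- z - t *\<^sub>R e + (z + w + t *\<^sub>R e) \<in> N'" unfolding N'_def by (rule imageI)
      then show False using that by simp
    qed
    define q' where "q' n w = (if w \<in> N' then c else max (q n w) c)" for n w
    have qint: "q n integrable_on Q" for n
      unfolding q_def by (intro integrable_on_divide integrable_diff int)
    have qc: "continuous_on Q (q n)" for n
      unfolding q_def using h(1)[of n]
      by (intro continuous_intros continuous_on_compose2[OF f[of UNIV]]) auto
    have mint: "(\<lambda>w. max (q n w) c) integrable_on Q" for n
      unfolding Q_def
      by (intro integrable_continuous continuous_intros qc[unfolded Q_def])
    have q'int: "q' n integrable_on Q" for n
      by (rule integrable_spike[OF mint N']) (auto simp: q'_def)
    have qb: "\<bar>q n w\<bar> \<le> L * norm e" for n w
    proof -
      have "\<bar>f (z + w + (t + h n) *\<^sub>R e) - f (z + w + t *\<^sub>R e)\<bar> \<le> L * norm (h n *\<^sub>R e)"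
        using lip[of "z + w + (t + h n) *\<^sub>R e" "z + w + t *\<^sub>R e"] by (simp add: algebra_simps)
      then show ?thesis using h(1)[of n] by (simp add: q_def abs_divide pos_divide_le_eq mult_ac)
    qed
    have "(\<lambda>n. integral Q (q' n)) \<longlonglongrightarrow> integral Q (\<lambda>w. c)"
    proof (rule dominated_convergence(2)[where h = "\<lambda>w. L * norm e + \<bar>c\<bar>"])
      show "(\<lambda>w. L * norm e + \<bar>c\<bar>) integrable_on Q" unfolding Q_def by (rule integrable_const)
      show "norm (q' n w) \<le> L * norm e + \<bar>c\<bar>" for n w
        using qb[of n w] by (auto simp: q'_def max_def)
      show "(\<lambda>n. q' n w) \<longlonglongrightarrow> c" if "w \<in> Q" for w
      proof (cases "w \<in> N'")
        case False
        define x where "x = z + w + t *\<^sub>R e"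
        have "norm w < R - m" using that Q(1) by (auto simp: Q_def V_def)
        then have "x \<in> ball a R - N"
          using seg[of t w] t N'_iff[OF False] by (simp add: x_def)
        from N(2)[OF this] obtain p where p: "GDERIV f x :> p" "e \<bullet> p \<le> c" by blast
        have "(f has_derivative (\<lambda>h. h \<bullet> p)) (at (x + 0 *\<^sub>R e))" using p by (simp add: gderiv_def)
        from has_derivative_compose[where f = "\<lambda>t. x + t *\<^sub>R e" and f' = "\<lambda>t. t *\<^sub>R e"
            and x = 0 and s = UNIV, OF _ this]
        moreover have "((\<lambda>t. x + t *\<^sub>R e) has_derivative (\<lambda>t. t *\<^sub>R e)) (at 0)"
          by (auto intro!: derivative_eq_intros)
        ultimately have "((\<lambda>t. f (x + t *\<^sub>R e)) has_derivative (\<lambda>t. (t *\<^sub>R e) \<bullet> p)) (at 0)"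
          by blast
        moreover have "(\<lambda>t. (t *\<^sub>R e) \<bullet> p) = (*) (e \<bullet> p)" by (simp add: fun_eq_iff)
        ultimately have "((\<lambda>t. f (x + t *\<^sub>R e)) has_real_derivative (e \<bullet> p)) (at 0)"
          by (simp only: has_field_derivative_def)
        then have "((\<lambda>k. (f (x + k *\<^sub>R e) - f x) / k) \<longlongrightarrow> e \<bullet> p) (at 0)"
          by (simp add: DERIV_def)
        moreover have "filterlim h (at 0) sequentially"
          using h0 h(1) by (simp add: filterlim_at less_imp_neq[symmetric])
        ultimately have "(\<lambda>n. (f (x + h n *\<^sub>R e) - f x) / h n) \<longlonglongrightarrow> e \<bullet> p"
          by (rule filterlim_compose)
        then have "(\<lambda>n. q n w) \<longlonglongrightarrow> e \<bullet> p" by (simp add: q_def x_def algebra_simps)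
        then have "(\<lambda>n. max (q n w) c) \<longlonglongrightarrow> max (e \<bullet> p) c" by (intro tendsto_max tendsto_const)
        then show ?thesis using False p(2) by (simp add: q'_def max_absorb2)
      qed (simp add: q'_def)
    qed (rule q'int)
    moreover have "integral Q (\<lambda>w. c) = c * v" by (simp add: Q_def v_def mult.commute)
    ultimately have lim: "(\<lambda>n. integral Q (q' n)) \<longlonglongrightarrow> c * v" by simp
    obtain n where n: "integral Q (q' n) < c * v + \<theta>"
    proof -
      from order_tendstoD(2)[OF lim, of "c * v + \<theta>"] \<open>\<theta> > 0\<close>
      obtain n where "integral Q (q' n) < c * v + \<theta>"
        by (auto simp: eventually_sequentially)
      then show ?thesis by (rule that)
    qed
    have "integral Q (q n) \<le> integral Q (\<lambda>w. max (q n w) c)"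
      by (rule integral_le[OF qint mint]) simp
    also have "\<dots> = integral Q (q' n)"
      by (rule integral_spike[OF N']) (auto simp: q'_def)
    finally have le: "integral Q (q n) \<le> c * v + \<theta>" using n by simp
    have "integral Q (q n) = (g (t + h n) - g t) / h n"
      unfolding q_def g_def
      by (simp add: Henstock_Kurzweil_Integration.integral_diff[OF int int])
    with le have "g (t + h n) - g t \<le> (c * v + \<theta>) * h n"
      using h(1)[of n] by (simp add: pos_divide_le_eq)
    then show "\<exists>h. 0 < h \<and> t + h \<le> T \<and> g (t + h) - g t \<le> (c * v + \<theta>) * h"
      using h[of n] by blast
  qed
  moreover have "(c * T + \<eta>) * v \<le> g T - g 0"
  proof -
    have "(c * T + \<eta>) * v = integral Q (\<lambda>w. c * T + \<eta>)" by (simp add: Q_def v_def mult.commute)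
    also have "\<dots> \<le> integral Q (\<lambda>w. f (z + w + T *\<^sub>R e) - f (z + w + 0 *\<^sub>R e))"
    proof (intro integral_le integrable_diff int)
      show "(\<lambda>w. c * T + \<eta>) integrable_on Q" unfolding Q_def by (rule integrable_const)
      show "c * T + \<eta> \<le> f (z + w + T *\<^sub>R e) - f (z + w + 0 *\<^sub>R e)" if "w \<in> Q" for w
        using Q(1) that by (auto simp: V_def Q_def)
    qed
    also have "\<dots> = g T - g 0"
      unfolding g_def by (intro Henstock_Kurzweil_Integration.integral_diff int)
    finally show ?thesis .
  qed
  ultimately have "\<eta> * v \<le> 0" by (simp add: algebra_simps)
  with \<eta> v show False by (simp add: mult_le_0_iff)
qed

section \<open>A priori bounds\<close>

lemma periodic_representative:
  fixes x :: "real^'n::finite"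
  obtains k where "\<forall>j. k $ j \<in> \<int>" "x + k \<in> cbox 0 1"
proof
  show "\<forall>j. (\<chi> j. - of_int \<lfloor>x $ j\<rfloor>) $ j \<in> \<int>" by simp
  show "x + (\<chi> j. - of_int \<lfloor>x $ j\<rfloor>) \<in> cbox 0 1"
  proof -
    have "0 \<le> x $ j - of_int \<lfloor>x $ j\<rfloor> \<and> x $ j - of_int \<lfloor>x $ j\<rfloor> \<le> 1" for j by linarith
    then show ?thesis by (simp add: mem_box_cart)
  qed
qed

lemma zperiodic_bounded:
  fixes f :: "real^'n::finite \<Rightarrow> real"
  assumes "zperiodic f" "continuous_on UNIV f"
  obtains B where "\<And>x. \<bar>f x\<bar> \<le> B"
proof -
  have "compact (f ` cbox 0 1)"
    using assms(2) continuous_on_subset by (intro compact_continuous_image compact_cbox) blast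
  then obtain B where B: "\<And>x. x \<in> cbox 0 1 \<Longrightarrow> \<bar>f x\<bar> \<le> B"
    by (metis bounded_iff compact_imp_bounded image_eqI real_norm_def)
  have "\<bar>f x\<bar> \<le> B" for x
  proof -
    obtain k where "\<forall>j. k $ j \<in> \<int>" "x + k \<in> cbox 0 1" by (rule periodic_representative)
    with B[of "x + k"] assms(1) show ?thesis by (simp add: zperiodic_def)
  qed
  then show ?thesis by (rule that)
qed

lemma zperiodic_component: "zperiodic u \<Longrightarrow> zperiodic (\<lambda>z. u z $ i)"
  by (simp add: zperiodic_def)

locale weakly_coupled =
  fixes H :: "'m::finite \<Rightarrow> real^'n::finite \<Rightarrow> real^'n \<Rightarrow> real"
    and A :: "real^'m^'m"
  assumes H_periodic: "\<And>i p. zperiodic (\<lambda>x. H i x p)"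
    and H_continuous: "\<And>i. continuous_on UNIV (\<lambda>(x, p). H i x p)"
    and H_convex: "\<And>i x. convex_on UNIV (H i x)"
    and H_superlinear: "\<And>i x. filterlim (\<lambda>p. H i x p / norm p) at_top at_infinity"
    and A_off_diagonal: "\<And>i j. i \<noteq> j \<Longrightarrow> A $ i $ j \<le> 0"
    and A_row_sum: "\<And>i. (\<Sum>j\<in>UNIV. A $ i $ j) = 0"
    and A_irreducible: "irreducible_coupling A"
begin

lemma H_tendsto:
  assumes "(f \<longlongrightarrow> x) F" "(g \<longlongrightarrow> p) F"
  shows "((\<lambda>t. H i (f t) (g t)) \<longlongrightarrow> H i x p) F"
proof -
  have "isCont (\<lambda>(x, p). H i x p) (x, p)"
    using H_continuous[of i] by (simp add: continuous_on_eq_continuous_at)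
  from isCont_tendsto_compose[OF this tendsto_Pair[OF assms]] show ?thesis by simp
qed

lemma H_continuous_on [continuous_intros]:
  assumes "continuous_on S f" "continuous_on S g"
  shows "continuous_on S (\<lambda>t. H i (f t) (g t))"
  using assms H_tendsto unfolding continuous_on_def by blast

lemma H_shift: "\<forall>j. k $ j \<in> \<int> \<Longrightarrow> H i (x + k) p = H i x p"
  using H_periodic by (auto simp: zperiodic_def)

text \<open>Superlinearity is only assumed pointwise in \<open>x\<close>. Convexity makes the resulting coercivity
  uniform: unbounded points \<open>p\<close> of sublevel sets can be pulled back along the ray through the
  origin to any prescribed sphere.\<close>

lemma H_sublevel_bounded:
  obtains L where "L \<ge> 0" "\<And>i x p. H i x p \<le> C \<Longrightarrow> norm p \<le> L"
proof -
  have "\<exists>L. \<forall>x p. H i x p \<le> C \<longrightarrow> norm p \<le> L" for i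
  proof (rule ccontr)
    assume "\<not> ?thesis"
    then have "\<forall>n::nat. \<exists>x p. H i x p \<le> C \<and> norm p > real n + 1"
      by (meson not_le)
    then obtain x' p where x': "\<And>n::nat. H i (x' n) (p n) \<le> C" "\<And>n::nat. norm (p n) > real n + 1"
      by metis
    have "\<forall>n. \<exists>x\<in>cbox 0 1. H i x (p n) \<le> C"
      by (metis H_shift periodic_representative x'(1))
    then obtain x where x: "\<And>n. x n \<in> cbox 0 1" "\<And>n. H i (x n) (p n) \<le> C" by metis
    define e where "e n = p n /\<^sub>R norm (p n)" for n
    have pos: "norm (p n) > 0" for n using x'(2)[of n] by linarith
    have "(x n, e n) \<in> (cbox 0 1 \<times> sphere 0 1 :: ((real^'n) \<times> (real^'n)) set)" for n using x(1) pos[of n] by (auto simp: e_def)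
    moreover have "compact (cbox 0 1 \<times> sphere 0 1 :: ((real^'n) \<times> (real^'n)) set)"
      by (intro compact_Times compact_cbox compact_sphere)
    ultimately obtain l r where l: "l \<in> (cbox 0 1 \<times> sphere 0 1 :: ((real^'n) \<times> (real^'n)) set)" "strict_mono r"
      "((\<lambda>n. (x n, e n)) \<circ> r) \<longlonglongrightarrow> l"
      unfolding compact_def by meson
    obtain x0 e0 where l0: "l = (x0, e0)" by (cases l)
    have lim: "(\<lambda>n. x (r n)) \<longlonglongrightarrow> x0" "(\<lambda>n. e (r n)) \<longlonglongrightarrow> e0"
      using tendsto_fst[OF l(3)] tendsto_snd[OF l(3)] by (auto simp: l0 o_def)
    have "norm e0 = 1" using l(1) l0 by simp
    define K where "K = max (max (H i x0 0) C) 0"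
    have "\<forall>\<^sub>F p in at_infinity. H i x0 p / norm p \<ge> K + 1"
      using H_superlinear[of i x0] by (simp add: filterlim_at_top)
    then obtain b where b: "\<And>p. norm p \<ge> b \<Longrightarrow> H i x0 p / norm p \<ge> K + 1"
      unfolding eventually_at_infinity by blast
    define R where "R = max b 1"
    have R: "R \<ge> 1" "R \<ge> b" by (auto simp: R_def)
    have "norm (R *\<^sub>R e0) = R" using \<open>norm e0 = 1\<close> R by simp
    with b[of "R *\<^sub>R e0"] R have "(K + 1) * R \<le> H i x0 (R *\<^sub>R e0)"
      by (simp add: pos_le_divide_eq)
    moreover have "K \<ge> 0" by (simp add: K_def)
    then have "K + 1 \<le> (K + 1) * R" using R mult_left_mono[of 1 R "K + 1"] by simp
    moreover have "H i x0 (R *\<^sub>R e0) \<le> K"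
    proof (rule LIMSEQ_le)
      show "(\<lambda>n. H i (x (r n)) (R *\<^sub>R e (r n))) \<longlonglongrightarrow> H i x0 (R *\<^sub>R e0)"
        by (intro H_tendsto lim tendsto_intros)
      show "(\<lambda>n. max (max (H i (x (r n)) 0) C) 0) \<longlonglongrightarrow> K"
        unfolding K_def by (intro H_tendsto lim tendsto_intros)
      have "H i (x (r n)) (R *\<^sub>R e (r n)) \<le> max (max (H i (x (r n)) 0) C) 0" if "n \<ge> nat \<lceil>R\<rceil>" for n
      proof -
        have "R \<le> real n" using that by linarith
        also have "\<dots> \<le> real (r n)" using seq_suble[OF l(2)] by simp
        also have "\<dots> < norm (p (r n))" using x'(2)[of "r n"] by simp
        finally have *: "R \<le> norm (p (r n))" by simp
        define t where "t = R / norm (p (r n))"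
        have t: "0 \<le> t" "t \<le> 1" using * R pos[of "r n"] by (auto simp: t_def)
        have "R *\<^sub>R e (r n) = (1 - t) *\<^sub>R 0 + t *\<^sub>R p (r n)" by (simp add: e_def t_def field_simps)
        moreover have "H i (x (r n)) ((1 - t) *\<^sub>R 0 + t *\<^sub>R p (r n))
            \<le> (1 - t) * H i (x (r n)) 0 + t * H i (x (r n)) (p (r n))"
          using H_convex t by (intro convex_onD) auto
        moreover have "\<dots> \<le> (1 - t) * max (H i (x (r n)) 0) C + t * max (H i (x (r n)) 0) C"
          using t x(2)[of "r n"] by (intro add_mono mult_left_mono) auto
        ultimately show ?thesis by (simp add: algebra_simps)
      qed
      then show "\<exists>N. \<forall>n\<ge>N. H i (x (r n)) (R *\<^sub>R e (r n)) \<le> max (max (H i (x (r n)) 0) C) 0" by blast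
    qed
    ultimately show False by linarith
  qed
  then obtain L where L: "\<And>i x p. H i x p \<le> C \<Longrightarrow> norm p \<le> L i" by metis
  have "L i \<le> Max (range (\<lambda>i. \<bar>L i\<bar>))" for i
    by (rule order_trans[OF abs_ge_self]) (simp add: Max_ge)
  moreover have "0 \<le> Max (range (\<lambda>i. \<bar>L i\<bar>))"
    by (rule order_trans[OF abs_ge_zero[of "L undefined"]]) (simp add: Max_ge)
  ultimately show ?thesis using that L order_trans by meson
qed

lemma H_bounded_below:
  obtains C where "\<And>i x p. - C \<le> H i x p"
proof -
  obtain L where L: "\<And>i x p. H i x p \<le> 0 \<Longrightarrow> norm p \<le> L" using H_sublevel_bounded by metis
  have "\<exists>C. \<forall>x p. - C \<le> H i x p" for i
  proof -
    have "continuous_on (cbox 0 1 \<times> cball 0 L) (\<lambda>(x, p). H i x p)"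
      using H_continuous continuous_on_subset by blast
    then have "compact ((\<lambda>(x, p). H i x p) ` (cbox 0 1 \<times> cball 0 L))"
      by (intro compact_continuous_image compact_Times compact_cbox compact_cball)
    then obtain B where B: "\<And>x p. x \<in> cbox 0 1 \<Longrightarrow> norm p \<le> L \<Longrightarrow> \<bar>H i x p\<bar> \<le> B"
      using compact_imp_bounded[THEN bounded_iff[THEN iffD1]] by fastforce
    have "- \<bar>B\<bar> \<le> H i x p" for x p
    proof (cases "H i x p \<le> 0")
      case True
      obtain k where "\<forall>j. k $ j \<in> \<int>" "x + k \<in> cbox 0 1" by (rule periodic_representative)
      with B[of "x + k" p] L[OF True] show ?thesis by (simp add: H_shift)
    qed simp
    then show ?thesis by blast
  qed
  then obtain C where C: "\<And>i x p. - C i \<le> H i x p" by metis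
  have "- Max (range C) \<le> - C i" for i by (simp add: Max_ge)
  then show ?thesis using that C order_trans by meson
qed

lemma H_uniformly_continuous:
  assumes "\<eta> > 0"
  obtains r where "r > 0"
    "\<And>i x x' p p'. x \<in> cball a 1 \<Longrightarrow> x' \<in> cball a 1 \<Longrightarrow> norm p \<le> L \<Longrightarrow> norm p' \<le> L \<Longrightarrow>
       norm (x - x') < r \<Longrightarrow> norm (p - p') < r \<Longrightarrow> \<bar>H i x p - H i x' p'\<bar> < \<eta>"
proof -
  have "\<exists>r>0. \<forall>x x' p p'. x \<in> cball a 1 \<longrightarrow> x' \<in> cball a 1 \<longrightarrow> norm p \<le> L \<longrightarrow> norm p' \<le> L \<longrightarrow>
      norm (x - x') < r \<longrightarrow> norm (p - p') < r \<longrightarrow> \<bar>H i x p - H i x' p'\<bar> < \<eta>" for i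
  proof -
    have "continuous_on (cball a 1 \<times> cball 0 L) (\<lambda>(x, p). H i x p)"
      using H_continuous continuous_on_subset by blast
    then have "uniformly_continuous_on (cball a 1 \<times> cball 0 L) (\<lambda>(x, p). H i x p)"
      by (intro compact_uniformly_continuous compact_Times compact_cball)
    then obtain d where d: "d > 0" "\<And>x x' p p'. x \<in> cball a 1 \<Longrightarrow> x' \<in> cball a 1 \<Longrightarrow>
        norm p \<le> L \<Longrightarrow> norm p' \<le> L \<Longrightarrow> dist (x', p') (x, p) < d \<Longrightarrow> \<bar>H i x' p' - H i x p\<bar> < \<eta>"
      using assms unfolding uniformly_continuous_on_def dist_real_def by fastforce
    have "\<bar>H i x p - H i x' p'\<bar> < \<eta>" if *: "x \<in> cball a 1" "x' \<in> cball a 1" "norm p \<le> L"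
      "norm p' \<le> L" "norm (x - x') < d / 2" "norm (p - p') < d / 2" for x x' p p'
    proof -
      have "dist (x', p') (x, p) \<le> dist x' x + dist p' p"
        unfolding dist_Pair_Pair by (rule sqrt_sum_squares_le_sum) auto
      also have "\<dots> < d" using *(5,6) by (simp add: dist_norm norm_minus_commute)
      finally show ?thesis using d(2)[of x x' p p'] * by (simp add: abs_minus_commute)
    qed
    with d(1) show ?thesis by (intro exI[of _ "d / 2"]) auto
  qed
  then obtain r where r: "\<And>i. r i > 0" "\<And>i x x' p p'. x \<in> cball a 1 \<Longrightarrow> x' \<in> cball a 1 \<Longrightarrow>
      norm p \<le> L \<Longrightarrow> norm p' \<le> L \<Longrightarrow>
      norm (x - x') < r i \<Longrightarrow> norm (p - p') < r i \<Longrightarrow> \<bar>H i x p - H i x' p'\<bar> < \<eta>"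
    by metis
  have "Min (range r) > 0" using r(1) by simp
  moreover have "Min (range r) \<le> r i" for i by simp
  ultimately show ?thesis
    using that[of "Min (range r)"] r(2) by (meson less_le_trans)
qed

lemma coupling_mono:
  assumes "\<And>j. u $ j \<le> v $ j"
  shows "(A *v v) $ i \<le> (A *v u) $ i + A $ i $ i * (v $ i - u $ i)"
proof -
  have "(A *v v) $ i - (A *v u) $ i = (\<Sum>j\<in>UNIV. A $ i $ j * (v $ j - u $ j))"
    by (simp add: matrix_vector_mult_def sum_subtractf algebra_simps)
  also have "\<dots> = A $ i $ i * (v $ i - u $ i) + (\<Sum>j\<in>UNIV - {i}. A $ i $ j * (v $ j - u $ j))"
    by (subst sum.remove[of UNIV i]) auto
  also have "(\<Sum>j\<in>UNIV - {i}. A $ i $ j * (v $ j - u $ j)) \<le> 0"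
    using assms A_off_diagonal by (intro sum_nonpos mult_nonpos_nonneg) auto
  finally show ?thesis by simp
qed

lemma coupling_const: "A *v (u + (\<chi> i. c)) = A *v u"
  using A_row_sum by (simp add: vec_eq_iff matrix_vector_mult_def distrib_left sum.distrib
      flip: sum_distrib_right)

lemma A_diagonal_nonneg: "0 \<le> A $ i $ i"
proof -
  have "0 = A $ i $ i + (\<Sum>j\<in>UNIV - {i}. A $ i $ j)"
    using A_row_sum[of i] by (subst (asm) sum.remove[of UNIV i]) auto
  moreover have "(\<Sum>j\<in>UNIV - {i}. A $ i $ j) \<le> 0"
    using A_off_diagonal by (intro sum_nonpos) auto
  ultimately show ?thesis by linarith
qed

text \<open>Being within a bounded distance of the
  largest entry spreads from a set of indices to a further index whenever a coefficient
  leads out of the set, and irreducibility supplies such a coefficient until all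
  indices are reached.\<close>

lemma coupling_oscillation:
  obtains D where "D \<ge> 0" "\<And>w i j. (\<And>i. (A *v w) $ i \<le> C) \<Longrightarrow> w $ i - w $ j \<le> D"
proof -
  define neg where "neg = {(i, j). A $ i $ j < 0}"
  obtain \<mu> where \<mu>: "\<mu> > 0" "\<And>i j. A $ i $ j < 0 \<Longrightarrow> A $ i $ j \<le> - \<mu>"
  proof (cases "neg = {}")
    case True
    then show ?thesis using that[of 1] by (auto simp: neg_def)
  next
    case False
    let ?M = "Max ((\<lambda>(i, j). A $ i $ j) ` neg)"
    have "finite neg" by simp
    then have "?M < 0" using False by (simp add: Max_less_iff) (auto simp: neg_def)
    moreover have "A $ i $ j \<le> ?M" if "A $ i $ j < 0" for i j
      using that \<open>finite neg\<close> by (intro Max_ge) (auto simp: neg_def)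
    ultimately show ?thesis using that[of "- ?M"] by simp
  qed
  obtain S where S: "\<And>i. A $ i $ i \<le> S" "S \<ge> 0"
  proof
    show "A $ i $ i \<le> Max (range (\<lambda>i. A $ i $ i))" for i by simp
    then show "Max (range (\<lambda>i. A $ i $ i)) \<ge> 0"
      using A_diagonal_nonneg order_trans by blast
  qed
  have main: "\<exists>D\<ge>0. \<forall>w M. (\<forall>i. (A *v w) $ i \<le> C) \<longrightarrow> (\<forall>i. w $ i \<le> M) \<longrightarrow> (\<exists>i. w $ i = M) \<longrightarrow>
      (\<exists>W. card W \<ge> n \<and> (\<forall>i\<in>W. w $ i \<ge> M - D))" if "n \<le> CARD('m)" for n
    using that
  proof (induction n)
    case 0
    show ?case by (rule exI[of _ 0]) auto
  next
    case (Suc n)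
    then obtain D where D: "D \<ge> 0" "\<And>w M. (\<forall>i. (A *v w) $ i \<le> C) \<Longrightarrow> (\<forall>i. w $ i \<le> M) \<Longrightarrow>
      (\<exists>i. w $ i = M) \<Longrightarrow> (\<exists>W. card W \<ge> n \<and> (\<forall>i\<in>W. w $ i \<ge> M - D))" by auto
    define D' where "D' = D + (\<bar>C\<bar> + D * S) / \<mu>"
    have D': "D' \<ge> D" using D S \<mu> by (simp add: D'_def)
    show ?case
    proof (intro exI[of _ D'] conjI allI impI)
      show "D' \<ge> 0" using D D' by simp
      fix w M assume w: "\<forall>i. (A *v w) $ i \<le> C" "\<forall>i. w $ i \<le> M" "\<exists>i. w $ i = M"
      from D(2)[OF w] obtain W where W: "card W \<ge> n" "\<And>i. i \<in> W \<Longrightarrow> w $ i \<ge> M - D" by auto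
      show "\<exists>W. card W \<ge> Suc n \<and> (\<forall>i\<in>W. w $ i \<ge> M - D')"
      proof (cases "W = {} \<or> W = UNIV")
        case True
        then show ?thesis
        proof
          assume "W = {}"
          then have "n = 0" using W by simp
          obtain i where "w $ i = M" using w by blast
          then show ?thesis using \<open>n = 0\<close> D D' by (intro exI[of _ "{i}"]) auto
        next
          assume "W = UNIV"
          then show ?thesis using Suc.prems order_trans[OF _ W(2)] D' by (intro exI[of _ UNIV]) auto
        qed
      next
        case False
        then obtain i j where ij: "i \<in> W" "j \<notin> W" "A $ i $ j < 0"
          using A_irreducible unfolding irreducible_coupling_def by (metis top.not_eq_extremum)
        have "i \<noteq> j" using ij by auto
        have "(A *v w) $ i = (\<Sum>k\<in>UNIV. A $ i $ k * (w $ k - w $ i))"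
          using A_row_sum[of i]
          by (simp add: matrix_vector_mult_def right_diff_distrib sum_subtractf flip: sum_distrib_right)
        also have "\<dots> = A $ i $ j * (w $ j - w $ i) + (\<Sum>k\<in>UNIV - {j}. A $ i $ k * (w $ k - w $ i))"
          by (subst sum.remove[of UNIV j]) auto
        finally have e1: "(A *v w) $ i
          = A $ i $ j * (w $ j - w $ i) + (\<Sum>k\<in>UNIV - {j}. A $ i $ k * (w $ k - w $ i))" .
        have e2: "(\<Sum>k\<in>UNIV - {j}. A $ i $ k * (w $ k - w $ i)) \<ge> (\<Sum>k\<in>UNIV - {j}. if k = i then 0 else A $ i $ k * D)"
        proof (rule sum_mono)
          fix k
          show "(if k = i then 0 else A $ i $ k * D) \<le> A $ i $ k * (w $ k - w $ i)"
            using w(2)[rule_format, of k] W(2)[OF ij(1)] A_off_diagonal[of i k]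
            by (auto intro!: mult_left_mono_neg)
        qed
        have e3: "(\<Sum>k\<in>UNIV - {j}. if k = i then 0 else A $ i $ k * D) \<ge> (\<Sum>k\<in>UNIV. if k = i then 0 else A $ i $ k * D)"
          using ij(3) \<open>i \<noteq> j\<close> D(1) by (subst sum.remove[of UNIV j]) (auto simp: mult_nonpos_nonneg)
        have e4: "(\<Sum>k\<in>UNIV. if k = i then 0 else A $ i $ k * D) = - A $ i $ i * D"
        proof -
          have "(\<Sum>k\<in>UNIV. A $ i $ k * D) = 0" using A_row_sum[of i] by (simp flip: sum_distrib_right)
          then show ?thesis
            by (subst (asm) sum.remove[of UNIV i], simp, simp, subst sum.remove[of UNIV i]) auto
        qed
        have "A $ i $ j * (w $ j - w $ i) - A $ i $ i * D \<le> C"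
          using w(1)[rule_format, of i] e1 e2 e3 e4 by linarith
        moreover have "A $ i $ i * D \<le> D * S" using S(1)[of i] D(1) by (simp add: mult.commute mult_left_mono)
        ultimately have *: "(- A $ i $ j) * (w $ i - w $ j) \<le> \<bar>C\<bar> + D * S"
          by (simp add: algebra_simps)
        have "w $ i - w $ j \<le> (\<bar>C\<bar> + D * S) / \<mu>"
        proof (cases "w $ i - w $ j \<le> 0")
          case True
          have "0 \<le> (\<bar>C\<bar> + D * S) / \<mu>" using D S \<mu> by simp
          with True show ?thesis by linarith
        next
          case False
          then have "\<mu> * (w $ i - w $ j) \<le> (- A $ i $ j) * (w $ i - w $ j)"
            using \<mu>(2)[OF ij(3)] by (intro mult_right_mono) auto
          with * have "\<mu> * (w $ i - w $ j) \<le> \<bar>C\<bar> + D * S" by linarith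
          then show ?thesis using \<mu>(1) by (simp add: pos_le_divide_eq mult.commute)
        qed
        then have "w $ j \<ge> M - D'" using W(2)[OF ij(1)] by (simp add: D'_def)
        moreover have "card (insert j W) \<ge> Suc n" using W(1) ij(2) by simp
        ultimately show ?thesis using W(2) D' order_trans[OF _ W(2)] by (intro exI[of _ "insert j W"]) auto
      qed
    qed
  qed
  from main[of "CARD('m)"] obtain D where D: "D \<ge> 0"
    "\<And>w M. (\<forall>i. (A *v w) $ i \<le> C) \<Longrightarrow> (\<forall>i. w $ i \<le> M) \<Longrightarrow>
      (\<exists>i. w $ i = M) \<Longrightarrow> (\<exists>W. card W \<ge> CARD('m) \<and> (\<forall>i\<in>W. w $ i \<ge> M - D))"
    by blast
  have "w $ i - w $ j \<le> D" if w: "\<And>i. (A *v w) $ i \<le> C" for w i j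
  proof -
    let ?M = "Max (range (\<lambda>i. w $ i))"
    have M: "w $ i \<le> ?M" for i by simp
    have "?M \<in> range (\<lambda>i. w $ i)" by (rule Max_in) auto
    then have "\<exists>i. w $ i = ?M" by (metis imageE)
    from D(2)[OF _ _ this] w M obtain W where W: "card W \<ge> CARD('m)" "\<And>i. i \<in> W \<Longrightarrow> w $ i \<ge> ?M - D"
      by blast
    from W(1) have "W = UNIV" by (metis card_mono card_subset_eq finite order_antisym subset_UNIV)
    then have "?M - D \<le> w $ j" using W(2) by blast
    with M[of i] show ?thesis by linarith
  qed
  with D(1) that show ?thesis by blast
qed

end

lemma continuous_on_cartI:
  fixes u :: "'a::topological_space \<Rightarrow> real^'m::finite"
  assumes "\<And>i. continuous_on S (\<lambda>z. u z $ i)"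
  shows "continuous_on S u"
  using continuous_on_vec_lambda[of S "\<lambda>i z. u z $ i"] assms by simp

context weakly_coupled
begin

lemma subsolution_superdiff:
  assumes "subsolution H A \<alpha> u" "p \<in> superdiff (\<lambda>z. u z $ i) x"
  shows "H i x p + (A *v u x) $ i \<le> \<alpha>"
  using assms by (auto simp: subsolution_iff_superdiff)

lemma subsolution_continuous:
  assumes "subsolution H A \<alpha> u"
  shows "continuous_on S (\<lambda>z. u z $ i)" "continuous_on S (\<lambda>z. (A *v u z) $ i)"
proof -
  have "continuous_on S u" using assms continuous_on_subset by (auto simp: subsolution_def)
  then show *: "continuous_on S (\<lambda>z. u z $ i)" for i by (intro continuous_intros)
  show "continuous_on S (\<lambda>z. (A *v u z) $ i)"
    unfolding matrix_vector_mult_def by (auto intro!: continuous_intros *)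
qed

lemma subsolution_shift:
  assumes "subsolution H A \<alpha> u" "\<forall>j. k $ j \<in> \<int>"
  shows "u (x + k) = u x"
  using assms by (auto simp: subsolution_def zperiodic_def)

lemma subsolution_coupling_le:
  obtains C where "\<And>u x i. subsolution H A \<alpha> u \<Longrightarrow> (A *v u x) $ i \<le> C"
proof -
  obtain B where B: "\<And>i x p. - B \<le> H i x p" using H_bounded_below by metis
  have "(A *v u x) $ i \<le> \<alpha> + B" if u: "subsolution H A \<alpha> u" for u x i
  proof -
    let ?S = "{z. (A *v u z) $ i \<le> \<alpha> + B}"
    have "closed ?S"
      by (intro closed_Collect_le subsolution_continuous[OF u] continuous_intros)
    moreover have "x \<in> closure ?S"
    proof (unfold closure_approachable, intro allI impI)
      fix r :: real assume "r > 0"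
      from superdiff_nonempty_nearby[OF subsolution_continuous(1)[OF u] this, of x i]
      obtain z p where z: "norm (z - x) < r" "p \<in> superdiff (\<lambda>z. u z $ i) z" by blast
      from subsolution_superdiff[OF u z(2)] B[of i z p] have "z \<in> ?S" by simp
      with z(1) show "\<exists>z\<in>?S. dist z x < r" by (auto simp: dist_norm)
    qed
    ultimately show ?thesis by (simp add: closure_closed)
  qed
  then show ?thesis by (rule that)
qed

text \<open>The constant depends on the level only: the lower bound on \<open>H\<close> bounds
  \<open>A u\<close> from above, hence the oscillation of the vector \<open>u x\<close>, hence \<open>A u\<close> from below;
  coercivity then bounds the superdifferentials.\<close>

lemma subsolution_bounds:
  obtains L where "L \<ge> 0"
    "\<And>u i x p. subsolution H A \<alpha> u \<Longrightarrow> p \<in> superdiff (\<lambda>z. u z $ i) x \<Longrightarrow> norm p \<le> L"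
    "\<And>u i x y. subsolution H A \<alpha> u \<Longrightarrow> \<bar>u x $ i - u y $ i\<bar> \<le> L * norm (x - y)"
proof -
  obtain C where C: "\<And>u x i. subsolution H A \<alpha> u \<Longrightarrow> (A *v u x) $ i \<le> C"
    using subsolution_coupling_le by metis
  obtain D where D: "D \<ge> 0" "\<And>w i j. (\<And>i. (A *v w) $ i \<le> C) \<Longrightarrow> w $ i - w $ j \<le> D"
    using coupling_oscillation by metis
  define S where "S = Max (range (\<lambda>i. \<Sum>j\<in>UNIV. \<bar>A $ i $ j\<bar>))"
  have S: "(\<Sum>j\<in>UNIV. \<bar>A $ i $ j\<bar>) \<le> S" for i by (simp add: S_def)
  have low: "- (S * D) \<le> (A *v u x) $ i" if u: "subsolution H A \<alpha> u" for u x i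
  proof -
    have osc: "\<bar>u x $ j - u x $ i\<bar> \<le> D" for j
      using D(2)[OF C[OF u], of x i j] D(2)[OF C[OF u], of x j i] by simp
    have "(A *v u x) $ i = (\<Sum>j\<in>UNIV. A $ i $ j * (u x $ j - u x $ i))"
      using A_row_sum[of i]
      by (simp add: matrix_vector_mult_def right_diff_distrib sum_subtractf flip: sum_distrib_right)
    also have "\<bar>\<dots>\<bar> \<le> (\<Sum>j\<in>UNIV. \<bar>A $ i $ j\<bar> * D)"
      by (intro order_trans[OF sum_abs] sum_mono) (simp add: abs_mult mult_left_mono osc)
    also have "\<dots> \<le> S * D"
      unfolding sum_distrib_right[symmetric] using S D(1) by (rule mult_right_mono)
    finally show ?thesis by linarith
  qed
  obtain L where L: "L \<ge> 0" "\<And>i x p. H i x p \<le> \<alpha> + S * D \<Longrightarrow> norm p \<le> L"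
    using H_sublevel_bounded by metis
  have p: "norm p \<le> L" if "subsolution H A \<alpha> u" "p \<in> superdiff (\<lambda>z. u z $ i) x" for u i x p
    using subsolution_superdiff[OF that] low[OF that(1), of x i] by (intro L(2)[of i x]) simp
  have le: "u x $ i \<le> u y $ i + L * norm (x - y)" if u: "subsolution H A \<alpha> u" for u i x y
  proof -
    let ?R = "norm x + norm y + 1"
    have "u (y + 1 *\<^sub>R (x - y)) $ i \<le> u y $ i + (L * norm (x - y)) * 1"
    proof (rule superdiff_bound_imp_increment[where a = 0 and R = ?R])
      fix z q assume "q \<in> superdiff (\<lambda>z. u z $ i) z"
      from p[OF u this] have "norm (x - y) * norm q \<le> norm (x - y) * L" by (intro mult_left_mono) auto
      then show "(x - y) \<bullet> q \<le> L * norm (x - y)"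
        using norm_cauchy_schwarz[of "x - y" q] by (simp add: mult.commute)
    qed (auto intro: subsolution_continuous[OF u] add_nonneg_pos simp: add_nonneg_pos add_pos_nonneg)
    then show ?thesis by simp
  qed
  have "\<bar>u x $ i - u y $ i\<bar> \<le> L * norm (x - y)" if "subsolution H A \<alpha> u" for u i x y
    using le[OF that, of x i y] le[OF that, of y i x] by (simp add: norm_minus_commute)
  with L(1) p that show ?thesis by blast
qed

section \<open>Maxima and suprema of subsolutions\<close>

text \<open>Off-diagonal coefficients are nonpositive, so raising components never hurts the equation of
  a component that is not raised at the point in question; only the raised values have to be
  checked, and there the gradient is that of the test function.\<close>

lemma subsolution_max:
  fixes g :: "'m \<Rightarrow> real^'n \<Rightarrow> real"
  assumes u: "subsolution H A \<alpha> u" and g: "\<And>i. C1_torus (g i) (Dg i)"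
    and le: "\<And>i z. u z $ i < g i z \<Longrightarrow>
      H i z (Dg i z) + (A *v u z) $ i + A $ i $ i * (g i z - u z $ i) \<le> \<alpha>"
  shows "subsolution H A \<alpha> (\<lambda>z. \<chi> i. max (u z $ i) (g i z))" (is "subsolution H A \<alpha> ?w")
  unfolding subsolution_iff_superdiff
proof (intro conjI allI ballI)
  show "zperiodic ?w"
    using u g by (auto simp: subsolution_def zperiodic_def C1_torus_def)
  show "continuous_on UNIV ?w"
    by (rule continuous_on_cartI)
      (auto intro!: continuous_intros subsolution_continuous[OF u] C1_torus_continuous(1)[OF g])
  fix i x p assume p: "p \<in> superdiff (\<lambda>z. ?w z $ i) x"
  have mono: "(A *v ?w x) $ i \<le> (A *v u x) $ i + A $ i $ i * (?w x $ i - u x $ i)"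
    by (rule coupling_mono) simp
  show "H i x p + (A *v ?w x) $ i \<le> \<alpha>"
  proof (cases "u x $ i < g i x")
    case True
    have "p \<in> superdiff (g i) x"
      by (rule superdiff_mono[OF p]) (use True in auto)
    then have "p = Dg i x" using g by (auto simp: C1_torus_def intro: superdiff_GDERIV)
    with le[OF True] mono True show ?thesis by simp
  next
    case False
    have "p \<in> superdiff (\<lambda>z. u z $ i) x"
      by (rule superdiff_mono[OF p]) (use False in auto)
    from subsolution_superdiff[OF u this] mono False show ?thesis by simp
  qed
qed

lemma subsolution_Sup:
  assumes U: "\<And>v. v \<in> U \<Longrightarrow> subsolution H A \<alpha> v"
    and ub: "\<And>v z i. v \<in> U \<Longrightarrow> v z $ i \<le> u z $ i"
    and approx: "\<And>z i \<epsilon>. \<epsilon> > 0 \<Longrightarrow> \<exists>v\<in>U. u z $ i - \<epsilon> < v z $ i"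
  shows "subsolution H A \<alpha> u"
proof -
  obtain L where L: "L \<ge> 0"
    "\<And>v i x y. subsolution H A \<alpha> v \<Longrightarrow> \<bar>v x $ i - v y $ i\<bar> \<le> L * norm (x - y)"
    using subsolution_bounds by metis
  have lip1: "u x $ i \<le> u y $ i + L * norm (x - y)" for x y i
  proof (rule field_le_epsilon)
    fix \<epsilon> :: real assume "\<epsilon> > 0"
    from approx[OF this, of x i] obtain v where v: "v \<in> U" "u x $ i - \<epsilon> < v x $ i" by blast
    with L(2)[OF U[OF v(1)], of x i y] ub[OF v(1), of y i]
    show "u x $ i \<le> u y $ i + L * norm (x - y) + \<epsilon>" by linarith
  qed
  have per1: "u (x + k) $ i \<le> u x $ i" if k: "\<forall>j. k $ j \<in> \<int>" for x k i
  proof (rule field_le_epsilon)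
    fix \<epsilon> :: real assume "\<epsilon> > 0"
    from approx[OF this, of "x + k" i] obtain v where v: "v \<in> U" "u (x + k) $ i - \<epsilon> < v (x + k) $ i"
      by blast
    with subsolution_shift[OF U[OF v(1)] k, of x] ub[OF v(1), of x i]
    show "u (x + k) $ i \<le> u x $ i + \<epsilon>" by simp
  qed
  have per: "u (x + k) = u x" if k: "\<forall>j. k $ j \<in> \<int>" for x k
  proof -
    have "u ((x + k) + - k) $ i \<le> u (x + k) $ i" for i using k by (intro per1) simp
    with per1[OF k, of x] show ?thesis by (simp add: vec_eq_iff order_antisym)
  qed
  have "L-lipschitz_on UNIV (\<lambda>z. u z $ i)" for i
    using lip1 L(1) unfolding lipschitz_on_def dist_real_def dist_norm
    by (auto simp: abs_le_iff) (metis diff_le_eq add.commute, metis diff_le_eq add.commute norm_minus_commute)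
  then have cont_i: "continuous_on UNIV (\<lambda>z. u z $ i)" for i
    by (rule lipschitz_on_continuous_on)
  then have cont: "continuous_on UNIV u" by (rule continuous_on_cartI)
  show ?thesis
    unfolding subsolution_iff_superdiff
  proof (intro conjI allI ballI cont)
    show "zperiodic u" using per by (simp add: zperiodic_def)
    fix i x p assume "p \<in> superdiff (\<lambda>z. u z $ i) x"
    then obtain \<phi> D\<phi> where \<phi>: "C1_torus \<phi> D\<phi>"
      "\<forall>\<^sub>F z in nhds x. u z $ i - \<phi> z \<le> u x $ i - \<phi> x" "p = D\<phi> x" by (rule superdiffE)
    from \<phi>(2) obtain d where d: "d > 0" "\<And>z. norm (z - x) < d \<Longrightarrow> u z $ i - \<phi> z \<le> u x $ i - \<phi> x"
      unfolding eventually_nhds_norm by auto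
    define G where "G z = H i z (D\<phi> z + Dsqd x z) + (A *v u z) $ i" for z
    \<comment> \<open>Adding \<open>sqd\<close> makes the maximum of \<open>u\<^sub>i - \<phi>\<close> strict, so a member of the family that nearly
      attains the supremum at \<open>x\<close> has an interior maximum nearby.\<close>
    have near: "\<exists>z. norm (z - x) < r \<and> G z \<le> \<alpha> + A $ i $ i * r\<^sup>2"
      if r: "0 < r" "r < d" "r \<le> 1/2" for r
    proof -
      have "r\<^sup>2 > 0" using r by simp
      from approx[OF this, of x i] obtain v where v: "v \<in> U" "u x $ i - r\<^sup>2 < v x $ i" by blast
      note vs = U[OF v(1)]
      let ?F = "\<lambda>z. v z $ i - (\<phi> z + sqd x z)"
      have C1: "C1_torus (\<lambda>z. \<phi> z + sqd x z) (\<lambda>z. D\<phi> z + Dsqd x z)"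
        by (rule C1_torus_add[OF \<phi>(1) C1_torus_sqd])
      have "continuous_on (cball x r) ?F"
        by (intro continuous_intros subsolution_continuous[OF vs]
            continuous_on_subset[OF C1_torus_continuous(1)[OF C1]]) simp
      then obtain z where z: "z \<in> cball x r" "\<And>w. w \<in> cball x r \<Longrightarrow> ?F w \<le> ?F z"
        using continuous_attains_sup[OF compact_cball, of x r ?F] r by auto
      have zx: "norm (z - x) \<le> r" using z(1) by (simp add: dist_norm norm_minus_commute)
      have Fx: "v x $ i - \<phi> x \<le> v z $ i - \<phi> z - sqd x z" using z(2)[of x] r by simp
      have uz: "u z $ i - \<phi> z \<le> u x $ i - \<phi> x" using d(2) zx r by simp
      have "norm (z - x) < r"
      proof (rule ccontr)
        assume "\<not> ?thesis"
        then have "norm (z - x) = r" using zx by simp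
        then have "r\<^sup>2 \<le> sqd x z" using norm_square_le_sqd[of z x] r by simp
        with Fx uz ub[OF v(1), of z i] v(2) show False by linarith
      qed
      have "\<forall>\<^sub>F w in nhds z. ?F w \<le> ?F z"
        unfolding eventually_nhds_norm
      proof (intro exI[of _ "r - norm (z - x)"] conjI allI impI)
        fix w assume "norm (w - z) < r - norm (z - x)"
        then have "norm (w - x) < r" using norm_triangle_ineq[of "w - z" "z - x"] by simp
        then show "?F w \<le> ?F z" by (intro z(2)) (simp add: dist_norm norm_minus_commute)
      qed (use \<open>norm (z - x) < r\<close> in simp)
      from superdiffI[OF C1 this] have "D\<phi> z + Dsqd x z \<in> superdiff (\<lambda>z. v z $ i) z" .
      from subsolution_superdiff[OF vs this]
      have "H i z (D\<phi> z + Dsqd x z) + (A *v v z) $ i \<le> \<alpha>" .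
      moreover have "(A *v u z) $ i \<le> (A *v v z) $ i + A $ i $ i * (u z $ i - v z $ i)"
        using ub[OF v(1)] by (rule coupling_mono)
      moreover have "A $ i $ i * (u z $ i - v z $ i) \<le> A $ i $ i * r\<^sup>2"
        using Fx uz v(2) sqd_nonneg[of x z] by (intro mult_left_mono A_diagonal_nonneg) linarith
      ultimately have "G z \<le> \<alpha> + A $ i $ i * r\<^sup>2" by (simp add: G_def)
      with \<open>norm (z - x) < r\<close> show ?thesis by blast
    qed
    have "continuous_on UNIV G"
      unfolding G_def matrix_vector_mult_def
      by (auto intro!: continuous_intros cont_i C1_torus_continuous[OF C1_torus_sqd]
          C1_torus_continuous[OF \<phi>(1)])
    show "H i x p + (A *v u x) $ i \<le> \<alpha>"
    proof (rule ccontr)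
      assume "\<not> ?thesis"
      then have gt: "G x > \<alpha>" using \<phi>(3) by (simp add: G_def)
      define \<eta> where "\<eta> = (G x - \<alpha>) / 2"
      have \<eta>: "\<eta> > 0" "\<alpha> + \<eta> < G x" using gt by (auto simp: \<eta>_def field_simps)
      have "open {z. \<alpha> + \<eta> < G z}"
        using \<open>continuous_on UNIV G\<close> by (intro open_Collect_less) auto
      then obtain e where e: "e > 0" "\<And>z. norm (z - x) < e \<Longrightarrow> \<alpha> + \<eta> < G z"
        using \<eta>(2) unfolding open_dist dist_norm by blast
      have a1: "A $ i $ i + 1 > 0" using A_diagonal_nonneg[of i] by simp
      define q where "q = \<eta> / (A $ i $ i + 1)"
      have "q > 0" using \<eta>(1) a1 by (simp add: q_def)
      define r where "r = min (min e (d / 2)) (min (1/2) q)"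
      have r: "0 < r" "r < d" "r \<le> 1/2" "r \<le> e" "r \<le> q"
        using e(1) d(1) \<open>q > 0\<close> unfolding r_def by linarith+
      have "r\<^sup>2 \<le> r" using r mult_left_mono[of r 1 r] by (simp add: power2_eq_square)
      then have "A $ i $ i * r\<^sup>2 \<le> A $ i $ i * r" by (intro mult_left_mono A_diagonal_nonneg)
      also have "\<dots> \<le> (A $ i $ i + 1) * r" using r by (simp add: algebra_simps)
      also have "\<dots> \<le> \<eta>" using r(5) a1 by (simp add: q_def pos_le_divide_eq mult.commute)
      finally have "A $ i $ i * r\<^sup>2 \<le> \<eta>" .
      moreover from near[OF r(1-3)] obtain z where "norm (z - x) < r" "G z \<le> \<alpha> + A $ i $ i * r\<^sup>2" by blast
      ultimately show False using e(2)[of z] r(4) by linarith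
    qed
  qed
qed

lemma maximal_subsolution_exists:
  assumes u0: "subsolution H A \<alpha> u0" "u0 y = b"
  obtains u where "subsolution H A \<alpha> u" "u y = b"
    "\<And>v z i. subsolution H A \<alpha> v \<Longrightarrow> v y = b \<Longrightarrow> v z $ i \<le> u z $ i"
proof -
  obtain L where L: "\<And>v i x y. subsolution H A \<alpha> v \<Longrightarrow> \<bar>v x $ i - v y $ i\<bar> \<le> L * norm (x - y)"
    using subsolution_bounds by metis
  define U where "U = {v. subsolution H A \<alpha> v \<and> v y = b}"
  define u where "u z = (\<chi> i. SUP v\<in>U. v z $ i)" for z
  have "U \<noteq> {}" using u0 by (auto simp: U_def)
  have bdd: "bdd_above ((\<lambda>v. v z $ i) ` U)" for z i
  proof (rule bdd_aboveI2)
    fix v assume "v \<in> U"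
    then show "v z $ i \<le> b $ i + L * norm (z - y)"
      using L[of v z i y] by (auto simp: U_def)
  qed
  have ub: "v z $ i \<le> u z $ i" if "v \<in> U" for v z i
    using cSUP_upper[OF that bdd] by (simp add: u_def)
  have "subsolution H A \<alpha> u"
  proof (rule subsolution_Sup[of U])
    fix z i and \<epsilon> :: real assume "\<epsilon> > 0"
    then have "u z $ i - \<epsilon> < (SUP v\<in>U. v z $ i)" by (simp add: u_def)
    then show "\<exists>v\<in>U. u z $ i - \<epsilon> < v z $ i" using less_cSUP_iff[OF \<open>U \<noteq> {}\<close> bdd] by blast
  qed (use ub in \<open>auto simp: U_def\<close>)
  moreover have "u y = b"
  proof -
    have "(\<lambda>v. v y $ i) ` U = {b $ i}" for i
      using \<open>U \<noteq> {}\<close> by (auto simp: U_def)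
    then show ?thesis by (simp add: u_def vec_eq_iff)
  qed
  ultimately show ?thesis using that ub by (auto simp: U_def)
qed

end

section \<open>Strictness of a subsolution near a point\<close>

context weakly_coupled
begin

text \<open>The viscosity form of local strictness, for a single component. It does not mention
  differentiability, so it makes sense for suprema and convex combinations of subsolutions, and
  it can be gained one component at a time.\<close>

definition strict_at :: "real \<Rightarrow> (real^'n \<Rightarrow> real^'m) \<Rightarrow> real^'n \<Rightarrow> 'm \<Rightarrow> bool" where
  "strict_at \<alpha> u y i \<longleftrightarrow> (\<exists>\<delta>>0. \<exists>r>0. \<forall>x p. norm (x - y) < r \<longrightarrow>
     p \<in> superdiff (\<lambda>z. u z $ i) x \<longrightarrow> H i x p + (A *v u x) $ i \<le> \<alpha> - \<delta>)"

text \<open>The Perron bump: where the supersolution test fails, the component can be raised by the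
  test function itself, and the raised function is a strict subsolution there. The term
  \<^const>\<open>sqd\<close> confines the bump to a small neighbourhood of \<open>x + \<int>\<^sup>N\<close>.\<close>

lemma bump_where_supersolution_fails:
  assumes u: "subsolution H A \<alpha> u" and \<phi>: "C1_torus \<phi> D\<phi>"
    and min: "local_min_at (\<lambda>z. u z $ i - \<phi> z) x"
    and fails: "H i x (D\<phi> x) + (A *v u x) $ i < \<alpha>" and "\<rho>0 > 0"
  obtains v where "subsolution H A \<alpha> v" "\<And>z j. u z $ j \<le> v z $ j"
    "\<And>z. \<rho>0 \<le> sqd x z \<Longrightarrow> v z = u z" "u x $ i < v x $ i" "strict_at \<alpha> v x i"
proof -
  note Dper = C1_torus_gradient_shift
  define c where "c = u x $ i - \<phi> x"
  define G where "G z = H i z (D\<phi> z - Dsqd x z) + (A *v u z) $ i" for z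
  have "continuous_on UNIV G"
    unfolding G_def by (intro continuous_intros subsolution_continuous[OF u]
        C1_torus_continuous[OF C1_torus_sqd] C1_torus_continuous[OF \<phi>])
  define \<delta> where "\<delta> = (\<alpha> - G x) / 3"
  have \<delta>: "\<delta> > 0" "G x < \<alpha> - 2 * \<delta>" using fails by (auto simp: G_def \<delta>_def field_simps)
  have "open {z. G z < \<alpha> - 2 * \<delta>}"
    using \<open>continuous_on UNIV G\<close> by (intro open_Collect_less) auto
  then obtain e where e: "e > 0" "\<And>z. norm (z - x) < e \<Longrightarrow> G z < \<alpha> - 2 * \<delta>"
    using \<delta>(2) unfolding open_dist dist_norm by blast
  from min obtain d where d: "d > 0" "\<And>z. norm (z - x) < d \<Longrightarrow> \<phi> z + c \<le> u z $ i"
    unfolding local_min_at_def eventually_nhds_norm c_def by (auto simp: algebra_simps)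
  define R where "R = min e d"
  have R: "R > 0" using e d by (simp add: R_def)
  have near: "G z < \<alpha> - 2 * \<delta>" "\<phi> z + c \<le> u z $ i" if z: "sqd x z < R\<^sup>2" for z
  proof -
    obtain k where k: "\<forall>j. k $ j \<in> \<int>" "(norm (z + k - x))\<^sup>2 \<le> sqd x z" by (rule lattice_distance_le_sqd)
    with z have "(norm (z + k - x))\<^sup>2 < R\<^sup>2" by linarith
    then have "norm (z + k - x) < R" using R by (simp add: power2_less_imp_less)
    then have *: "G (z + k) < \<alpha> - 2 * \<delta>" "\<phi> (z + k) + c \<le> u (z + k) $ i"
      using e d by (auto simp: R_def)
    show "G z < \<alpha> - 2 * \<delta>"
      using *(1) by (simp add: G_def H_shift[OF k(1)] subsolution_shift[OF u k(1)]
          Dper[OF \<phi> k(1)] Dper[OF C1_torus_sqd k(1)])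
    have "\<phi> (z + k) = \<phi> z" using \<phi> k(1) by (simp add: C1_torus_def zperiodic_def)
    then show "\<phi> z + c \<le> u z $ i" using *(2) subsolution_shift[OF u k(1), of z] by simp
  qed
  \<comment> \<open>The bump lives on \<open>sqd x z < \<rho> / 2\<close>; its height \<open>\<epsilon>\<close> is small against \<open>\<rho>\<close>, so that it has
    disappeared at the boundary of that region, and small against the gap \<open>\<delta>\<close>.\<close>
  define \<rho> where "\<rho> = min \<rho>0 (R\<^sup>2)"
  have \<rho>: "\<rho> > 0" "\<rho> \<le> \<rho>0" "\<rho> \<le> R\<^sup>2" using \<open>\<rho>0 > 0\<close> R by (auto simp: \<rho>_def)
  define q where "q = \<delta> / (A $ i $ i + 1)"
  have a1: "A $ i $ i + 1 > 0" using A_diagonal_nonneg[of i] by simp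
  have q: "q > 0" "q * (A $ i $ i + 1) = \<delta>" using \<delta> a1 by (auto simp: q_def)
  define \<epsilon> where "\<epsilon> = min (\<rho> / 4) q"
  have \<epsilon>: "\<epsilon> > 0" "\<epsilon> \<le> \<rho> / 4" "\<epsilon> \<le> q" using \<rho> q by (auto simp: \<epsilon>_def)
  have "A $ i $ i * \<epsilon> \<le> A $ i $ i * q" using \<epsilon> A_diagonal_nonneg by (intro mult_left_mono) auto
  also have "\<dots> \<le> \<delta>" using q by (simp add: algebra_simps)
  finally have A\<epsilon>: "A $ i $ i * \<epsilon> \<le> \<delta>" .
  define g where "g z = \<phi> z + (c + \<epsilon>) - sqd x z" for z
  have g: "C1_torus g (\<lambda>z. D\<phi> z + 0 - Dsqd x z)"
    unfolding g_def by (intro C1_torus_diff C1_torus_add \<phi> C1_torus_const C1_torus_sqd)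
  have "zperiodic (\<lambda>z. g z - u z $ i)"
    using g u by (simp add: C1_torus_def zperiodic_def subsolution_def)
  moreover have "continuous_on UNIV (\<lambda>z. g z - u z $ i)"
    by (intro continuous_intros C1_torus_continuous[OF g] subsolution_continuous[OF u])
  ultimately obtain B where "\<And>z. \<bar>g z - u z $ i\<bar> \<le> B" by (rule zperiodic_bounded) blast
  then have B: "g z - u z $ i \<le> B" for z by (meson abs_le_D1)
  have below: "g z < u z $ i" if "\<rho> / 2 \<le> sqd x z" "sqd x z < \<rho>" for z
    using near(2)[of z] that \<rho> \<epsilon> by (simp add: g_def)
  from \<rho> have "\<rho> / 2 < \<rho>" by simp
  from C1_torus_push_below[where f = "\<lambda>z. u z $ i", OF g B this below]
  obtain h Dh where h: "C1_torus h Dh"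
    "\<And>z. sqd x z \<le> \<rho> / 2 \<Longrightarrow> h z = g z \<and> Dh z = D\<phi> z + 0 - Dsqd x z"
    "\<And>z. \<rho> / 2 \<le> sqd x z \<Longrightarrow> h z < u z $ i" by blast
  have "\<exists>b. \<forall>z. - b \<le> u z $ j" for j
  proof -
    have "zperiodic (\<lambda>z. u z $ j)" using u by (simp add: subsolution_def zperiodic_component)
    then obtain b where "\<And>z. \<bar>u z $ j\<bar> \<le> b"
      using zperiodic_bounded subsolution_continuous(1)[OF u] by metis
    then have "\<forall>z. - b \<le> u z $ j" by (metis abs_le_D2 minus_le_iff)
    then show ?thesis by blast
  qed
  then obtain b where b: "\<And>z j. - b j \<le> u z $ j" by metis
  define gs where "gs j = (if j = i then h else (\<lambda>z. - b j))" for j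
  define Dgs where "Dgs j = (if j = i then Dh else (\<lambda>z. 0))" for j
  define v where "v z = (\<chi> j. max (u z $ j) (gs j z))" for z
  have raised: "H i z (Dh z) + (A *v u z) $ i + A $ i $ i * (h z - u z $ i) \<le> \<alpha> - \<delta>"
    if "u z $ i < h z" for z
  proof -
    have z: "sqd x z < \<rho> / 2" using h(3)[of z] that by (meson less_asym not_le)
    then have "sqd x z < R\<^sup>2" using \<rho> by simp
    have "h z - u z $ i \<le> \<epsilon>"
      using h(2)[of z] z near(2)[OF \<open>sqd x z < R\<^sup>2\<close>] sqd_nonneg[of x z] by (simp add: g_def)
    then have "A $ i $ i * (h z - u z $ i) \<le> A $ i $ i * \<epsilon>"
      by (intro mult_left_mono A_diagonal_nonneg)
    moreover have "H i z (Dh z) + (A *v u z) $ i = G z" using h(2)[of z] z by (simp add: G_def)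
    ultimately show ?thesis using near(1)[OF \<open>sqd x z < R\<^sup>2\<close>] A\<epsilon> by linarith
  qed
  have "subsolution H A \<alpha> v"
    unfolding v_def
  proof (rule subsolution_max[OF u])
    show "C1_torus (gs j) (Dgs j)" for j by (simp add: gs_def Dgs_def h(1) C1_torus_const)
    show "H j z (Dgs j z) + (A *v u z) $ j + A $ j $ j * (gs j z - u z $ j) \<le> \<alpha>"
      if "u z $ j < gs j z" for j z
    proof (cases "j = i")
      case True
      with raised[of z] that \<delta>(1) show ?thesis by (simp add: gs_def Dgs_def)
    next
      case False
      with that b[of j z] show ?thesis by (simp add: gs_def)
    qed
  qed
  moreover have uv: "u z $ j \<le> v z $ j" for z j by (simp add: v_def)
  moreover have "v z = u z" if "\<rho>0 \<le> sqd x z" for z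
    using h(3)[of z] that \<rho> b by (auto simp: v_def vec_eq_iff gs_def max_def intro: order_antisym)
  moreover have ux: "u x $ i < h x" using h(2)[of x] \<rho>(1) \<epsilon>(1) by (simp add: g_def c_def)
  then have "u x $ i < v x $ i" by (simp add: v_def gs_def)
  moreover have "strict_at \<alpha> v x i"
  proof -
    have "open {z. u z $ i < h z}"
      by (intro open_Collect_less subsolution_continuous[OF u] C1_torus_continuous[OF h(1)])
    then obtain s where s: "s > 0" "\<And>z. norm (z - x) < s \<Longrightarrow> u z $ i < h z"
      using ux unfolding open_dist dist_norm by blast
    have "H i z p + (A *v v z) $ i \<le> \<alpha> - \<delta>"
      if z: "norm (z - x) < s" and p: "p \<in> superdiff (\<lambda>z. v z $ i) z" for z p
    proof -
      have "p \<in> superdiff h z"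
        by (rule superdiff_mono[OF p]) (use s(2)[OF z] in \<open>auto simp: v_def gs_def\<close>)
      then have "p = Dh z" using h(1) by (auto simp: C1_torus_def intro: superdiff_GDERIV)
      moreover have "(A *v v z) $ i \<le> (A *v u z) $ i + A $ i $ i * (v z $ i - u z $ i)"
        by (rule coupling_mono) (rule uv)
      moreover have "v z $ i = h z" using s(2)[OF z] by (simp add: v_def gs_def)
      ultimately show ?thesis using raised[OF s(2)[OF z]] by simp
    qed
    with \<delta>(1) s(1) show ?thesis unfolding strict_at_def by blast
  qed
  ultimately show ?thesis using that by blast
qed

text \<open>Strict components have room for a small multiple of a bump at \<open>y\<close>, of either sign, as long as
  the coupling terms of the remaining equations do not increase. Where such a term
  decreases, that equation becomes strict too.\<close>

lemma perturb_strict_components: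
  assumes u: "subsolution H A \<alpha> u" and W: "\<And>j. j \<in> W \<Longrightarrow> strict_at \<alpha> u y j"
  shows "\<exists>c0>0. \<exists>\<psi>. \<psi> y > 0 \<and>
    (\<forall>c. (\<forall>j. \<bar>c $ j\<bar> \<le> c0) \<longrightarrow> (\<forall>j. j \<notin> W \<longrightarrow> c $ j = 0 \<and> (A *v c) $ j \<le> 0) \<longrightarrow>
      subsolution H A \<alpha> (\<lambda>z. u z + \<psi> z *\<^sub>R c) \<and>
      (\<forall>j. j \<in> W \<or> (A *v c) $ j < 0 \<longrightarrow> strict_at \<alpha> (\<lambda>z. u z + \<psi> z *\<^sub>R c) y j))"
proof -
  have "\<forall>j. \<exists>\<delta>>0. \<exists>r>0. j \<in> W \<longrightarrow> (\<forall>x p. norm (x - y) < r \<longrightarrow>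
     p \<in> superdiff (\<lambda>z. u z $ j) x \<longrightarrow> H j x p + (A *v u x) $ j \<le> \<alpha> - \<delta>)"
    using W unfolding strict_at_def by (metis zero_less_one)
  then obtain \<delta>' r' where \<delta>r: "\<And>j. \<delta>' j > 0" "\<And>j. r' j > 0"
    "\<And>j x p. j \<in> W \<Longrightarrow> norm (x - y) < r' j \<Longrightarrow> p \<in> superdiff (\<lambda>z. u z $ j) x \<Longrightarrow>
       H j x p + (A *v u x) $ j \<le> \<alpha> - \<delta>' j" by metis
  define \<delta> where "\<delta> = Min (range \<delta>')"
  define r where "r = min (Min (range r')) 1"
  have \<delta>: "\<delta> > 0" "\<And>j. \<delta> \<le> \<delta>' j" using \<delta>r(1) by (auto simp: \<delta>_def)
  have r: "r > 0" "r \<le> 1" "\<And>j. r \<le> r' j" using \<delta>r(2) by (auto simp: r_def min_le_iff_disj)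
  have strict: "H j x p + (A *v u x) $ j \<le> \<alpha> - \<delta>"
    if "j \<in> W" "norm (x - y) < r" "p \<in> superdiff (\<lambda>z. u z $ j) x" for j x p
    using \<delta>r(3)[OF that(1) less_le_trans[OF that(2) r(3)] that(3)] \<delta>(2)[of j] by linarith
  obtain L where L: "L \<ge> 0"
    "\<And>i x p. p \<in> superdiff (\<lambda>z. u z $ i) x \<Longrightarrow> norm p \<le> L"
    using subsolution_bounds u by metis
  let ?F = "\<lambda>s. (max 0 (r\<^sup>2 - s))\<^sup>2"
  define \<psi> where "\<psi> z = ?F (sqd y z)" for z
  define D\<psi> where "D\<psi> z = (- 2 * max 0 (r\<^sup>2 - sqd y z)) *\<^sub>R Dsqd y z" for z
  have \<psi>: "C1_torus \<psi> D\<psi>"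
    unfolding \<psi>_def D\<psi>_def
  proof (rule C1_torus_chain[OF C1_torus_sqd, where F = ?F and F' = "\<lambda>s. - 2 * max 0 (r\<^sup>2 - s)"])
    fix z
    have "((\<lambda>s. r\<^sup>2 - s) has_real_derivative - 1) (at (sqd y z))"
      by (auto intro!: derivative_eq_intros)
    from DERIV_chain2[OF has_derivative_max0_square this]
    show "(?F has_real_derivative - 2 * max 0 (r\<^sup>2 - sqd y z)) (at (sqd y z))" by simp
  qed (intro continuous_intros C1_torus_continuous(1)[OF C1_torus_sqd])
  have \<psi>0: "\<psi> z \<ge> 0" for z by (simp add: \<psi>_def)
  have \<psi>y: "\<psi> y > 0" using r by (simp add: \<psi>_def)
  have far: "\<psi> z = 0 \<and> D\<psi> z = 0" if "r\<^sup>2 \<le> sqd y z" for z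
    using that by (simp add: \<psi>_def D\<psi>_def)
  obtain B1 where B1: "\<And>z. \<bar>\<psi> z\<bar> \<le> B1"
    using zperiodic_bounded[of \<psi>] \<psi> C1_torus_continuous(1)[OF \<psi>] by (metis C1_torus_def)
  have "zperiodic (\<lambda>z. norm (D\<psi> z))"
    using C1_torus_gradient_shift[OF \<psi>] by (simp add: zperiodic_def)
  moreover have "continuous_on UNIV (\<lambda>z. norm (D\<psi> z))"
    by (intro continuous_intros C1_torus_continuous[OF \<psi>])
  ultimately obtain B2 where "\<And>z. \<bar>norm (D\<psi> z)\<bar> \<le> B2" by (rule zperiodic_bounded) blast
  then have B2: "norm (D\<psi> z) \<le> B2" for z by simp
  define B where "B = max B1 B2 + 1"
  have B: "\<psi> z \<le> B" "norm (D\<psi> z) \<le> B" "B > 0" for z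
    using B1[of z] B2[of z] by (auto simp: B_def abs_le_iff add_nonneg_pos le_max_iff_disj
        intro: order_trans[OF _ max.cobounded2] add_nonneg_pos)
  obtain s where s: "s > 0" "\<And>i x x' p p'. x \<in> cball y 1 \<Longrightarrow> x' \<in> cball y 1 \<Longrightarrow> norm p \<le> L + 1 \<Longrightarrow>
      norm p' \<le> L + 1 \<Longrightarrow> norm (x - x') < s \<Longrightarrow> norm (p - p') < s \<Longrightarrow> \<bar>H i x p - H i x' p'\<bar> < \<delta> / 4"
    using H_uniformly_continuous[of "\<delta> / 4" y "L + 1"] \<delta>(1) by (auto simp del: mem_cball)
  define S where "S = Max (range (\<lambda>i. \<Sum>j\<in>UNIV. \<bar>A $ i $ j\<bar>))"
  have S: "(\<Sum>j\<in>UNIV. \<bar>A $ i $ j\<bar>) \<le> S" for i by (simp add: S_def)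
  have S0: "S \<ge> 0" by (rule order_trans[OF sum_nonneg S]) auto
  \<comment> \<open>The three entries keep the perturbed gradients bounded by \<open>L + 1\<close>, the change of \<open>H\<close> below
    \<open>\<delta> / 4\<close>, and the change of the coupling term below \<open>\<delta> / 4\<close>.\<close>
  define c0 where "c0 = min (min (1 / B) (s / (2 * B))) (\<delta> / (4 * B * (S + 1)))"
  have c0: "c0 > 0" using B(3) s(1) \<delta>(1) S0 by (simp add: c0_def)
  have "c0 \<le> 1 / B" "c0 \<le> s / (2 * B)" "c0 \<le> \<delta> / (4 * B * (S + 1))"
    by (auto simp: c0_def min_le_iff_disj)
  then have c0B: "c0 * B \<le> 1" "c0 * (2 * B) \<le> s" "c0 * (4 * B * (S + 1)) \<le> \<delta>"
    using B(3) S0 by (simp_all add: pos_le_divide_eq)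
  show ?thesis
  proof (intro exI[of _ c0] exI[of _ \<psi>] conjI c0 \<psi>y allI impI)
    fix c :: "real^'m" assume "\<forall>j. \<bar>c $ j\<bar> \<le> c0" "\<forall>j. j \<notin> W \<longrightarrow> c $ j = 0 \<and> (A *v c) $ j \<le> 0"
    then have c: "\<And>j. \<bar>c $ j\<bar> \<le> c0" and cW: "\<And>j. j \<notin> W \<Longrightarrow> c $ j = 0 \<and> (A *v c) $ j \<le> 0"
      by auto
    define w where "w z = u z + \<psi> z *\<^sub>R c" for z
    have Aw: "(A *v w z) $ j = (A *v u z) $ j + \<psi> z * (A *v c) $ j" for z j
      by (simp add: w_def matrix_vector_right_distrib matrix_vector_mult_scaleR)
    have p': "p - c $ j *\<^sub>R D\<psi> z \<in> superdiff (\<lambda>z. u z $ j) z" if "p \<in> superdiff (\<lambda>z. w z $ j) z" for p j z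
    proof (rule superdiff_add_C1)
      show "C1_torus (\<lambda>z. c $ j * \<psi> z) (\<lambda>z. c $ j *\<^sub>R D\<psi> z)" by (rule C1_torus_cmult[OF \<psi>])
      show "p \<in> superdiff (\<lambda>z. u z $ j + c $ j * \<psi> z) z" using that by (simp add: w_def mult.commute)
    qed
    have Ac: "\<psi> z * (A *v c) $ j \<le> \<delta> / 4" for z j
    proof -
      have "\<bar>(A *v c) $ j\<bar> \<le> (\<Sum>k\<in>UNIV. \<bar>A $ j $ k\<bar> * c0)"
        unfolding matrix_vector_mult_def
        by (simp, intro order_trans[OF sum_abs] sum_mono) (simp add: abs_mult mult_left_mono c)
      also have "\<dots> \<le> (S + 1) * c0"
        unfolding sum_distrib_right[symmetric] using S[of j] c0 by (intro mult_right_mono) auto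
      finally have "\<psi> z * (A *v c) $ j \<le> B * ((S + 1) * c0)"
        using B \<psi>0 S0 c0 by (intro order_trans[OF mult_left_mono mult_right_mono]) auto
      with c0B(3) show ?thesis by (simp add: algebra_simps)
    qed
    have inside: "H j z p + (A *v w z) $ j \<le> \<alpha> - \<delta> / 2"
      if j: "j \<in> W" and z: "norm (z - y) < r" and p: "p \<in> superdiff (\<lambda>z. w z $ j) z" for j z p
    proof -
      let ?p = "p - c $ j *\<^sub>R D\<psi> z"
      have st: "H j z ?p + (A *v u z) $ j \<le> \<alpha> - \<delta>" by (rule strict[OF j z p'[OF p]])
      have "norm (c $ j *\<^sub>R D\<psi> z) \<le> c0 * B"
        using c[of j] B(2)[of z] c0 by (simp add: mult_mono)
      then have n: "norm (p - ?p) \<le> c0 * B" by simp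
      have "c0 * B > 0" using c0 B(3) by simp
      have "norm ?p \<le> L" using L(2) p'[OF p] by blast
      moreover have "norm p \<le> norm ?p + norm (p - ?p)" using norm_triangle_ineq[of ?p "p - ?p"] by simp
      ultimately have "norm p \<le> L + 1" "norm ?p \<le> L + 1" using n c0B(1) by linarith+
      moreover have "z \<in> cball y 1" using z r by (simp add: dist_norm norm_minus_commute)
      moreover have "norm (p - ?p) < s" using n c0B(2) \<open>c0 * B > 0\<close> by linarith
      ultimately have "\<bar>H j z p - H j z ?p\<bar> < \<delta> / 4" using s(1) by (intro s(2)) auto
      with st Ac[of z j] show ?thesis unfolding Aw by linarith
    qed
    have per: "zperiodic w"
      using u \<psi> by (auto simp: w_def zperiodic_def subsolution_def C1_torus_def)
    have sub: "subsolution H A \<alpha> w"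
      unfolding subsolution_iff_superdiff
    proof (intro conjI allI ballI per)
      show "continuous_on UNIV w"
        using u unfolding w_def
        by (intro continuous_intros C1_torus_continuous[OF \<psi>]) (simp add: subsolution_def)
      fix j z p assume p: "p \<in> superdiff (\<lambda>z. w z $ j) z"
      show "H j z p + (A *v w z) $ j \<le> \<alpha>"
      proof (cases "j \<in> W \<and> sqd y z < r\<^sup>2")
        case True
        obtain k where k: "\<forall>j. k $ j \<in> \<int>" "(norm (z + k - y))\<^sup>2 \<le> sqd y z"
          by (rule lattice_distance_le_sqd)
        then have "(norm (z + k - y))\<^sup>2 < r\<^sup>2" using True by linarith
        then have "norm (z + k - y) < r" using r by (simp add: power2_less_imp_less)
        from inside[OF _ this superdiff_shift[OF p zperiodic_component[OF per] k(1)]] True \<delta>(1)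
        have "H j (z + k) p + (A *v w (z + k)) $ j \<le> \<alpha>" by simp
        then show ?thesis using per k(1) by (simp add: H_shift zperiodic_def)
      next
        case False
        then have "c $ j *\<^sub>R D\<psi> z = 0" "\<psi> z * (A *v c) $ j \<le> 0"
          using cW[of j] far[of z] \<psi>0[of z] by (auto simp: mult_nonneg_nonpos)
        with p'[OF p] subsolution_superdiff[OF u, of "p" j z] show ?thesis unfolding Aw by simp
      qed
    qed
    have "strict_at \<alpha> w y j" if "j \<in> W \<or> (A *v c) $ j < 0" for j
    proof (cases "j \<in> W")
      case True
      with inside \<delta>(1) r(1) show ?thesis
        unfolding strict_at_def by (intro exI[of _ "\<delta> / 2"] conjI exI[of _ r]) auto
    next
      case False
      then have cj: "c $ j = 0" "(A *v c) $ j < 0" using that cW[of j] by auto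
      have "open {z. \<psi> y / 2 < \<psi> z}"
        by (intro open_Collect_less continuous_intros C1_torus_continuous[OF \<psi>])
      then obtain t where t: "t > 0" "\<And>z. norm (z - y) < t \<Longrightarrow> \<psi> y / 2 < \<psi> z"
        using \<psi>y unfolding open_dist dist_norm by (metis (mono_tags) field_less_half_sum half_gt_zero_iff mem_Collect_eq add_cancel_right_left less_add_same_cancel1 field_sum_of_halves)
      let ?d = "- (\<psi> y / 2 * (A *v c) $ j)"
      have "?d > 0" using \<psi>y cj(2) by (simp add: mult_pos_neg)
      moreover have "H j z p + (A *v w z) $ j \<le> \<alpha> - ?d"
        if z: "norm (z - y) < t" and p: "p \<in> superdiff (\<lambda>z. w z $ j) z" for z p
      proof -
        have "p \<in> superdiff (\<lambda>z. u z $ j) z" using p'[OF p] cj(1) by simp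
        from subsolution_superdiff[OF u this]
        have "H j z p + (A *v u z) $ j \<le> \<alpha>" .
        moreover have "\<psi> z * (A *v c) $ j \<le> \<psi> y / 2 * (A *v c) $ j"
          using t(2)[OF z] cj(2) by (intro mult_right_mono_neg) auto
        ultimately show ?thesis unfolding Aw by linarith
      qed
      ultimately show ?thesis using t(1) unfolding strict_at_def by blast
    qed
    with sub show "subsolution H A \<alpha> (\<lambda>z. u z + \<psi> z *\<^sub>R c)"
      and "\<And>j. j \<in> W \<or> (A *v c) $ j < 0 \<Longrightarrow> strict_at \<alpha> (\<lambda>z. u z + \<psi> z *\<^sub>R c) y j"
      unfolding w_def[abs_def] by blast+
  qed
qed

text \<open>Strictness spreads through the coupling. Raising all strict components at \<open>y\<close> makes
  strict every equation that is coupled to one of them, and by irreducibility some equation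
  outside the current set is.\<close>

lemma strict_everywhere_from_one:
  assumes "subsolution H A \<alpha> u" "strict_at \<alpha> u y i"
  obtains v where "subsolution H A \<alpha> v" "\<And>j. strict_at \<alpha> v y j"
proof -
  have "\<exists>v. subsolution H A \<alpha> v \<and> (\<forall>j. strict_at \<alpha> v y j)"
    using assms
  proof (induction "card {j. \<not> strict_at \<alpha> u y j}" arbitrary: u rule: less_induct)
    case less
    define W where "W = {j. strict_at \<alpha> u y j}"
    show ?case
    proof (cases "W = UNIV")
      case True
      then show ?thesis using less.prems(1) by (auto simp: W_def)
    next
      case False
      have "i \<in> W" using less.prems(2) by (simp add: W_def)
      have "- W \<noteq> {} \<and> - W \<subset> UNIV" using False \<open>i \<in> W\<close> by auto
      then obtain k j where kj: "k \<notin> W" "j \<in> W" "A $ k $ j < 0"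
        using A_irreducible unfolding irreducible_coupling_def by (metis ComplD ComplI)
      obtain c0 and \<psi> :: "real^'n \<Rightarrow> real" where pert: "c0 > 0" "\<psi> y > 0"
        "\<forall>c. (\<forall>j. \<bar>c $ j\<bar> \<le> c0) \<longrightarrow> (\<forall>j. j \<notin> W \<longrightarrow> c $ j = 0 \<and> (A *v c) $ j \<le> 0) \<longrightarrow>
          subsolution H A \<alpha> (\<lambda>z. u z + \<psi> z *\<^sub>R c) \<and>
          (\<forall>j. j \<in> W \<or> (A *v c) $ j < 0 \<longrightarrow> strict_at \<alpha> (\<lambda>z. u z + \<psi> z *\<^sub>R c) y j)"
        using perturb_strict_components[OF less.prems(1), of W y] unfolding W_def by blast
      define c :: "real^'m" where "c = (\<chi> j. if j \<in> W then c0 else 0)"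
      have row: "(A *v c) $ l = (\<Sum>j\<in>W. A $ l $ j * c0)" for l
        by (simp add: matrix_vector_mult_def c_def if_distrib[of "\<lambda>x. _ * x"] sum.If_cases cong: if_cong)
      have neg: "A $ l $ j * c0 \<le> 0" if "l \<notin> W" "j \<in> W" for l j
      proof -
        have "l \<noteq> j" using that by auto
        then show ?thesis using pert(1) A_off_diagonal[of l j] by (simp add: mult_nonpos_nonneg)
      qed
      have "(A *v c) $ k < 0"
      proof -
        have "(A *v c) $ k = A $ k $ j * c0 + (\<Sum>j\<in>W - {j}. A $ k $ j * c0)"
          unfolding row using kj(2) by (intro sum.remove) auto
        moreover have "(\<Sum>j\<in>W - {j}. A $ k $ j * c0) \<le> 0"
          using neg kj(1) by (intro sum_nonpos) auto
        moreover have "A $ k $ j * c0 < 0" using kj(3) pert(1) by (rule mult_neg_pos)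
        ultimately show ?thesis by linarith
      qed
      moreover have "subsolution H A \<alpha> (\<lambda>z. u z + \<psi> z *\<^sub>R c) \<and>
          (\<forall>j. j \<in> W \<or> (A *v c) $ j < 0 \<longrightarrow> strict_at \<alpha> (\<lambda>z. u z + \<psi> z *\<^sub>R c) y j)"
      proof (rule pert(3)[rule_format])
        show "\<bar>c $ j\<bar> \<le> c0" for j using pert(1) by (simp add: c_def)
        show "c $ j = 0 \<and> (A *v c) $ j \<le> 0" if "j \<notin> W" for j
          using that neg unfolding row by (auto simp: c_def intro: sum_nonpos)
      qed
      ultimately have *: "subsolution H A \<alpha> (\<lambda>z. u z + \<psi> z *\<^sub>R c)"
        "strict_at \<alpha> (\<lambda>z. u z + \<psi> z *\<^sub>R c) y k"
        "\<And>j. j \<in> W \<Longrightarrow> strict_at \<alpha> (\<lambda>z. u z + \<psi> z *\<^sub>R c) y j" by blast+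
      have "{j. \<not> strict_at \<alpha> (\<lambda>z. u z + \<psi> z *\<^sub>R c) y j} \<subset> {j. \<not> strict_at \<alpha> u y j}"
        using * kj(1) by (auto simp: W_def)
      then have "card {j. \<not> strict_at \<alpha> (\<lambda>z. u z + \<psi> z *\<^sub>R c) y j} < card {j. \<not> strict_at \<alpha> u y j}"
        by (intro psubset_card_mono) auto
      from less.hyps[OF this *(1) *(3)[OF \<open>i \<in> W\<close>]] show ?thesis .
    qed
  qed
  then show ?thesis using that by blast
qed

lemma strict_value_interior:
  assumes u: "subsolution H A \<alpha> u" and "\<And>j. strict_at \<alpha> u y j"
  shows "u y \<in> interior {b. \<exists>v. subsolution H A \<alpha> v \<and> v y = b}"
proof -
  obtain c0 and \<psi> :: "real^'n \<Rightarrow> real" where pert: "c0 > 0" "\<psi> y > 0"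
    "\<forall>c. (\<forall>j. \<bar>c $ j\<bar> \<le> c0) \<longrightarrow> subsolution H A \<alpha> (\<lambda>z. u z + \<psi> z *\<^sub>R c)"
    using perturb_strict_components[OF u, of UNIV y] assms(2) by auto
  have "b \<in> {b. \<exists>v. subsolution H A \<alpha> v \<and> v y = b}" if b: "b \<in> ball (u y) (\<psi> y * c0)" for b
  proof -
    define c where "c = (b - u y) /\<^sub>R \<psi> y"
    have "\<bar>c $ j\<bar> \<le> c0" for j
    proof -
      have "\<bar>c $ j\<bar> \<le> norm c" by (rule component_le_norm_cart)
      also have "\<dots> \<le> c0"
      proof -
        have "norm c = norm (b - u y) / \<psi> y"
          unfolding c_def norm_scaleR using pert(2) by (simp add: divide_inverse mult.commute)
        moreover have "norm (b - u y) \<le> c0 * \<psi> y"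
          using b by (simp add: dist_norm norm_minus_commute mult.commute)
        ultimately show ?thesis using pert(2) by (simp add: pos_divide_le_eq)
      qed
      finally show ?thesis .
    qed
    from pert(3)[rule_format, OF this] pert(2) show ?thesis
      by (auto intro!: exI[of _ "\<lambda>z. u z + \<psi> z *\<^sub>R c"] simp: c_def)
  qed
  then have "ball (u y) (\<psi> y * c0) \<subseteq> {b. \<exists>v. subsolution H A \<alpha> v \<and> v y = b}" by blast
  moreover have "u y \<in> ball (u y) (\<psi> y * c0)" using pert by simp
  ultimately show ?thesis by (meson interior_maximal open_ball subset_iff)
qed

end

section \<open>Convex combinations\<close>

text \<open>In this form, through the value \<open>e \<bullet> q\<close> of a support function, gradient bounds can be added:
  increments of a sum are sums of increments.\<close>

lemma increment_le_support:
  fixes f :: "real^'n::finite \<Rightarrow> real"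
  assumes f: "continuous_on UNIV f" and K: "compact K" and "s > 0"
    and sup: "\<And>x p. norm (x - x0) < s \<Longrightarrow> p \<in> superdiff f x \<Longrightarrow> p \<in> K"
  obtains q where "q \<in> K" "\<And>k. k \<in> K \<Longrightarrow> e \<bullet> k \<le> e \<bullet> q"
    "\<And>z t. norm (z - x0) < s \<Longrightarrow> norm (z + t *\<^sub>R e - x0) < s \<Longrightarrow> 0 \<le> t \<Longrightarrow>
       f (z + t *\<^sub>R e) \<le> f z + (e \<bullet> q) * t"
proof -
  have fb: "continuous_on S f" for S using f continuous_on_subset by blast
  obtain z p where "norm (z - x0) < s" "p \<in> superdiff f z"
    using superdiff_nonempty_nearby[OF fb \<open>s > 0\<close>] by blast
  then have "K \<noteq> {}" using sup by blast
  have "continuous_on K (\<lambda>k. e \<bullet> k)" by (intro continuous_intros)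
  from continuous_attains_sup[OF K \<open>K \<noteq> {}\<close> this]
  obtain q where q: "q \<in> K" "\<And>k. k \<in> K \<Longrightarrow> e \<bullet> k \<le> e \<bullet> q" by blast
  have "f (z + t *\<^sub>R e) \<le> f z + (e \<bullet> q) * t"
    if "norm (z - x0) < s" "norm (z + t *\<^sub>R e - x0) < s" "0 \<le> t" for z t
  proof (rule superdiff_bound_imp_increment[where a = x0 and R = s])
    show "e \<bullet> p \<le> e \<bullet> q" if "x \<in> ball x0 s" "p \<in> superdiff f x" for x p
      using that by (intro q(2) sup[of x]) (auto simp: dist_norm norm_minus_commute)
  qed (use that fb in \<open>auto simp: dist_norm norm_minus_commute\<close>)
  with q that show ?thesis by blast
qed

lemma small_step_norm:
  fixes e :: "'a::real_normed_vector"
  assumes "s > 0"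
  obtains d where "d > 0" "\<And>t. 0 < t \<Longrightarrow> t < d \<Longrightarrow> norm (t *\<^sub>R e) < s"
proof
  have n: "norm e + 1 > 0" by (simp add: add_nonneg_pos)
  show "s / (norm e + 1) > 0" using assms n by simp
  fix t assume "0 < t" "t < s / (norm e + 1)"
  then have "t * (norm e + 1) < s" using n by (simp add: pos_less_divide_eq)
  then show "norm (t *\<^sub>R e) < s" using \<open>0 < t\<close> by (simp add: algebra_simps)
qed

context weakly_coupled
begin

lemma H_sublevel_compact_convex:
  "compact {q. H i x q \<le> c}" "convex {q. H i x q \<le> c}"
proof -
  obtain L where "\<And>q. H i x q \<le> c \<Longrightarrow> norm q \<le> L" using H_sublevel_bounded by metis
  then have "bounded {q. H i x q \<le> c}" unfolding bounded_iff by blast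
  moreover have "closed {q. H i x q \<le> c}"
    by (intro closed_Collect_le continuous_intros)
  ultimately show "compact {q. H i x q \<le> c}" by (simp add: compact_eq_bounded_closed)
  show "convex {q. H i x q \<le> c}"
  proof (rule convexI, clarify)
    fix p q and a b :: real
    assume *: "H i x p \<le> c" "H i x q \<le> c" "0 \<le> a" "0 \<le> b" "a + b = 1"
    have "H i x (a *\<^sub>R p + b *\<^sub>R q) \<le> max (H i x p) (H i x q)"
      using * by (intro convex_lower[OF H_convex]) auto
    then show "H i x (a *\<^sub>R p + b *\<^sub>R q) \<le> c" using * by linarith
  qed
qed

lemma hamiltonian_near:
  assumes u: "subsolution H A \<alpha> u" and "\<eta> > 0"
  obtains s where "s > 0" "\<And>i x p. norm (x - x0) < s \<Longrightarrow> norm p \<le> L \<Longrightarrow>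
    \<bar>(H i x p + (A *v u x) $ i) - (H i x0 p + (A *v u x0) $ i)\<bar> < \<eta>"
proof -
  obtain r where r: "r > 0" "\<And>i x x' p p'. x \<in> cball x0 1 \<Longrightarrow> x' \<in> cball x0 1 \<Longrightarrow> norm p \<le> L \<Longrightarrow>
      norm p' \<le> L \<Longrightarrow> norm (x - x') < r \<Longrightarrow> norm (p - p') < r \<Longrightarrow> \<bar>H i x p - H i x' p'\<bar> < \<eta> / 2"
    using H_uniformly_continuous[of "\<eta> / 2" x0 L] \<open>\<eta> > 0\<close> by (auto simp del: mem_cball)
  have "\<exists>d>0. \<forall>x. norm (x - x0) < d \<longrightarrow> \<bar>(A *v u x) $ i - (A *v u x0) $ i\<bar> < \<eta> / 2" for i
  proof -
    have "\<forall>x\<in>UNIV. \<forall>\<epsilon>>0. \<exists>d>0. \<forall>x'\<in>UNIV. dist x' x < d \<longrightarrow>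
        dist ((A *v u x') $ i) ((A *v u x) $ i) < \<epsilon>"
      using subsolution_continuous(2)[OF u, of UNIV i] unfolding continuous_on_iff .
    then show ?thesis using half_gt_zero[OF \<open>\<eta> > 0\<close>] unfolding dist_norm real_norm_def by blast
  qed
  then obtain d where d: "\<And>i. d i > 0"
    "\<And>i x. norm (x - x0) < d i \<Longrightarrow> \<bar>(A *v u x) $ i - (A *v u x0) $ i\<bar> < \<eta> / 2" by metis
  define s where "s = min (min r 1) (Min (range d))"
  have s: "s > 0" "s \<le> r" "s \<le> 1" "\<And>i. s \<le> d i"
    using r(1) d(1) by (auto simp: s_def min_le_iff_disj)
  have "\<bar>(H i x p + (A *v u x) $ i) - (H i x0 p + (A *v u x0) $ i)\<bar> < \<eta>"
    if x: "norm (x - x0) < s" and p: "norm p \<le> L" for i x p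
  proof -
    have "x \<in> cball x0 1" using x s(3) by (simp add: dist_norm norm_minus_commute)
    then have "\<bar>H i x p - H i x0 p\<bar> < \<eta> / 2"
      using x s(2) p r(1) by (intro r(2)) auto
    moreover have "\<bar>(A *v u x) $ i - (A *v u x0) $ i\<bar> < \<eta> / 2"
      using x s(4)[of i] by (intro d(2)) simp
    ultimately show ?thesis by linarith
  qed
  with s(1) that show ?thesis by blast
qed

lemma superdiff_in_sublevel_nearby:
  assumes u: "subsolution H A \<alpha> u" and "r > 0" "\<eta> > 0"
    and loc: "\<And>x p. norm (x - x0) < r \<Longrightarrow> p \<in> superdiff (\<lambda>z. u z $ i) x \<Longrightarrow> H i x p + (A *v u x) $ i \<le> a"
  obtains s where "s > 0" "\<And>x p. norm (x - x0) < s \<Longrightarrow> p \<in> superdiff (\<lambda>z. u z $ i) x \<Longrightarrow>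
    p \<in> {q. H i x0 q \<le> a + \<eta> - (A *v u x0) $ i}"
proof -
  obtain L where L: "\<And>i x p. p \<in> superdiff (\<lambda>z. u z $ i) x \<Longrightarrow> norm p \<le> L"
    using subsolution_bounds u by metis
  obtain s where s: "s > 0" "\<And>i x p. norm (x - x0) < s \<Longrightarrow> norm p \<le> L \<Longrightarrow>
    \<bar>(H i x p + (A *v u x) $ i) - (H i x0 p + (A *v u x0) $ i)\<bar> < \<eta>"
    using hamiltonian_near[OF u \<open>\<eta> > 0\<close>] by blast
  have "p \<in> {q. H i x0 q \<le> a + \<eta> - (A *v u x0) $ i}"
    if "norm (x - x0) < min s r" "p \<in> superdiff (\<lambda>z. u z $ i) x" for x p
    using loc[of x p] s(2)[of x p i] L[of p i x] that by simp
  with s(1) \<open>r > 0\<close> that[of "min s r"] show ?thesis by simp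
qed

text \<open>Superdifferentials of a combination need not split into superdifferentials of the summands
  at the same point. Increments do add up, and they are bounded by support functions, so a
  gradient outside the combination of the two nearby sublevel sets would contradict a
  separating hyperplane.\<close>

lemma convex_combination_pointwise:
  assumes u: "subsolution H A \<alpha> u" and v: "subsolution H A \<alpha> v" and "r > 0" "0 \<le> s" "s \<le> 1"
    and locu: "\<And>x p. norm (x - x0) < r \<Longrightarrow> p \<in> superdiff (\<lambda>z. u z $ i) x \<Longrightarrow> H i x p + (A *v u x) $ i \<le> a"
    and locv: "\<And>x p. norm (x - x0) < r \<Longrightarrow> p \<in> superdiff (\<lambda>z. v z $ i) x \<Longrightarrow> H i x p + (A *v v x) $ i \<le> b"
    and p: "p \<in> superdiff (\<lambda>z. ((1 - s) *\<^sub>R u z + s *\<^sub>R v z) $ i) x0"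
  shows "H i x0 p + (A *v ((1 - s) *\<^sub>R u x0 + s *\<^sub>R v x0)) $ i \<le> (1 - s) * a + s * b"
proof (rule field_le_epsilon)
  fix \<eta> :: real assume "\<eta> > 0"
  define K where "K = {q. H i x0 q \<le> a + \<eta> - (A *v u x0) $ i}"
  define M where "M = {q. H i x0 q \<le> b + \<eta> - (A *v v x0) $ i}"
  obtain d1 where d1: "d1 > 0"
    "\<And>x p. norm (x - x0) < d1 \<Longrightarrow> p \<in> superdiff (\<lambda>z. u z $ i) x \<Longrightarrow> p \<in> K"
    using superdiff_in_sublevel_nearby[OF u \<open>r > 0\<close> \<open>\<eta> > 0\<close> locu] unfolding K_def by blast
  obtain d2 where d2: "d2 > 0"
    "\<And>x p. norm (x - x0) < d2 \<Longrightarrow> p \<in> superdiff (\<lambda>z. v z $ i) x \<Longrightarrow> p \<in> M"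
    using superdiff_in_sublevel_nearby[OF v \<open>r > 0\<close> \<open>\<eta> > 0\<close> locv] unfolding M_def by blast
  have K: "compact K" "convex K" and M: "compact M" "convex M"
    unfolding K_def M_def by (rule H_sublevel_compact_convex)+
  define C where "C = {x + y | x y. x \<in> (\<lambda>q. (1 - s) *\<^sub>R q) ` K \<and> y \<in> (\<lambda>q. s *\<^sub>R q) ` M}"
  have C: "compact C" "convex C"
  proof -
    show "compact C" unfolding C_def by (intro compact_sums compact_scaling K M)
    have "C = (\<Union>x\<in>(\<lambda>q. (1 - s) *\<^sub>R q) ` K. \<Union>y\<in>(\<lambda>q. s *\<^sub>R q) ` M. {x + y})"
      unfolding C_def by blast
    then show "convex C" by (simp only: convex_sums convex_scaling K M)
  qed
  have "p \<in> C"
  proof (rule ccontr)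
    assume "p \<notin> C"
    with separating_hyperplane_closed_point[OF C(2) compact_imp_closed[OF C(1)]]
    obtain e0 c where sep: "e0 \<bullet> p < c" "\<And>x. x \<in> C \<Longrightarrow> e0 \<bullet> x > c" by blast
    define e where "e = - e0"
    obtain q1 where q1: "q1 \<in> K" "\<And>k. k \<in> K \<Longrightarrow> e \<bullet> k \<le> e \<bullet> q1"
      "\<And>z t. norm (z - x0) < d1 \<Longrightarrow> norm (z + t *\<^sub>R e - x0) < d1 \<Longrightarrow> 0 \<le> t \<Longrightarrow>
        u (z + t *\<^sub>R e) $ i \<le> u z $ i + (e \<bullet> q1) * t"
    proof (rule increment_le_support[OF subsolution_continuous(1)[OF u, where i = i] K(1) d1(1),
          where e = e and ?x0.0 = x0])
      show "p \<in> K" if "norm (x - x0) < d1" "p \<in> superdiff (\<lambda>z. u z $ i) x" for x p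
        using that by (rule d1(2))
    qed (rule that)
    obtain q2 where q2: "q2 \<in> M" "\<And>k. k \<in> M \<Longrightarrow> e \<bullet> k \<le> e \<bullet> q2"
      "\<And>z t. norm (z - x0) < d2 \<Longrightarrow> norm (z + t *\<^sub>R e - x0) < d2 \<Longrightarrow> 0 \<le> t \<Longrightarrow>
        v (z + t *\<^sub>R e) $ i \<le> v z $ i + (e \<bullet> q2) * t"
    proof (rule increment_le_support[OF subsolution_continuous(1)[OF v, where i = i] M(1) d2(1),
          where e = e and ?x0.0 = x0])
      show "p \<in> M" if "norm (x - x0) < d2" "p \<in> superdiff (\<lambda>z. v z $ i) x" for x p
        using that by (rule d2(2))
    qed (rule that)
    define q where "q = (1 - s) *\<^sub>R q1 + s *\<^sub>R q2"
    have "q \<in> C" unfolding C_def q_def using q1(1) q2(1) by blast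
    have "min d1 d2 > 0" using d1 d2 by simp
    obtain d where d: "d > 0" "\<And>t. 0 < t \<Longrightarrow> t < d \<Longrightarrow> norm (t *\<^sub>R e) < min d1 d2"
      using small_step_norm[OF \<open>min d1 d2 > 0\<close>, where e = e] by metis
    have "e \<bullet> p \<le> e \<bullet> q"
    proof (rule increment_bound_imp_superdiff[OF p d(1)])
      fix t assume t: "0 < t" "t < d"
      from d(2)[OF this] have *: "norm ((x0 - t *\<^sub>R e) - x0) < d1" "norm ((x0 - t *\<^sub>R e) - x0) < d2"
        by simp_all
      have 1: "u x0 $ i - u (x0 - t *\<^sub>R e) $ i \<le> (e \<bullet> q1) * t"
        using q1(3)[OF *(1), of t] t d1(1) by simp
      have 2: "v x0 $ i - v (x0 - t *\<^sub>R e) $ i \<le> (e \<bullet> q2) * t"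
        using q2(3)[OF *(2), of t] t d2(1) by simp
      have "(1 - s) * (u x0 $ i - u (x0 - t *\<^sub>R e) $ i) + s * (v x0 $ i - v (x0 - t *\<^sub>R e) $ i)
          \<le> (1 - s) * ((e \<bullet> q1) * t) + s * ((e \<bullet> q2) * t)"
        using 1 2 \<open>0 \<le> s\<close> \<open>s \<le> 1\<close> by (intro add_mono mult_left_mono) auto
      then show "((1 - s) *\<^sub>R u x0 + s *\<^sub>R v x0) $ i
          - ((1 - s) *\<^sub>R u (x0 - t *\<^sub>R e) + s *\<^sub>R v (x0 - t *\<^sub>R e)) $ i \<le> (e \<bullet> q) * t"
        by (simp add: q_def inner_add_right algebra_simps)
    qed
    with sep(1) sep(2)[OF \<open>q \<in> C\<close>] show False by (simp add: e_def)
  qed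
  then obtain q1 q2 where q: "q1 \<in> K" "q2 \<in> M" "p = (1 - s) *\<^sub>R q1 + s *\<^sub>R q2"
    unfolding C_def by blast
  have "H i x0 p \<le> (1 - s) * H i x0 q1 + s * H i x0 q2"
    unfolding q(3) using \<open>0 \<le> s\<close> \<open>s \<le> 1\<close> H_convex by (intro convex_onD) auto
  also have "\<dots> \<le> (1 - s) * (a + \<eta> - (A *v u x0) $ i) + s * (b + \<eta> - (A *v v x0) $ i)"
    using q(1,2) \<open>0 \<le> s\<close> \<open>s \<le> 1\<close> by (intro add_mono mult_left_mono) (auto simp: K_def M_def)
  also have "\<dots> = (1 - s) * a + s * b + \<eta>
      - ((1 - s) * (A *v u x0) $ i + s * (A *v v x0) $ i)"
    by (simp add: ring_distribs)
  finally show "H i x0 p + (A *v ((1 - s) *\<^sub>R u x0 + s *\<^sub>R v x0)) $ i \<le> (1 - s) * a + s * b + \<eta>"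
    by (simp add: matrix_vector_right_distrib matrix_vector_mult_scaleR)
qed

lemma strict_convex_combination:
  assumes u: "subsolution H A \<alpha> u" "\<And>j. strict_at \<alpha> u y j"
    and v: "subsolution H A \<alpha> v" and s: "0 \<le> s" "s < 1"
  shows "subsolution H A \<alpha> (\<lambda>z. (1 - s) *\<^sub>R u z + s *\<^sub>R v z)"
    and "strict_at \<alpha> (\<lambda>z. (1 - s) *\<^sub>R u z + s *\<^sub>R v z) y j"
proof -
  let ?w = "\<lambda>z. (1 - s) *\<^sub>R u z + s *\<^sub>R v z"
  show "subsolution H A \<alpha> ?w"
    unfolding subsolution_iff_superdiff
  proof (intro conjI allI ballI)
    show "zperiodic ?w" using u(1) v by (simp add: subsolution_def zperiodic_def)
    show "continuous_on UNIV ?w" using u(1) v by (auto simp: subsolution_def intro!: continuous_intros)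
    fix i x p assume p: "p \<in> superdiff (\<lambda>z. ?w z $ i) x"
    have "H i x p + (A *v ?w x) $ i \<le> (1 - s) * \<alpha> + s * \<alpha>"
    proof (rule convex_combination_pointwise[OF u(1) v zero_less_one _ _ _ _ p])
      show "H i z q + (A *v u z) $ i \<le> \<alpha>" if "q \<in> superdiff (\<lambda>z. u z $ i) z" for z q
        using that by (rule subsolution_superdiff[OF u(1)])
      show "H i z q + (A *v v z) $ i \<le> \<alpha>" if "q \<in> superdiff (\<lambda>z. v z $ i) z" for z q
        using that by (rule subsolution_superdiff[OF v])
    qed (use s in auto)
    also have "(1 - s) * \<alpha> + s * \<alpha> = \<alpha>" by (simp add: algebra_simps)
    finally show "H i x p + (A *v ?w x) $ i \<le> \<alpha>" .
  qed
  obtain \<delta> r where \<delta>: "\<delta> > 0" "r > 0" "\<And>x p. norm (x - y) < r \<Longrightarrow>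
     p \<in> superdiff (\<lambda>z. u z $ j) x \<Longrightarrow> H j x p + (A *v u x) $ j \<le> \<alpha> - \<delta>"
    using u(2)[of j] unfolding strict_at_def by blast
  have "H j x p + (A *v ?w x) $ j \<le> \<alpha> - (1 - s) * \<delta>"
    if x: "norm (x - y) < r" and p: "p \<in> superdiff (\<lambda>z. ?w z $ j) x" for x p
  proof -
    have "H j x p + (A *v ?w x) $ j \<le> (1 - s) * (\<alpha> - \<delta>) + s * \<alpha>"
    proof (rule convex_combination_pointwise[OF u(1) v _ _ _ _ _ p, where r = "r - norm (x - y)"])
      fix z q assume zq: "norm (z - x) < r - norm (x - y)" "q \<in> superdiff (\<lambda>z. u z $ j) z"
      then have "norm (z - y) < r" using norm_triangle_ineq[of "z - x" "x - y"] by simp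
      then show "H j z q + (A *v u z) $ j \<le> \<alpha> - \<delta>" using zq(2) by (rule \<delta>(3))
    next
      show "H j z q + (A *v v z) $ j \<le> \<alpha>" if "q \<in> superdiff (\<lambda>z. v z $ j) z" for z q
        using that by (rule subsolution_superdiff[OF v])
    qed (use x s in auto)
    also have "\<dots> = \<alpha> - (1 - s) * \<delta>" by (simp add: algebra_simps)
    finally show ?thesis .
  qed
  moreover have "(1 - s) * \<delta> > 0" using s \<delta> by simp
  ultimately show "strict_at \<alpha> ?w y j" using \<delta>(2) unfolding strict_at_def by blast
qed

text \<open>Near any point \<open>x0\<close> close to \<open>y\<close> almost all
  gradients lie in a convex sublevel set of \<open>H\<close> at \<open>x0\<close>, so a superdifferential element
  outside it would violate the increment bound in a separating direction.\<close>

lemma strict_at_if_ae_strict: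
  assumes u: "subsolution H A \<alpha> u" and U: "open U" "y \<in> U" and "\<delta> > 0"
    and ae: "AE x in lebesgue. x \<in> U \<longrightarrow> (\<exists>p. GDERIV (\<lambda>z. u z $ i) x :> p \<and>
      H i x p + (A *v u x) $ i \<le> \<alpha> - \<delta>)"
  shows "strict_at \<alpha> u y i"
proof -
  obtain r where r: "r > 0" "ball y r \<subseteq> U" using U open_contains_ball by metis
  obtain L where L: "\<And>x z. \<bar>u x $ i - u z $ i\<bar> \<le> L * norm (x - z)"
    using subsolution_bounds u by metis
  have "zperiodic (\<lambda>z. (A *v u z) $ i)" using u by (simp add: subsolution_def zperiodic_def)
  then obtain B where B: "\<And>x. \<bar>(A *v u x) $ i\<bar> \<le> B"
    using zperiodic_bounded subsolution_continuous(2)[OF u] by metis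
  obtain R where R: "\<And>x p. H i x p \<le> \<alpha> - \<delta> + B \<Longrightarrow> norm p \<le> R" using H_sublevel_bounded by metis
  have "H i x0 p + (A *v u x0) $ i \<le> \<alpha> - \<delta>"
    if x0: "norm (x0 - y) < r" and p: "p \<in> superdiff (\<lambda>z. u z $ i) x0" for x0 p
  proof (rule field_le_epsilon)
    fix \<eta> :: real assume "\<eta> > 0"
    obtain s where s: "s > 0" "\<And>x p. norm (x - x0) < s \<Longrightarrow> norm p \<le> R \<Longrightarrow>
      \<bar>(H i x p + (A *v u x) $ i) - (H i x0 p + (A *v u x0) $ i)\<bar> < \<eta>"
      using hamiltonian_near[OF u \<open>\<eta> > 0\<close>] by metis
    define K where "K = {q. H i x0 q \<le> \<alpha> - \<delta> + \<eta> - (A *v u x0) $ i}"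
    have K: "compact K" "convex K" unfolding K_def by (rule H_sublevel_compact_convex)+
    define t where "t = min s (r - norm (x0 - y))"
    have "t > 0" using s x0 by (simp add: t_def)
    have inK: "q \<in> K" if "x \<in> ball x0 t" "H i x q + (A *v u x) $ i \<le> \<alpha> - \<delta>" for x q
    proof -
      have "H i x q \<le> \<alpha> - \<delta> + B" using that(2) B[of x] by linarith
      then have "norm q \<le> R" by (rule R)
      moreover have "norm (x - x0) < s" using that(1) by (simp add: t_def dist_norm norm_minus_commute)
      ultimately have "\<bar>(H i x q + (A *v u x) $ i) - (H i x0 q + (A *v u x0) $ i)\<bar> < \<eta>"
        by (intro s(2))
      then show ?thesis using that(2) unfolding K_def mem_Collect_eq by linarith
    qed
    have tU: "ball x0 t \<subseteq> U"
    proof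
      fix x assume "x \<in> ball x0 t"
      then have "norm (x - x0) < r - norm (x0 - y)" by (simp add: t_def dist_norm norm_minus_commute)
      then have "norm (x - y) < r" using norm_triangle_ineq[of "x - x0" "x0 - y"] by simp
      then have "x \<in> ball y r" by (simp add: dist_norm norm_minus_commute)
      then show "x \<in> U" using r(2) by blast
    qed
    have "p \<in> K"
    proof (rule ccontr)
      assume "p \<notin> K"
      with separating_hyperplane_closed_point[OF K(2) compact_imp_closed[OF K(1)]]
      obtain e0 c where sep: "e0 \<bullet> p < c" "\<And>x. x \<in> K \<Longrightarrow> e0 \<bullet> x > c" by metis
      define e where "e = - e0"
      have "AE x in lebesgue. x \<in> ball x0 t \<longrightarrow> (\<exists>p. GDERIV (\<lambda>z. u z $ i) x :> p \<and> e \<bullet> p \<le> - c)"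
        using ae
      proof eventually_elim
        case (elim x)
        show ?case
        proof
          assume x: "x \<in> ball x0 t"
          then have "x \<in> U" using tU by blast
          with elim obtain q where q: "GDERIV (\<lambda>z. u z $ i) x :> q"
            "H i x q + (A *v u x) $ i \<le> \<alpha> - \<delta>" by metis
          have "e \<bullet> q \<le> - c" using sep(2)[OF inK[OF x q(2)]] by (simp add: e_def)
          with q(1) show "\<exists>p. GDERIV (\<lambda>z. u z $ i) x :> p \<and> e \<bullet> p \<le> - c" by blast
        qed
      qed
      note inc = ae_gradient_bound_imp_increment[OF L this]
      obtain d where d: "d > 0" "\<And>h. 0 < h \<Longrightarrow> h < d \<Longrightarrow> norm (h *\<^sub>R e) < t"
        using small_step_norm[OF \<open>t > 0\<close>] by metis
      have "e \<bullet> p \<le> - c"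
      proof (rule increment_bound_imp_superdiff[OF p d(1)])
        fix h assume h: "0 < h" "h < d"
        then show "u x0 $ i - u (x0 - h *\<^sub>R e) $ i \<le> - c * h"
          using inc[of "x0 - h *\<^sub>R e" h] d(2)[OF h] \<open>t > 0\<close> by (simp add: dist_norm)
      qed
      with sep(1) show False by (simp add: e_def)
    qed
    then show "H i x0 p + (A *v u x0) $ i \<le> \<alpha> - \<delta> + \<eta>" unfolding K_def mem_Collect_eq by linarith
  qed
  with \<open>\<delta> > 0\<close> r(1) show ?thesis unfolding strict_at_def by blast
qed

end

section \<open>Smooth strict subsolutions\<close>

text \<open>A compact set inside an open set is surrounded, still inside the open set, by finitely many
  points whose lower support function lies strictly below that of the compact set: take
  a fine net and its translates along the coordinate axes.\<close>

lemma finite_cage: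
  fixes K V :: "(real^'n::finite) set"
  assumes K: "compact K" "K \<noteq> {}" and V: "open V" "K \<subseteq> V"
  obtains Q \<kappa> where "finite Q" "Q \<noteq> {}" "Q \<subseteq> V" "\<kappa> > 0"
    "\<And>k h. k \<in> K \<Longrightarrow> \<exists>q\<in>Q. q \<bullet> h \<le> k \<bullet> h - \<kappa> * norm h"
proof -
  obtain \<epsilon> where \<epsilon>: "\<epsilon> > 0" "(\<Union>x\<in>K. cball x \<epsilon>) \<subseteq> V"
    using compact_subset_open_imp_cball_epsilon_subset[OF K(1) V] by blast
  define n where "n = real CARD('n)"
  have n: "n \<ge> 1" by (simp add: n_def Suc_leI)
  define \<kappa> where "\<kappa> = \<epsilon> / (2 * n)"
  have \<kappa>: "\<kappa> > 0" using \<epsilon> n by (simp add: \<kappa>_def)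
  obtain Z where Z: "finite Z" "Z \<subseteq> K" "K \<subseteq> (\<Union>z\<in>Z. ball z \<kappa>)"
    using compactE_image[OF K(1), of K "\<lambda>z. ball z \<kappa>"] \<kappa> by force
  define Q where "Q = (\<lambda>(z, j, s). z + (s * \<epsilon>) *\<^sub>R axis j 1) ` (Z \<times> UNIV \<times> {-1, 1})"
  have "finite Q" using Z(1) by (simp add: Q_def)
  moreover have "Z \<noteq> {}" using Z K(2) by auto
  then have "Q \<noteq> {}" by (simp add: Q_def)
  moreover have "Q \<subseteq> V"
  proof
    fix q assume "q \<in> Q"
    then obtain z j s where q: "z \<in> Z" "q = z + (s * \<epsilon>) *\<^sub>R axis j 1" "s = -1 \<or> s = (1::real)"
      by (auto simp: Q_def)
    then have "dist z q \<le> \<epsilon>" using \<epsilon>(1) by (auto simp: dist_norm norm_axis_1)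
    then have "q \<in> cball z \<epsilon>" by simp
    then show "q \<in> V" using \<epsilon>(2) q(1) Z(2) by blast
  qed
  moreover note \<kappa>
  moreover have "\<exists>q\<in>Q. q \<bullet> h \<le> k \<bullet> h - \<kappa> * norm h" if k: "k \<in> K" for k h
  proof -
    obtain z where z: "z \<in> Z" "norm (k - z) < \<kappa>"
      using k Z(3) by (auto simp: dist_norm norm_minus_commute)
    obtain j where j: "\<And>i. \<bar>h $ i\<bar> \<le> \<bar>h $ j\<bar>"
    proof -
      have "Max (range (\<lambda>i. \<bar>h $ i\<bar>)) \<in> range (\<lambda>i. \<bar>h $ i\<bar>)" by (rule Max_in) auto
      then obtain j where j: "Max (range (\<lambda>i. \<bar>h $ i\<bar>)) = \<bar>h $ j\<bar>" by blast
      show ?thesis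
      proof (rule that)
        fix i
        have "\<bar>h $ i\<bar> \<le> Max (range (\<lambda>i. \<bar>h $ i\<bar>))" by (rule Max_ge) auto
        then show "\<bar>h $ i\<bar> \<le> \<bar>h $ j\<bar>" unfolding j .
      qed
    qed
    have "norm h \<le> (\<Sum>i\<in>UNIV. \<bar>h $ i\<bar>)" by (rule norm_le_l1_cart)
    also have "\<dots> \<le> (\<Sum>i\<in>(UNIV :: 'n set). \<bar>h $ j\<bar>)" by (intro sum_mono j)
    also have "\<dots> = n * \<bar>h $ j\<bar>" by (simp add: n_def)
    finally have hj: "norm h \<le> n * \<bar>h $ j\<bar>" .
    define s :: real where "s = (if h $ j \<ge> 0 then -1 else 1)"
    define q where "q = z + (s * \<epsilon>) *\<^sub>R axis j 1"
    have "q \<in> Q" using z(1) by (auto simp: Q_def q_def s_def intro!: image_eqI[of _ _ "(z, j, s)"])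
    have "q \<bullet> h = z \<bullet> h - \<epsilon> * \<bar>h $ j\<bar>"
      by (simp add: q_def s_def inner_add_left inner_axis' abs_if)
    moreover have "\<epsilon> * \<bar>h $ j\<bar> = 2 * \<kappa> * (n * \<bar>h $ j\<bar>)" using n by (simp add: \<kappa>_def)
    moreover have "2 * \<kappa> * norm h \<le> 2 * \<kappa> * (n * \<bar>h $ j\<bar>)" using hj \<kappa> by (intro mult_left_mono) auto
    moreover have "(z - k) \<bullet> h \<le> \<kappa> * norm h"
    proof -
      have "(z - k) \<bullet> h \<le> norm (z - k) * norm h" by (rule norm_cauchy_schwarz)
      also have "\<dots> \<le> \<kappa> * norm h" using z(2) by (intro mult_right_mono) (auto simp: norm_minus_commute)
      finally show ?thesis .
    qed
    ultimately have "q \<bullet> h \<le> k \<bullet> h - \<kappa> * norm h" by (simp add: inner_diff_left)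
    with \<open>q \<in> Q\<close> show ?thesis by blast
  qed
  ultimately show ?thesis by (rule that)
qed

text \<open>A smooth minimum of the functions \<open>slin y q\<close>, \<open>q \<in> Q\<close>, accurate up to \<open>\<epsilon>\<close>. Its
  gradient is an average of their gradients, hence governed by the convex hull of \<open>Q\<close>.\<close>

lemma smooth_minimum:
  fixes y :: "real^'n::finite"
  assumes Q: "finite Q" "Q \<noteq> {}" and \<epsilon>: "\<epsilon> > 0"
  obtains g Dg where "C1_torus g Dg" "g y = 0"
    "\<And>z q. q \<in> Q \<Longrightarrow> g z \<le> slin y q z + \<epsilon>"
    "\<And>z. \<exists>m\<in>convex hull Q. Dg z = Dslin y m z"
proof -
  define N where "N = real (card Q)"
  have N: "N \<ge> 1" using Q by (simp add: N_def Suc_leI card_gt_0_iff)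
  define \<theta> where "\<theta> = (ln N + 1) / \<epsilon>"
  have lnN: "ln N \<ge> 0" using N by simp
  have \<theta>: "\<theta> > 0" using lnN \<epsilon> by (simp add: \<theta>_def add_nonneg_pos)
  have "ln N \<le> \<theta> * \<epsilon>" using \<epsilon> by (simp add: \<theta>_def)
  then have ln_le: "ln N / \<theta> \<le> \<epsilon>" using \<theta> by (simp add: pos_divide_le_eq mult.commute)
  define E where "E q z = exp (- \<theta> * slin y q z)" for q z
  define T where "T z = (\<Sum>q\<in>Q. E q z)" for z
  have Epos: "E q z > 0" for q z by (simp add: E_def)
  have T: "T z > 0" for z unfolding T_def using Q Epos by (intro sum_pos) auto
  have E1: "C1_torus (E q) (\<lambda>z. (- \<theta> * E q z) *\<^sub>R Dslin y q z)" for q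
  proof -
    have "C1_torus (\<lambda>z. exp (- \<theta> * slin y q z)) (\<lambda>z. (- \<theta> * exp (- \<theta> * slin y q z)) *\<^sub>R Dslin y q z)"
      by (rule C1_torus_chain[OF C1_torus_slin, where F = "\<lambda>s. exp (- \<theta> * s)"
            and F' = "\<lambda>s. - \<theta> * exp (- \<theta> * s)"])
        (auto intro!: derivative_eq_intros continuous_intros C1_torus_continuous[OF C1_torus_slin])
    then show ?thesis by (simp add: E_def[abs_def])
  qed
  have T1: "C1_torus T (\<lambda>z. \<Sum>q\<in>Q. (- \<theta> * E q z) *\<^sub>R Dslin y q z)"
    unfolding T_def by (intro C1_torus_sum Q E1)
  define g where "g z = (ln N - ln (T z)) / \<theta>" for z
  define Dg where "Dg z = (- 1 / (\<theta> * T z)) *\<^sub>R (\<Sum>q\<in>Q. (- \<theta> * E q z) *\<^sub>R Dslin y q z)" for z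
  have "C1_torus g Dg"
    unfolding g_def Dg_def
  proof (rule C1_torus_chain[OF T1, where F = "\<lambda>s. (ln N - ln s) / \<theta>" and F' = "\<lambda>s. - 1 / (\<theta> * s)"])
    fix z
    show "((\<lambda>s. (ln N - ln s) / \<theta>) has_real_derivative - 1 / (\<theta> * T z)) (at (T z))"
      using T[of z] \<theta> by (auto intro!: derivative_eq_intros simp: field_simps)
  next
    show "continuous_on UNIV (\<lambda>z. - 1 / (\<theta> * T z))"
      using T \<theta> by (intro continuous_intros C1_torus_continuous[OF T1])
        (metis less_irrefl mult_eq_0_iff)
  qed
  moreover have "g y = 0" by (simp add: g_def T_def E_def N_def)
  moreover have "g z \<le> slin y q z + \<epsilon>" if "q \<in> Q" for z q
  proof -
    have "E q z \<le> T z" unfolding T_def using Q(1) that Epos by (intro member_le_sum) (auto simp: less_imp_le)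
    then have "- \<theta> * slin y q z \<le> ln (T z)" using ln_mono[OF _ Epos] by (fastforce simp: E_def)
    then have "g z \<le> (ln N + \<theta> * slin y q z) / \<theta>"
      unfolding g_def using \<theta> by (intro divide_right_mono) auto
    also have "\<dots> = ln N / \<theta> + slin y q z" using \<theta> by (simp add: add_divide_distrib)
    finally show ?thesis using ln_le by simp
  qed
  moreover have "\<exists>m\<in>convex hull Q. Dg z = Dslin y m z" for z
  proof
    define m where "m = (\<Sum>q\<in>Q. (E q z / T z) *\<^sub>R q)"
    show "m \<in> convex hull Q"
      unfolding m_def
    proof (rule convex_sum)
      show "(\<Sum>q\<in>Q. E q z / T z) = 1"
        using T[of z] by (simp add: T_def flip: sum_divide_distrib)
    qed (use Q Epos T in \<open>auto simp: less_imp_le hull_inc\<close>)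
    have "Dg z $ j = Dslin y m z $ j" for j
    proof -
      have "Dg z $ j = (\<Sum>q\<in>Q. (E q z / T z) * (q $ j * cos (2 * pi * (z $ j - y $ j))))"
        using \<theta> T[of z] by (simp add: Dg_def Dslin_def sum_distrib_left sum_negf)
      also have "\<dots> = Dslin y m z $ j" by (simp add: Dslin_def m_def sum_distrib_right mult.assoc)
      finally show ?thesis .
    qed
    then show "Dg z = Dslin y m z" by (simp add: vec_eq_iff)
  qed
  ultimately show ?thesis by (rule that)
qed

lemma sqd_le_norm_square: "sqd y z \<le> pi\<^sup>2 * (norm (z - y))\<^sup>2"
proof -
  have "(sin (pi * t))\<^sup>2 \<le> pi\<^sup>2 * t\<^sup>2" for t :: real
    using abs_sin_x_le_abs_x[of "pi * t"] by (simp add: abs_le_square_iff power_mult_distrib)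
  then show ?thesis unfolding sqd_def norm_square_sum by (simp add: sum_distrib_left sum_mono)
qed

lemma Dslin_near: "norm (Dslin y m z - m) \<le> 2 * pi * norm m * norm (z - y)"
proof -
  have c: "\<bar>cos t - 1\<bar> \<le> \<bar>t\<bar>" for t :: real
  proof -
    have "cos t = 1 - 2 * (sin (t / 2))\<^sup>2" using cos_double_sin[of "t / 2"] by simp
    then have "\<bar>cos t - 1\<bar> = 2 * (\<bar>sin (t / 2)\<bar> * \<bar>sin (t / 2)\<bar>)"
      by (simp add: power2_eq_square abs_mult)
    also have "\<dots> \<le> 2 * (1 * \<bar>t / 2\<bar>)"
      by (intro mult_left_mono mult_mono abs_sin_le_one abs_sin_x_le_abs_x) auto
    finally show ?thesis by simp
  qed
  have "norm (Dslin y m z - m) \<le> norm ((2 * pi * norm (z - y)) *\<^sub>R m)"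
  proof (rule norm_le_componentwise_cart)
    fix j
    have "(Dslin y m z - m) $ j = m $ j * (cos (2 * pi * (z $ j - y $ j)) - 1)"
      by (simp add: Dslin_def algebra_simps)
    also have "norm \<dots> \<le> \<bar>m $ j\<bar> * \<bar>2 * pi * (z $ j - y $ j)\<bar>"
      unfolding real_norm_def abs_mult[of "m $ j"] by (intro mult_left_mono c) auto
    also have "\<dots> \<le> \<bar>m $ j\<bar> * (2 * pi * norm (z - y))"
      using component_le_norm_cart[of "z - y" j] by (intro mult_left_mono) (auto simp: abs_mult)
    finally show "norm ((Dslin y m z - m) $ j) \<le> norm (((2 * pi * norm (z - y)) *\<^sub>R m) $ j)"
      by (simp add: abs_mult mult.commute)
  qed
  then show ?thesis by (simp add: mult_ac)
qed

context weakly_coupled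
begin

text \<open>A strict component can be replaced near \<open>y\<close> by a \<open>C\<^sup>1\<close> function lying above it by exactly
  \<open>\<epsilon>\<close> at \<open>y\<close>. The replacement is a smoothed concave cone with vertex \<open>y\<close> whose
  gradients stay in the open sublevel set left by strictness, and which decreases
  faster than the component can, since the gradients of the component lie in a smaller
  compact sublevel set.\<close>

lemma smooth_cap:
  assumes u: "subsolution H A \<alpha> u" and st: "strict_at \<alpha> u y i"
  shows "\<exists>\<delta>>0. \<exists>\<epsilon>0>0. \<forall>\<epsilon>. 0 < \<epsilon> \<and> \<epsilon> \<le> \<epsilon>0 \<longrightarrow> (\<exists>h Dh. C1_torus h Dh \<and> h y = u y $ i + \<epsilon> \<and>
    (\<forall>z. u z $ i < h z \<longrightarrow> H i z (Dh z) + (A *v u z) $ i + A $ i $ i * (h z - u z $ i) \<le> \<alpha> - \<delta>))"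
proof -
  obtain \<delta> r where \<delta>: "\<delta> > 0" "r > 0" and st': "\<And>x p. norm (x - y) < r \<Longrightarrow>
     p \<in> superdiff (\<lambda>z. u z $ i) x \<Longrightarrow> H i x p + (A *v u x) $ i \<le> \<alpha> - \<delta>"
    using st unfolding strict_at_def by blast
  have "\<delta> / 4 > 0" using \<delta> by simp
  define K where "K = {q. H i y q \<le> \<alpha> - \<delta> + \<delta> / 4 - (A *v u y) $ i}"
  obtain s where s: "s > 0" "\<And>x p. norm (x - y) < s \<Longrightarrow> p \<in> superdiff (\<lambda>z. u z $ i) x \<Longrightarrow> p \<in> K"
    using superdiff_in_sublevel_nearby[OF u \<delta>(2) \<open>\<delta> / 4 > 0\<close> st'] unfolding K_def by metis
  have K: "compact K" unfolding K_def by (rule H_sublevel_compact_convex)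
  obtain z0 p0 where "norm (z0 - y) < s" "p0 \<in> superdiff (\<lambda>z. u z $ i) z0"
    using superdiff_nonempty_nearby[OF subsolution_continuous(1)[OF u] s(1)] by metis
  then have "K \<noteq> {}" using s(2) by blast
  define V where "V = {q. H i y q < \<alpha> - \<delta> / 2 - (A *v u y) $ i}"
  have "open V" unfolding V_def by (intro open_Collect_less continuous_intros)
  have "K \<subseteq> V" using \<delta>(1) by (auto simp: K_def V_def)
  obtain Q \<kappa> where Q: "finite Q" "Q \<noteq> {}" "Q \<subseteq> V" "\<kappa> > 0"
    "\<And>k h. k \<in> K \<Longrightarrow> \<exists>q\<in>Q. q \<bullet> h \<le> k \<bullet> h - \<kappa> * norm h"
    using finite_cage[OF K \<open>K \<noteq> {}\<close> \<open>open V\<close> \<open>K \<subseteq> V\<close>] by metis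
  define c0 where "c0 = \<alpha> - \<delta> / 2 - (A *v u y) $ i"
  have hull: "H i y m \<le> c0" if "m \<in> convex hull Q" for m
  proof -
    have "convex hull Q \<subseteq> {q. H i y q \<le> c0}"
      using Q(3) by (intro hull_minimal H_sublevel_compact_convex) (auto simp: V_def c0_def)
    then show ?thesis using that by blast
  qed
  obtain M where M: "M > 0" "\<And>m. m \<in> convex hull Q \<Longrightarrow> norm m \<le> M"
    using compact_imp_bounded[OF finite_imp_compact_convex_hull[OF Q(1)]] bounded_pos by metis
  have "\<delta> / 8 > 0" using \<delta> by simp
  obtain r1 where r1: "r1 > 0" "\<And>i x x' p p'. x \<in> cball y 1 \<Longrightarrow> x' \<in> cball y 1 \<Longrightarrow> norm p \<le> M + 1 \<Longrightarrow>
      norm p' \<le> M + 1 \<Longrightarrow> norm (x - x') < r1 \<Longrightarrow> norm (p - p') < r1 \<Longrightarrow> \<bar>H i x p - H i x' p'\<bar> < \<delta> / 8"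
    using H_uniformly_continuous[OF \<open>\<delta> / 8 > 0\<close>, of y "M + 1"] by metis
  obtain r2 where r2: "r2 > 0" "\<And>x. norm (x - y) < r2 \<Longrightarrow> \<bar>(A *v u x) $ i - (A *v u y) $ i\<bar> < \<delta> / 8"
    using subsolution_continuous(2)[OF u, of UNIV i] \<open>\<delta> / 8 > 0\<close>
    unfolding continuous_on_iff dist_norm real_norm_def by (metis UNIV_I)
  \<comment> \<open>Within radius \<open>R\<close> the second order error of \<open>slin\<close> costs at most half of the slope \<open>\<kappa>\<close> of the cone,
    and \<open>H\<close> and the coupling term vary by less than \<open>\<delta> / 8\<close>.\<close>
  define R where "R = min (min (min s 1) (min r1 r2))
    (min (min (1 / (2 * pi * M)) (r1 / (2 * pi * M))) (\<kappa> / (2 * pi * M)))"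
  have pM: "2 * pi * M > 0" using M by simp
  have R: "R > 0" using s r1(1) r2(1) Q(4) pM by (simp add: R_def)
  have "R \<le> 1 / (2 * pi * M)" "R \<le> r1 / (2 * pi * M)" "R \<le> \<kappa> / (2 * pi * M)"
    by (auto simp: R_def min_le_iff_disj)
  then have R': "R * (2 * pi * M) \<le> 1" "R * (2 * pi * M) \<le> r1" "R * (2 * pi * M) \<le> \<kappa>"
    using pM by (simp_all add: pos_le_divide_eq)
  have R'': "R \<le> s" "R \<le> 1" "R \<le> r1" "R \<le> r2" by (auto simp: R_def min_le_iff_disj)
  define \<rho>1 where "\<rho>1 = R\<^sup>2 / 4"
  have \<rho>1: "\<rho>1 > 0" "\<rho>1 < R\<^sup>2" using R by (auto simp: \<rho>1_def)
  have a1: "A $ i $ i + 1 > 0" using A_diagonal_nonneg[of i] by simp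
  \<comment> \<open>A cap of this height has dropped below the component on the region \<open>\<rho>1 \<le> sqd y z < R\<^sup>2\<close>,
    and raising the component by \<open>2 \<epsilon>\<close> costs at most \<open>\<delta> / 8\<close> in its own equation.\<close>
  define \<epsilon>0 where "\<epsilon>0 = min (\<kappa> * R / (16 * pi)) (\<delta> / (16 * (A $ i $ i + 1)))"
  have \<epsilon>0: "\<epsilon>0 > 0" using Q(4) R \<delta> a1 by (simp add: \<epsilon>0_def)
  have "\<exists>h Dh. C1_torus h Dh \<and> h y = u y $ i + \<epsilon> \<and>
      (\<forall>z. u z $ i < h z \<longrightarrow> H i z (Dh z) + (A *v u z) $ i + A $ i $ i * (h z - u z $ i) \<le> \<alpha> - \<delta> / 8)"
    if "0 < \<epsilon> \<and> \<epsilon> \<le> \<epsilon>0" for \<epsilon>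
  proof -
    from that have \<epsilon>: "\<epsilon> > 0" "\<epsilon> \<le> \<kappa> * R / (16 * pi)" "\<epsilon> \<le> \<delta> / (16 * (A $ i $ i + 1))"
      by (auto simp: \<epsilon>0_def)
    have e1: "\<epsilon> * (16 * pi) \<le> \<kappa> * R" and e2: "\<epsilon> * (16 * (A $ i $ i + 1)) \<le> \<delta>"
      using \<epsilon>(2,3) a1 by (simp_all add: pos_le_divide_eq)
    obtain g Dg where g: "C1_torus g Dg" "g y = 0"
      "\<And>z q. q \<in> Q \<Longrightarrow> g z \<le> slin y q z + \<epsilon>" "\<And>z. \<exists>m\<in>convex hull Q. Dg z = Dslin y m z"
      using smooth_minimum[OF Q(1,2) \<epsilon>(1), of y] by metis
    define G where "G z = g z + (u y $ i + \<epsilon>)" for z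
    have G: "C1_torus G Dg"
      using C1_torus_add[OF g(1) C1_torus_const] unfolding G_def by simp
    have cone: "G z \<le> u z $ i + 2 * \<epsilon> - \<kappa> / 2 * norm (z - y)" if z: "norm (z - y) < R" for z
    proof -
      let ?h = "z - y"
      obtain k where k: "k \<in> K" "\<And>k'. k' \<in> K \<Longrightarrow> (- ?h) \<bullet> k' \<le> (- ?h) \<bullet> k"
        "\<And>w t. norm (w - y) < s \<Longrightarrow> norm (w + t *\<^sub>R (- ?h) - y) < s \<Longrightarrow>
            0 \<le> t \<Longrightarrow> u (w + t *\<^sub>R (- ?h)) $ i \<le> u w $ i + ((- ?h) \<bullet> k) * t"
      proof (rule increment_le_support[OF subsolution_continuous(1)[OF u, where i = i] K s(1),
            where e = "- ?h" and ?x0.0 = y])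
        show "p \<in> K" if "norm (x - y) < s" "p \<in> superdiff (\<lambda>z. u z $ i) x" for x p
          using that by (rule s(2))
      qed (rule that)
      have uy: "u y $ i \<le> u z $ i - ?h \<bullet> k"
        using k(3)[of z 1] z R'' s(1) unfolding scaleR_one inner_minus_left by simp
      from Q(5)[OF k(1), of ?h] obtain q where q: "q \<in> Q" "q \<bullet> ?h \<le> k \<bullet> ?h - \<kappa> * norm ?h" by blast
      have "norm q \<le> M" using M(2) hull_inc[of q Q] q(1) by blast
      then have "pi * norm q * (norm ?h)\<^sup>2 \<le> pi * M * (norm ?h)\<^sup>2"
        by (intro mult_right_mono mult_left_mono) auto
      also have "\<dots> = (pi * M * norm ?h) * norm ?h" by (simp add: power2_eq_square)
      also have "\<dots> \<le> \<kappa> / 2 * norm ?h"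
      proof (intro mult_right_mono)
        have "norm ?h * (2 * pi * M) \<le> R * (2 * pi * M)" using z pM by (intro mult_right_mono) auto
        with R'(3) show "pi * M * norm ?h \<le> \<kappa> / 2" by (simp add: mult_ac)
      qed simp
      finally have "pi * norm q * (norm ?h)\<^sup>2 \<le> \<kappa> / 2 * norm ?h" .
      with slin_approx[of y q z] have "slin y q z \<le> q \<bullet> ?h + \<kappa> / 2 * norm ?h" by linarith
      moreover have "?h \<bullet> k = k \<bullet> ?h" by (rule inner_commute)
      moreover have "\<kappa> * norm ?h = \<kappa> / 2 * norm ?h + \<kappa> / 2 * norm ?h" by simp
      ultimately show ?thesis using g(3)[OF q(1), of z] uy q(2) unfolding G_def by linarith
    qed
    have shift: "\<exists>k. (\<forall>j. k $ j \<in> \<int>) \<and> norm (z + k - y) < R" if "sqd y z < R\<^sup>2" for z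
    proof -
      obtain k where k: "\<forall>j. k $ j \<in> \<int>" "(norm (z + k - y))\<^sup>2 \<le> sqd y z" by (rule lattice_distance_le_sqd)
      with that have "(norm (z + k - y))\<^sup>2 < R\<^sup>2" by linarith
      then have "norm (z + k - y) < R" using R by (simp add: power2_less_imp_less)
      with k(1) show ?thesis by blast
    qed
    have Gper: "G (z + k) = G z" "Dg (z + k) = Dg z" if "\<forall>j. k $ j \<in> \<int>" for z k
      using G that C1_torus_gradient_shift[OF G that] by (auto simp: C1_torus_def zperiodic_def)
    have below: "G z < u z $ i" if z: "\<rho>1 \<le> sqd y z" "sqd y z < R\<^sup>2" for z
    proof -
      obtain k where k: "\<forall>j. k $ j \<in> \<int>" "norm (z + k - y) < R" using shift[OF z(2)] by blast
      let ?n = "norm (z + k - y)"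
      have "sqd y (z + k) = sqd y z" using zperiodic_sqd[of y] k(1) by (simp add: zperiodic_def)
      then have "(R / 2)\<^sup>2 \<le> (pi * ?n)\<^sup>2"
        using z(1) sqd_le_norm_square[of y "z + k"] by (simp add: \<rho>1_def power_mult_distrib power_divide)
      then have "R / 2 \<le> pi * ?n" by (rule power2_le_imp_le) simp
      then have "\<kappa> * (R / 2) \<le> \<kappa> * (pi * ?n)" using Q(4) by (intro mult_left_mono) auto
      moreover have "pi * (8 * \<epsilon>) = \<epsilon> * (16 * pi) / 2" "pi * (\<kappa> * ?n) = \<kappa> * (pi * ?n)"
        "\<kappa> * (R / 2) = \<kappa> * R / 2" by simp_all
      ultimately have "pi * (8 * \<epsilon>) \<le> pi * (\<kappa> * ?n)" using e1 by linarith
      then have "8 * \<epsilon> \<le> \<kappa> * ?n" by (rule mult_left_le_imp_le) simp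
      with cone[OF k(2)] \<epsilon>(1) have "G (z + k) < u (z + k) $ i" by simp
      then show ?thesis using Gper(1)[OF k(1)] subsolution_shift[OF u k(1)] by simp
    qed
    have "zperiodic (\<lambda>z. G z - u z $ i)"
      using G u by (simp add: C1_torus_def zperiodic_def subsolution_def)
    moreover have "continuous_on UNIV (\<lambda>z. G z - u z $ i)"
      by (intro continuous_intros C1_torus_continuous[OF G] subsolution_continuous[OF u])
    ultimately obtain B where "\<And>z. \<bar>G z - u z $ i\<bar> \<le> B" by (rule zperiodic_bounded) blast
    then have B: "G z - u z $ i \<le> B" for z by (meson abs_le_D1)
    from C1_torus_push_below[where f = "\<lambda>z. u z $ i", OF G B \<rho>1(2) below]
    obtain h Dh where h: "C1_torus h Dh"
      "\<And>z. sqd y z \<le> \<rho>1 \<Longrightarrow> h z = G z \<and> Dh z = Dg z"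
      "\<And>z. \<rho>1 \<le> sqd y z \<Longrightarrow> h z < u z $ i" by blast
    have "h y = u y $ i + \<epsilon>" using h(2)[of y] \<rho>1 g(2) by (simp add: G_def)
    moreover have "H i z (Dh z) + (A *v u z) $ i + A $ i $ i * (h z - u z $ i) \<le> \<alpha> - \<delta> / 8"
      if hz: "u z $ i < h z" for z
    proof -
      have z1: "sqd y z < \<rho>1" using h(3)[of z] hz by (meson less_asym not_le)
      then have "sqd y z < R\<^sup>2" using \<rho>1 by simp
      then obtain k where k: "\<forall>j. k $ j \<in> \<int>" "norm (z + k - y) < R" using shift by blast
      define x where "x = z + k"
      have x: "norm (x - y) < R" using k(2) by (simp add: x_def)
      have hx: "h z = G x" "Dh z = Dg x" "u z = u x"
        using h(2)[of z] z1 Gper[OF k(1)] subsolution_shift[OF u k(1)] by (auto simp: x_def)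
      have Hx: "H i z p = H i x p" for p using H_shift[OF k(1)] by (simp add: x_def)
      obtain m where m: "m \<in> convex hull Q" "Dg x = Dslin y m x" using g(4) by blast
      have "norm (Dg x - m) \<le> 2 * pi * norm m * norm (x - y)" unfolding m(2) by (rule Dslin_near)
      also have "\<dots> \<le> 2 * pi * M * norm (x - y)"
        using M(2)[OF m(1)] by (intro mult_right_mono mult_left_mono) auto
      also have "\<dots> < R * (2 * pi * M)"
        using mult_strict_left_mono[OF x pM] by (simp only: mult.commute)
      finally have d: "norm (Dg x - m) < R * (2 * pi * M)" .
      have "norm (Dg x) \<le> norm (Dg x - m) + norm m" using norm_triangle_ineq[of "Dg x - m" m] by simp
      then have "norm (Dg x) \<le> M + 1" using d R'(1) M(2)[OF m(1)] by linarith
      moreover have "norm m \<le> M + 1" using M(2)[OF m(1)] by simp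
      moreover have "x \<in> cball y 1" using x R'' by (simp add: dist_norm norm_minus_commute)
      moreover have "y \<in> cball y 1" by simp
      moreover have "norm (x - y) < r1" using x R'' by simp
      moreover have "norm (Dg x - m) < r1" using d R'(2) by simp
      ultimately have "\<bar>H i x (Dg x) - H i y m\<bar> < \<delta> / 8" by (intro r1(2))
      moreover have "\<bar>(A *v u x) $ i - (A *v u y) $ i\<bar> < \<delta> / 8" using x R'' by (intro r2(2)) simp
      moreover have "H i y m \<le> \<alpha> - \<delta> / 2 - (A *v u y) $ i" using hull[OF m(1)] by (simp add: c0_def)
      moreover have "A $ i $ i * (G x - u x $ i) \<le> \<delta> / 8"
      proof -
        have "0 \<le> \<kappa> / 2 * norm (x - y)" using Q(4) by simp
        then have "G x - u x $ i \<le> 2 * \<epsilon>" using cone[OF x] by linarith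
        then have "A $ i $ i * (G x - u x $ i) \<le> A $ i $ i * (2 * \<epsilon>)"
          by (intro mult_left_mono A_diagonal_nonneg)
        then show ?thesis using e2 \<epsilon>(1) by (simp add: algebra_simps)
      qed
      ultimately show ?thesis unfolding Hx hx by linarith
    qed
    ultimately show ?thesis using h(1) by blast
  qed
  with \<open>\<delta> / 8 > 0\<close> \<epsilon>0 show ?thesis by blast
qed

text \<open>Capping all components by the same amount \<open>\<epsilon>\<close> and subtracting the constant vector with
  entries \<open>\<epsilon>\<close>, which the coupling does not see, restores the value at \<open>y\<close>.\<close>

lemma smooth_strict_with_same_value:
  assumes u: "subsolution H A \<alpha> u" and st: "\<And>j. strict_at \<alpha> u y j"
  obtains w \<delta> U where "subsolution H A \<alpha> w" "w y = u y" "\<delta> > 0" "open U" "y \<in> U"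
    "\<And>i x. x \<in> U \<Longrightarrow> \<exists>p. GDERIV (\<lambda>z. w z $ i) x :> p \<and> H i x p + (A *v w x) $ i \<le> \<alpha> - \<delta>"
proof -
  have "\<forall>i. \<exists>\<delta> \<epsilon>0. \<delta> > 0 \<and> \<epsilon>0 > 0 \<and> (\<forall>\<epsilon>. 0 < \<epsilon> \<and> \<epsilon> \<le> \<epsilon>0 \<longrightarrow> (\<exists>h Dh. C1_torus h Dh \<and> h y = u y $ i + \<epsilon> \<and>
    (\<forall>z. u z $ i < h z \<longrightarrow> H i z (Dh z) + (A *v u z) $ i + A $ i $ i * (h z - u z $ i) \<le> \<alpha> - \<delta>)))"
    using smooth_cap[OF u st] by blast
  then obtain d e where de: "\<And>i. d i > 0" "\<And>i. e i > 0"
    "\<And>i \<epsilon>. 0 < \<epsilon> \<and> \<epsilon> \<le> e i \<Longrightarrow> (\<exists>h Dh. C1_torus h Dh \<and> h y = u y $ i + \<epsilon> \<and>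
    (\<forall>z. u z $ i < h z \<longrightarrow> H i z (Dh z) + (A *v u z) $ i + A $ i $ i * (h z - u z $ i) \<le> \<alpha> - d i))"
    by metis
  define \<epsilon> where "\<epsilon> = Min (range e)"
  define \<delta> where "\<delta> = Min (range d)"
  have \<epsilon>: "0 < \<epsilon>" "\<And>i. \<epsilon> \<le> e i" and \<delta>: "\<delta> > 0" "\<And>i. \<delta> \<le> d i" using de(1,2) by (auto simp: \<epsilon>_def \<delta>_def)
  have "\<forall>i. \<exists>h Dh. C1_torus h Dh \<and> h y = u y $ i + \<epsilon> \<and>
    (\<forall>z. u z $ i < h z \<longrightarrow> H i z (Dh z) + (A *v u z) $ i + A $ i $ i * (h z - u z $ i) \<le> \<alpha> - d i)"
    using de(3) \<epsilon> by blast
  then obtain h Dh where h: "\<And>i. C1_torus (h i) (Dh i)" "\<And>i. h i y = u y $ i + \<epsilon>"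
    "\<And>i z. u z $ i < h i z \<Longrightarrow>
      H i z (Dh i z) + (A *v u z) $ i + A $ i $ i * (h i z - u z $ i) \<le> \<alpha> - d i" by metis
  define v where "v z = (\<chi> i. max (u z $ i) (h i z))" for z
  have v: "subsolution H A \<alpha> v"
    unfolding v_def
  proof (rule subsolution_max[OF u h(1)])
    show "H i z (Dh i z) + (A *v u z) $ i + A $ i $ i * (h i z - u z $ i) \<le> \<alpha>"
      if "u z $ i < h i z" for i z using h(3)[OF that] de(1)[of i] by linarith
  qed
  define w where "w z = v z + (\<chi> i. - \<epsilon>)" for z
  have Aw: "A *v w z = A *v v z" for z unfolding w_def by (rule coupling_const)
  have "subsolution H A \<alpha> w"
    unfolding subsolution_iff_superdiff
  proof (intro conjI allI ballI)
    show "zperiodic w" using v by (simp add: subsolution_def zperiodic_def w_def)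
    show "continuous_on UNIV w" using v unfolding w_def by (intro continuous_intros) (simp add: subsolution_def)
    fix i x p assume "p \<in> superdiff (\<lambda>z. w z $ i) x"
    then have "p \<in> superdiff (\<lambda>z. v z $ i + - \<epsilon>) x" by (simp add: w_def)
    from superdiff_add_C1[OF this C1_torus_const] have "p \<in> superdiff (\<lambda>z. v z $ i) x" by simp
    from subsolution_superdiff[OF v this] show "H i x p + (A *v w x) $ i \<le> \<alpha>" unfolding Aw .
  qed
  moreover have "w y = u y" using h(2) \<epsilon>(1) by (simp add: w_def v_def vec_eq_iff)
  moreover note \<delta>(1)
  moreover define U where "U = (\<Inter>i. {z. u z $ i < h i z})"
  have oi: "open {z. u z $ i < h i z}" for i
    by (intro open_Collect_less subsolution_continuous[OF u] C1_torus_continuous[OF h(1)])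
  have "open U" unfolding U_def using oi by (intro open_INT) auto
  moreover have "y \<in> U" using h(2) \<epsilon>(1) by (simp add: U_def)
  moreover have "\<exists>p. GDERIV (\<lambda>z. w z $ i) x :> p \<and> H i x p + (A *v w x) $ i \<le> \<alpha> - \<delta>" if x: "x \<in> U" for i x
  proof (intro exI conjI)
    have xi: "u x $ i < h i x" using x by (simp add: U_def)
    have "((\<lambda>z. h i z - \<epsilon>) has_derivative (\<lambda>t. t \<bullet> Dh i x)) (at x)"
      using h(1)[of i] by (auto simp: C1_torus_def gderiv_def intro!: derivative_eq_intros)
    then show "GDERIV (\<lambda>z. w z $ i) x :> Dh i x"
      unfolding gderiv_def
      by (rule has_derivative_transform_within_open[OF _ oi[of i]]) (use xi in \<open>auto simp: w_def v_def\<close>)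
    have "(A *v v x) $ i \<le> (A *v u x) $ i + A $ i $ i * (v x $ i - u x $ i)"
      by (rule coupling_mono) (simp add: v_def)
    moreover have "v x $ i = h i x" using xi by (simp add: v_def)
    ultimately show "H i x (Dh i x) + (A *v w x) $ i \<le> \<alpha> - \<delta>"
      using h(3)[OF xi] \<delta>(2)[of i] unfolding Aw by simp
  qed
  ultimately show ?thesis by (rule that)
qed

section \<open>Points outside the Aubry set\<close>

lemma strict_subsolution_outside_aubry:
  assumes y: "y \<notin> aubry_set H A"
  obtains u where "critical_subsolution H A u" "\<And>j. strict_at (critical_value H A) u y j"
proof -
  let ?\<beta> = "critical_value H A"
  from y obtain b where b: "b \<in> critical_subsolution_values H A y"
    "\<And>u. maximal_critical_subsolution H A y b u \<Longrightarrow> \<not> critical_solution H A u"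
    unfolding aubry_set_def by blast
  then obtain u0 where "critical_subsolution H A u0" "u0 y = b"
    unfolding critical_subsolution_values_def by blast
  then obtain u where u: "critical_subsolution H A u" "u y = b"
    "\<And>v z i. critical_subsolution H A v \<Longrightarrow> v y = b \<Longrightarrow> v z $ i \<le> u z $ i"
    using maximal_subsolution_exists[of ?\<beta> u0 y b] by metis
  then have "maximal_critical_subsolution H A y b u"
    unfolding maximal_critical_subsolution_def by blast
  then have "\<not> supersolution H A ?\<beta> u" using b(2) u(1) by (auto simp: solution_def)
  then obtain i x \<phi> D\<phi> where \<phi>: "C1_torus \<phi> D\<phi>" "local_min_at (\<lambda>z. u z $ i - \<phi> z) x"
    "\<not> H i x (D\<phi> x) + (\<Sum>j\<in>UNIV. A $ i $ j * u x $ j) \<ge> ?\<beta>"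
    using u(1) unfolding supersolution_def subsolution_def by blast
  then have fails: "H i x (D\<phi> x) + (A *v u x) $ i < ?\<beta>" by (simp add: matrix_vector_mult_def)
  have "sqd x y = 0"
  proof (rule ccontr)
    \<comment> \<open>Away from \<open>y + \<int>\<^sup>N\<close> the bump would contradict maximality.\<close>
    assume "sqd x y \<noteq> 0"
    then have pos: "sqd x y > 0" using sqd_nonneg[of x y] by simp
    from bump_where_supersolution_fails[OF u(1) \<phi>(1,2) fails pos]
    obtain v where v: "critical_subsolution H A v" "\<And>z. sqd x y \<le> sqd x z \<Longrightarrow> v z = u z"
      "u x $ i < v x $ i" by metis
    have "v y = b" using v(2)[of y] u(2) by simp
    from u(3)[OF v(1) this, of x i] v(3) show False by simp
  qed
  obtain k where k: "\<forall>j. k $ j \<in> \<int>" "(norm (y + k - x))\<^sup>2 \<le> sqd x y" by (rule lattice_distance_le_sqd)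
  then have xk: "x = y + k" using \<open>sqd x y = 0\<close> by simp
  obtain v where v: "critical_subsolution H A v" "strict_at ?\<beta> v x i"
    using bump_where_supersolution_fails[OF u(1) \<phi>(1,2) fails zero_less_one] by metis
  from v obtain w where w: "critical_subsolution H A w" "\<And>j. strict_at ?\<beta> w x j"
    using strict_everywhere_from_one by metis
  have "strict_at ?\<beta> w y j" for j
  proof -
    obtain \<delta> r where \<delta>: "\<delta> > 0" "r > 0" "\<And>z p. norm (z - x) < r \<Longrightarrow>
       p \<in> superdiff (\<lambda>z. w z $ j) z \<Longrightarrow> H j z p + (A *v w z) $ j \<le> ?\<beta> - \<delta>"
      using w(2)[of j] unfolding strict_at_def by blast
    have "H j z p + (A *v w z) $ j \<le> ?\<beta> - \<delta>"
      if z: "norm (z - y) < r" "p \<in> superdiff (\<lambda>z. w z $ j) z" for z p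
    proof -
      have "zperiodic (\<lambda>z. w z $ j)" using w(1) by (simp add: subsolution_def zperiodic_component)
      from superdiff_shift[OF z(2) this k(1)] have "p \<in> superdiff (\<lambda>z. w z $ j) (z + k)" .
      moreover have "norm (z + k - x) < r" using z(1) by (simp add: xk)
      ultimately have "H j (z + k) p + (A *v w (z + k)) $ j \<le> ?\<beta> - \<delta>" by (intro \<delta>(3))
      then show ?thesis by (simp add: H_shift[OF k(1)] subsolution_shift[OF w(1) k(1)])
    qed
    with \<delta>(1,2) show ?thesis unfolding strict_at_def by blast
  qed
  with w(1) that show ?thesis by blast
qed

end

theorem proposition2p6:
  fixes H :: "'m::finite \<Rightarrow> real^'n::finite \<Rightarrow> real^'n \<Rightarrow> real"
    and A :: "real^'m^'m"
    and y :: "real^'n"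
  assumes "CARD('m) \<ge> 2"
    and "\<And>i p. zperiodic (\<lambda>x. H i x p)"
    and "\<And>i. continuous_on UNIV (\<lambda>(x, p). H i x p)"
    and "\<And>i x. convex_on UNIV (H i x)"
    and "\<And>i x. filterlim (\<lambda>p. H i x p / norm p) at_top at_infinity"
    and "\<And>i j. i \<noteq> j \<Longrightarrow> A $ i $ j \<le> 0"
    and "\<And>i. (\<Sum>j\<in>UNIV. A $ i $ j) = 0"
    and "irreducible_coupling A"
    and "y \<notin> aubry_set H A"
  shows "interior (critical_subsolution_values H A y) \<noteq> {} \<and>
    (\<forall>b. b \<in> interior (critical_subsolution_values H A y) \<longleftrightarrow>
       (\<exists>u. critical_subsolution H A u \<and> locally_strict_at H A u y \<and> u y = b))"
proof -
  interpret weakly_coupled H A using assms(2-8) by unfold_locales auto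
  let ?\<beta> = "critical_value H A" and ?F = "critical_subsolution_values H A y"
  obtain u0 where u0: "critical_subsolution H A u0" "\<And>j. strict_at ?\<beta> u0 y j"
    using strict_subsolution_outside_aubry[OF assms(9)] by metis
  have F: "?F = {b. \<exists>v. critical_subsolution H A v \<and> v y = b}"
    by (simp add: critical_subsolution_values_def)
  have "u0 y \<in> interior ?F" unfolding F by (rule strict_value_interior[OF u0])
  moreover have "\<exists>u. critical_subsolution H A u \<and> locally_strict_at H A u y \<and> u y = b"
    if b: "b \<in> interior ?F" for b
  proof -
    \<comment> \<open>Move from \<open>b\<close> slightly away from \<open>u0 y\<close> inside the set of values, so that \<open>b\<close> becomes a convex
      combination giving positive weight to the strict subsolution.\<close>
    obtain e where e: "e > 0" "cball b e \<subseteq> ?F" using b by (meson mem_interior_cball)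
    define n where "n = norm (b - u0 y) + e"
    have n: "n > 0" using e(1) by (simp add: n_def add_nonneg_pos)
    define b' where "b' = b + (e / n) *\<^sub>R (b - u0 y)"
    have "e / n * norm (b - u0 y) \<le> e"
      using e(1) n by (simp add: pos_divide_le_eq n_def)
    then have "b' \<in> cball b e" using e(1) n by (simp add: b'_def dist_norm)
    then obtain v where v: "critical_subsolution H A v" "v y = b'" using e(2) unfolding F by blast
    define s where "s = n / (n + e)"
    have s: "0 \<le> s" "s < 1" using e(1) n by (auto simp: s_def)
    have "1 + e / n = (n + e) / n" using n by (simp add: add_divide_distrib)
    then have "s * (1 + e / n) = 1" using e(1) n by (simp add: s_def)
    then have b_eq: "(1 - s) *\<^sub>R u0 y + s *\<^sub>R b' = b"
    proof -
      have "(1 - s) *\<^sub>R u0 y + s *\<^sub>R b' = u0 y + (s * (1 + e / n)) *\<^sub>R (b - u0 y)"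
        by (simp add: b'_def algebra_simps)
      then show ?thesis using \<open>s * (1 + e / n) = 1\<close> by simp
    qed
    let ?w = "\<lambda>z. (1 - s) *\<^sub>R u0 z + s *\<^sub>R v z"
    have w0: "critical_subsolution H A ?w" "\<And>j. strict_at ?\<beta> ?w y j"
      by (rule strict_convex_combination[OF u0 v(1) s])+
    obtain w \<delta> U where w: "critical_subsolution H A w" "w y = ?w y" "\<delta> > 0" "open U" "y \<in> U"
      "\<And>i x. x \<in> U \<Longrightarrow> \<exists>p. GDERIV (\<lambda>z. w z $ i) x :> p \<and> H i x p + (A *v w x) $ i \<le> ?\<beta> - \<delta>"
    proof (rule smooth_strict_with_same_value[OF w0])
    qed (rule that)
    have "locally_strict_at H A w y"
      unfolding locally_strict_at_def
      using w(3-6) by (intro exI[of _ U] exI[of _ \<delta>]) (auto simp: matrix_vector_mult_def)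
    moreover have "w y = b" using w(2) v(2) b_eq by simp
    ultimately show ?thesis using w(1) by blast
  qed
  moreover have "u y \<in> interior ?F"
    if u: "critical_subsolution H A u" and strict: "locally_strict_at H A u y" for u
  proof -
    obtain U \<delta> where U: "open U" "y \<in> U" "\<delta> > 0" "\<And>i. AE x in lebesgue. x \<in> U \<longrightarrow>
        (\<exists>p. GDERIV (\<lambda>z. u z $ i) x :> p \<and> H i x p + (A *v u x) $ i \<le> ?\<beta> - \<delta>)"
      using strict unfolding locally_strict_at_def by (auto simp: matrix_vector_mult_def)
    have "strict_at ?\<beta> u y j" for j by (rule strict_at_if_ae_strict[OF u U])
    then show ?thesis unfolding F by (rule strict_value_interior[OF u])
  qed
  ultimately show ?thesis by blast
qed

end
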